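(* Let $X$ be an excited random walk in an environment satisfying (IID), (WEL) and ($\mathrm{BD}_M$), with total drift parameter $\delta$. If $\delta=1$ then there is a constant $c_4\in(0,\infty)$ such that $$\lim_{n\to\infty}(\ln n)\,P_1(T_n<T_0)=c_4,\qquad \lim_{n\to\infty}(\ln n)\,P_1(T_0>n)=2c_4.$$ Moreover, if $|\delta|=1$ then $$\lim_{n\to\infty}(\ln n)\,P_0(T_0^r>n)=c_5,\qquad c_5:=\begin{cases}2c_4\,\mathbb{E}[\omega_0(1)],&\text{if }\delta=1;\\ 2c_4\,\mathbb{E}[1-\omega_0(1)],&\text{if }\delta=-1,\end{cases}$$ where for $\delta=-1$ the symbol $c_4$ denotes the constant $c_4$ associated with the reflected environment $\tilde\omega_x(i)=1-\omega_x(i)$, $x\in\mathbb{Z}$, $i\in\mathbb{N}$ (whose drift parameter is $1$).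
   Context: Here $\mathbb{N}=\{1,2,\dots\}$. An environment is $\omega=(\omega_x(i))_{x\in\mathbb{Z},i\in\mathbb{N}}\in\Omega=[0,1]^{\mathbb{Z}\times\mathbb{N}}$, chosen according to a probability measure $\mathbb{P}$ (expectation $\mathbb{E}$) on $\Omega$ satisfying: (IID) the stacks $\omega_x=(\omega_x(i))_{i\in\mathbb{N}}$, $x\in\mathbb{Z}$, are i.i.d. under $\mathbb{P}$; (WEL) for all $x\in\mathbb{Z}$, $\mathbb{P}(\omega_x(i)>0\ \forall i\in\mathbb{N})>0$ and $\mathbb{P}(\omega_x(i)<1\ \forall i\in\mathbb{N})>0$; ($\mathrm{BD}_M$) there is a non-random integer $M\ge0$ with $\mathbb{P}(\omega_x(i)=1/2\ \forall x\in\mathbb{Z},\ i>M)=1$. Given $\omega$, let $(\eta_x(i))_{x\in\mathbb{Z},i\in\mathbb{N}}$ be independent Bernoulli random variables under a probability measure $P_\omega$ with $P_\omega(\eta_x(i)=1)=1-P_\omega(\eta_x(i)=0)=\omega_x(i)$. The excited random walk (ERW) started at $x\in\mathbb{Z}$ is defined by $X_0=x$ and $X_{n+1}=X_n+2\eta_{X_n}(\#\{k\in\{0,\dots,n\}:X_k=X_n\})-1$, $n\ge0$. Its quenched law is $P_{\omega,x}$ and the averaged law is $P_x(\cdot)=\mathbb{E}[P_{\omega,x}(\cdot)]$. The drift parameter is $\delta:=\mathbb{E}\left[\sum_{i=1}^M(2\omega_0(i)-1)\right]$. Put $T_k:=\inf\{n\ge0:X_n=k\}$ for $k\in\mathbb{Z}$,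 and $T_0^r:=\inf\{n\ge1:X_n=0\}$. *)

theory Defs
  imports "HOL-Probability.Probability"
begin

section \<open>Random environments\<close>

text \<open>
  An environment assigns to a site \<open>x\<close> and a visit number \<open>i \<ge> 1\<close> the value \<open>\<omega> (x, i) \<in> [0,1]\<close>.
  Visit numbers start at 1, so all index sets below exclude \<open>i = 0\<close>.
\<close>

abbreviation unit_interval :: "real measure" where
  "unit_interval \<equiv> restrict_space borel {0..1}"

abbreviation cookies :: "(int \<times> nat) set" where
  "cookies \<equiv> UNIV \<times> {1..}"

definition env_space :: "(int \<times> nat \<Rightarrow> real) measure" where
  "env_space = PiM cookies (\<lambda>_. unit_interval)"

definition stack_space :: "(nat \<Rightarrow> real) measure" where
  "stack_space = PiM {1..} (\<lambda>_. unit_interval)"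

definition stack :: "int \<Rightarrow> (int \<times> nat \<Rightarrow> real) \<Rightarrow> nat \<Rightarrow> real" where
  "stack x \<omega> = (\<lambda>i\<in>{1..}. \<omega> (x, i))"

definition environment_law :: "(int \<times> nat \<Rightarrow> real) measure \<Rightarrow> bool" where
  "environment_law P \<longleftrightarrow> prob_space P \<and> sets P = sets env_space"

definition iid_stacks :: "(int \<times> nat \<Rightarrow> real) measure \<Rightarrow> bool" where
  "iid_stacks P \<longleftrightarrow>
     prob_space.indep_vars P (\<lambda>_. stack_space) stack UNIV \<and>
     (\<forall>x y. distr P stack_space (stack x) = distr P stack_space (stack y))"

definition weakly_elliptic :: "(int \<times> nat \<Rightarrow> real) measure \<Rightarrow> bool" where
  "weakly_elliptic P \<longleftrightarrow>
     (\<forall>x. \<P>(\<omega> in P. \<forall>i\<ge>1. \<omega> (x, i) > 0) > 0 \<and> \<P>(\<omega> in P. \<forall>i\<ge>1. \<omega> (x, i) < 1) > 0)"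

definition bounded_cookies :: "(int \<times> nat \<Rightarrow> real) measure \<Rightarrow> nat \<Rightarrow> bool" where
  "bounded_cookies P M \<longleftrightarrow> \<P>(\<omega> in P. \<forall>x. \<forall>i>M. \<omega> (x, i) = 1/2) = 1"

definition drift :: "(int \<times> nat \<Rightarrow> real) measure \<Rightarrow> nat \<Rightarrow> real" where
  "drift P M = (\<integral>\<omega>. (\<Sum>i=1..M. 2 * \<omega> (0, i) - 1) \<partial>P)"

definition reflect :: "(int \<times> nat \<Rightarrow> real) \<Rightarrow> int \<times> nat \<Rightarrow> real" where
  "reflect \<omega> = (\<lambda>k\<in>cookies. 1 - \<omega> k)"

definition reflected_law :: "(int \<times> nat \<Rightarrow> real) measure \<Rightarrow> (int \<times> nat \<Rightarrow> real) measure" where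
  "reflected_law P = distr P env_space reflect"


section \<open>The excited random walk\<close>

definition coin_measure :: "(int \<times> nat \<Rightarrow> real) \<Rightarrow> (int \<times> nat \<Rightarrow> bool) measure" where
  "coin_measure \<omega> = PiM cookies (\<lambda>k. measure_pmf (bernoulli_pmf (\<omega> k)))"

text \<open>Coins are Boolean, \<open>True\<close> standing for the value 1 of a Bernoulli variable.\<close>

context
  notes conj_cong [fundef_cong]
begin

fun erw :: "int \<Rightarrow> (int \<times> nat \<Rightarrow> bool) \<Rightarrow> nat \<Rightarrow> int" where
  "erw x \<eta> 0 = x"
| "erw x \<eta> (Suc n) =
     erw x \<eta> n + 2 * of_bool (\<eta> (erw x \<eta> n, card {k. k \<le> n \<and> erw x \<eta> k = erw x \<eta> n})) - 1"

end

abbreviation path_space :: "(nat \<Rightarrow> int) measure" where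
  "path_space \<equiv> PiM UNIV (\<lambda>_. count_space UNIV)"

definition quenched_law :: "(int \<times> nat \<Rightarrow> real) \<Rightarrow> int \<Rightarrow> (nat \<Rightarrow> int) measure" where
  "quenched_law \<omega> x = distr (coin_measure \<omega>) path_space (erw x)"

definition averaged_prob ::
    "(int \<times> nat \<Rightarrow> real) measure \<Rightarrow> int \<Rightarrow> ((nat \<Rightarrow> int) \<Rightarrow> bool) \<Rightarrow> real" where
  "averaged_prob P x A = (\<integral>\<omega>. \<P>(X in quenched_law \<omega> x. A X) \<partial>P)"

definition hitting_time :: "int \<Rightarrow> (nat \<Rightarrow> int) \<Rightarrow> enat" where
  "hitting_time k X = Inf {enat n | n. X n = k}"

definition return_time :: "(nat \<Rightarrow> int) \<Rightarrow> enat" where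
  "return_time X = Inf {enat n | n. n \<ge> 1 \<and> X n = 0}"


section \<open>Measurability\<close>

text \<open>
  The push-forwards and the integral above have junk values for non-measurable arguments;
  these facts show that this does not occur.
\<close>

lemma space_env_space: "space env_space = PiE cookies (\<lambda>_. {0..1})"
  by (simp add: env_space_def space_PiM space_restrict_space)

lemma measurable_stack: "stack x \<in> measurable env_space stack_space"
  unfolding stack_def stack_space_def env_space_def
  by (rule measurable_restrict) (auto intro!: measurable_component_singleton)

lemma measurable_reflect: "reflect \<in> measurable env_space env_space"
proof -
  have "(\<lambda>\<omega>. 1 - \<omega> k) \<in> measurable env_space unit_interval" if "k \<in> cookies" for k
  proof (rule measurable_restrict_space2)
    show "(\<lambda>\<omega>. 1 - \<omega> k) \<in> space env_space \<rightarrow> {0..1}"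
      using that by (fastforce simp: space_env_space PiE_iff)
    have "(\<lambda>\<omega>. \<omega> k) \<in> measurable env_space unit_interval"
      unfolding env_space_def using that by (rule measurable_component_singleton)
    then have "(\<lambda>\<omega>. \<omega> k) \<in> borel_measurable env_space"
      by (simp add: measurable_restrict_space2_iff)
    then show "(\<lambda>\<omega>. 1 - \<omega> k) \<in> borel_measurable env_space" by simp
  qed
  then show ?thesis
    unfolding reflect_def env_space_def by (intro measurable_restrict)
qed

abbreviation coin_space :: "(int \<times> nat \<Rightarrow> bool) measure" where
  "coin_space \<equiv> PiM cookies (\<lambda>_. count_space UNIV)"

lemma sets_coin_measure: "sets (coin_measure \<omega>) = sets coin_space"
  unfolding coin_measure_def by (intro sets_PiM_cong) auto

lemma measurable_erw_coord: "(\<lambda>\<eta>. erw x \<eta> n) \<in> measurable coin_space (count_space UNIV)"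
proof (induction n rule: less_induct)
  case (less n)
  show ?case
  proof (cases n)
    case 0
    then show ?thesis by simp
  next
    case (Suc m)
    have IH: "(\<lambda>\<eta>. erw x \<eta> k) \<in> measurable coin_space (count_space UNIV)" if "k \<le> m" for k
      using less.IH[of k] that Suc by simp
    have p: "Measurable.pred coin_space (\<lambda>\<eta>. j \<in> {k. k \<le> m \<and> erw x \<eta> k = erw x \<eta> m})" for j
    proof (cases "j \<le> m")
      case True
      show ?thesis
        using measurable_compose[OF measurable_Pair[OF IH[OF True] IH[OF order.refl]],
          of "\<lambda>(a, b). a = b" "count_space UNIV"] True
        by (simp add: pair_measure_countable)
    qed simp
    have c: "(\<lambda>\<eta>. card {k. k \<le> m \<and> erw x \<eta> k = erw x \<eta> m})
        \<in> measurable coin_space (count_space UNIV)"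
      by (rule measurable_card) (rule p[unfolded pred_def])
    define G where "G \<eta> = (erw x \<eta> m, card {k. k \<le> m \<and> erw x \<eta> k = erw x \<eta> m})" for \<eta>
    have G: "G \<in> measurable coin_space (count_space UNIV)"
    proof -
      have "G \<in> measurable coin_space (count_space UNIV \<Otimes>\<^sub>M count_space UNIV)"
        unfolding G_def using IH[of m] by (intro measurable_Pair c) auto
      then show ?thesis
        by (simp add: pair_measure_countable)
    qed
    have mem: "G \<eta> \<in> cookies" for \<eta>
    proof -
      have "0 < card {k. k \<le> m \<and> erw x \<eta> k = erw x \<eta> m}"
        by (subst card_gt_0_iff) auto
      then show ?thesis by (simp add: G_def)
    qed
    have comp: "(\<lambda>\<eta>. \<eta> k) \<in> measurable coin_space (count_space UNIV)" if "k \<in> cookies" for k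
      using measurable_component_singleton[OF that, of "\<lambda>_. count_space UNIV"] by simp
    have "(\<lambda>\<eta>. \<eta> (G \<eta>)) \<in> measurable coin_space (count_space UNIV)"
    proof (rule measurable_compose_countable'[where I = cookies])
      show "G \<in> measurable coin_space (count_space cookies)"
        using G mem by (auto simp: measurable_def space_PiM)
    qed (use comp in auto)
    then have "(\<lambda>\<eta>. (erw x \<eta> m, \<eta> (G \<eta>))) \<in>
        measurable coin_space (count_space UNIV \<Otimes>\<^sub>M count_space UNIV)"
      using IH[of m] by (intro measurable_Pair) auto
    from measurable_compose[OF this, of "\<lambda>(a, b). a + 2 * of_bool b - 1" "count_space UNIV"]
    have "(\<lambda>\<eta>. erw x \<eta> m + 2 * of_bool (\<eta> (G \<eta>)) - 1) \<in> measurable coin_space (count_space UNIV)"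
      by (simp add: pair_measure_countable)
    then show ?thesis unfolding Suc erw.simps G_def .
  qed
qed

lemma measurable_erw: "erw x \<in> measurable coin_space path_space"
  by (rule measurable_PiM_single') (use measurable_erw_coord[of x] in auto)

lemma prob_space_quenched_law: "prob_space (quenched_law \<omega> x)"
proof -
  interpret prob_space "coin_measure \<omega>"
    unfolding coin_measure_def by (intro prob_space_PiM measure_pmf.prob_space_axioms)
  have "erw x \<in> measurable (coin_measure \<omega>) path_space"
    using measurable_erw[of x] by (simp add: measurable_cong_sets[OF sets_coin_measure refl])
  then show ?thesis
    unfolding quenched_law_def by (rule prob_space_distr)
qed

lemma measurable_coin_measure: "coin_measure \<in> measurable env_space (prob_algebra coin_space)"
proof (rule measurable_prob_algebra_generated[OF sets_PiM Int_stable_prod_algebra prod_algebra_sets_into_space])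
  fix \<omega> :: "int \<times> nat \<Rightarrow> real"
  show "prob_space (coin_measure \<omega>)"
    unfolding coin_measure_def by (intro prob_space_PiM measure_pmf.prob_space_axioms)
  show "sets (coin_measure \<omega>) = sets coin_space"
    by (rule sets_coin_measure)
next
  fix A assume "A \<in> prod_algebra cookies (\<lambda>_. count_space (UNIV :: bool set))"
  then obtain J E where J: "finite J" "J \<subseteq> cookies"
    and A: "A = prod_emb cookies (\<lambda>_. count_space UNIV) J (PiE J E)"
    by (rule prod_algebraE) blast
  have eq: "emeasure (coin_measure \<omega>) A = (\<Prod>j\<in>J. emeasure (measure_pmf (bernoulli_pmf (\<omega> j))) (E j))"
    for \<omega>
  proof -
    interpret product_prob_space "\<lambda>k. measure_pmf (bernoulli_pmf (\<omega> k))" cookies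
      by unfold_locales
    have A': "A = prod_emb cookies (\<lambda>k. measure_pmf (bernoulli_pmf (\<omega> k))) J (PiE J E)"
      unfolding A prod_emb_def by simp
    show ?thesis
      unfolding coin_measure_def A' by (rule emeasure_PiM_emb[OF J(2) J(1)]) simp
  qed
  have "(\<lambda>\<omega>. emeasure (measure_pmf (bernoulli_pmf (\<omega> j))) (E j)) \<in> borel_measurable env_space"
    if "j \<in> J" for j
  proof -
    have j: "j \<in> cookies" using that J by auto
    have "(\<lambda>\<omega>. \<omega> j) \<in> measurable env_space unit_interval"
      unfolding env_space_def using j by (rule measurable_component_singleton)
    then have m [measurable]: "(\<lambda>\<omega>. \<omega> j) \<in> borel_measurable env_space"
      by (simp add: measurable_restrict_space2_iff)
    have "emeasure (measure_pmf (bernoulli_pmf (\<omega> j))) (E j) =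
        ennreal (of_bool (True \<in> E j) * \<omega> j + of_bool (False \<in> E j) * (1 - \<omega> j))"
      if "\<omega> \<in> space env_space" for \<omega>
    proof -
      have r: "0 \<le> \<omega> j" "\<omega> j \<le> 1"
        using that j by (auto simp: space_env_space PiE_iff)
      have "measure (measure_pmf (bernoulli_pmf (\<omega> j))) (E j) = (\<Sum>b\<in>E j. pmf (bernoulli_pmf (\<omega> j)) b)"
        by (rule measure_measure_pmf_finite) simp
      also have "\<dots> = (\<Sum>b\<in>UNIV. of_bool (b \<in> E j) * pmf (bernoulli_pmf (\<omega> j)) b)"
        by (intro sum.mono_neutral_cong_left) auto
      also have "\<dots> = of_bool (True \<in> E j) * \<omega> j + of_bool (False \<in> E j) * (1 - \<omega> j)"
        using r by (simp add: UNIV_bool)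
      finally show ?thesis by (simp add: measure_pmf.emeasure_eq_measure)
    qed
    then show ?thesis by (simp cong: measurable_cong)
  qed
  then show "(\<lambda>\<omega>. emeasure (coin_measure \<omega>) A) \<in> borel_measurable env_space"
    unfolding eq by (rule borel_measurable_prod_ennreal)
qed

lemma measurable_quenched_law:
  "(\<lambda>\<omega>. quenched_law \<omega> x) \<in> measurable env_space (prob_algebra path_space)"
  unfolding quenched_law_def
  by (rule measurable_compose[OF measurable_coin_measure measurable_distr_prob_space[OF measurable_erw]])

lemma measurable_Inf_enat:
  assumes "\<And>n. Measurable.pred N (\<lambda>X. Q n X)"
  shows "(\<lambda>X. Inf {enat n | n. Q n X}) \<in> measurable N (count_space UNIV)"
proof -
  have eq: "Inf {enat n | n. Q n X} = (if \<exists>n. Q n X then enat (LEAST n. Q n X) else \<infinity>)" for X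
  proof (cases "\<exists>n. Q n X")
    case True
    then have "Q (LEAST n. Q n X) X" by (rule LeastI_ex)
    then have "Inf {enat n | n. Q n X} = enat (LEAST n. Q n X)"
      by (intro antisym Inf_lower Inf_greatest) (blast, auto simp: Least_le)
    then show ?thesis using True by simp
  qed (simp add: top_enat_def)
  note assms [measurable]
  show ?thesis unfolding eq by measurable
qed

lemma measurable_hitting_time: "hitting_time k \<in> measurable path_space (count_space UNIV)"
  unfolding hitting_time_def by (rule measurable_Inf_enat) measurable

lemma measurable_return_time: "return_time \<in> measurable path_space (count_space UNIV)"
  unfolding return_time_def by (rule measurable_Inf_enat) measurable

end

theory Submission
  imports Defs "HOL-Real_Asymp.Real_Asymp"
begin

text \<open>
Cut the path of the walk started at \<open>1\<close> when it first hits \<open>0\<close> and let \<open>Z x\<close> be the number of steps from \<open>x\<close> to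
\<open>x + 1\<close> made before that time, with \<open>Z 0 = 1\<close> for the step that would have led from \<open>0\<close> to the starting point. Before the
walk dies it returns from \<open>x + 1\<close> to \<open>x\<close> as often as it went up, so \<open>Z x\<close> is the number of heads among the coins at \<open>x\<close>
that precede the \<open>Z (x - 1)\<close>-th tail (\<open>branching\<close>). The excursion reaches \<open>n\<close> exactly when \<open>Z (n - 1) > 0\<close>, and its
duration is \<open>1 + 2 (Z 1 + Z 2 + \<dots>)\<close> (\<open>reaches_iff_branching_survives\<close>, \<open>hitting_time_0_le\<close>, \<open>hitting_time_0_ge\<close>).
Under the averaged law the coin stacks of different sites are independent and identically distributed
(\<open>indep_coin_stacks\<close>), hence \<open>Z\<close> is a Markov chain on the naturals, absorbed at \<open>0\<close> (\<open>branching_law\<close>). From \<open>M\<close> or more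
crossings a step of the chain has mean increment \<open>\<delta>\<close> and variance about \<open>2 k\<close> (\<open>kernel_moments\<close>). Everything that
follows happens for this chain.

For \<open>\<delta> = 1\<close> the chain resembles the diffusion with generator \<open>k f'' + f'\<close>, a squared Bessel process of dimension \<open>2\<close>, whose
scale function is the logarithm. Three test functions do all the work; their drifts come from Taylor polynomials of degree
three and four and the first four moments of a step.
\<^item> \<open>1 / sqrt (k + 1)\<close> has drift at least \<open>(k + 1) powr (-3/2) / 8\<close> for large \<open>k\<close>. As each small state has a fixed chance to be
absorbed, the errors of order \<open>(k + 1) powr (-3/2)\<close> have a finite expected sum along the path (\<open>error_weight_summable\<close>).
\<^item> \<open>ln (1 + k)\<close> has drift of that order, so \<open>E ln (1 + Z n)\<close> converges; subtracting the errors gives a submartingale, which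
makes the limit \<open>c\<close> positive (\<open>mean_log_convergent\<close>, \<open>mean_log_limit_positive\<close>).
\<^item> \<open>ln (1 + k / a)\<close> has drift \<open>a / (a + k) ^ 2\<close> up to such errors, so the chain spends expected time at most \<open>C a\<close> in
\<open>{1..a}\<close> (\<open>occupation_bound\<close>).

On survival \<open>Z n\<close> is at most \<open>n powr (1 + e)\<close>, since \<open>E Z n\<close> grows at most linearly; by the occupation bound it is at least
\<open>n powr (1 - e)\<close> at most times between \<open>n\<close> and \<open>2 n\<close>. Thus \<open>E ln (1 + Z n)\<close> is about \<open>ln n\<close> times the survival probability,
which gives \<open>ln n * P (Z n > 0) \<longlonglongrightarrow> c\<close> (\<open>survival_asymptotics\<close>). An excursion that reaches height \<open>N\<close> lasts
\<open>N powr (2 + o(1))\<close> steps, and the logarithm turns the exponent into the factor \<open>2\<close> (\<open>lifetime_asymptotics\<close>). For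
\<open>\<delta> = -1\<close> the expected lifetime of the chain is finite, so it survives to \<open>n\<close> with probability \<open>O(1 / n)\<close> only
(\<open>survival_subcritical\<close>).

For the return time condition on the first step. A first step to the right is followed by an excursion that uses only coins
at positive sites, which are independent of that step. A first step to the left is, after exchanging left and right, a right
excursion in the reflected environment; as the stacks are i.i.d., mirroring the sites does not change their law
(\<open>return_decomposition\<close>). Exactly one of the two sides is critical, the other one is negligible.
\<close>

section \<open>Moments of the negative binomial law\<close>

abbreviation mean :: "'a pmf \<Rightarrow> ('a \<Rightarrow> real) \<Rightarrow> real" where
  "mean p \<equiv> measure_pmf.expectation p"

lemma integrable_fourth_moment_bound:
  fixes f :: "nat \<Rightarrow> real"
  assumes "integrable (measure_pmf p) (\<lambda>x. real x ^ 4)" and "\<And>x. \<bar>f x\<bar> \<le> c * (1 + real x ^ 4)"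
  shows "integrable (measure_pmf p) f"
proof (rule Bochner_Integration.integrable_bound)
  show "integrable (measure_pmf p) (\<lambda>x. c * (1 + real x ^ 4))"
    using assms(1) by simp
  show "AE x in measure_pmf p. norm (f x) \<le> norm (c * (1 + real x ^ 4))"
    using assms(2) by (intro AE_I2) (smt (verit) real_norm_def)
qed simp

lemma power_le_one_plus_fourth:
  fixes x :: real assumes "x \<ge> 0" "i \<le> 4" shows "x ^ i \<le> 1 + x ^ 4"
proof (cases "x \<ge> 1")
  case True
  then have "x ^ i \<le> x ^ 4" using assms by (intro power_increasing) auto
  then show ?thesis by simp
next
  case False
  then have "x ^ i \<le> 1" using assms by (intro power_le_one) auto
  moreover have "x ^ 4 \<ge> 0" by simp
  ultimately show ?thesis by linarith
qed

lemma fourth_power_add_le: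
  fixes a b :: real
  shows "(a + b) ^ 4 \<le> 8 * (a ^ 4 + b ^ 4)"
proof -
  have sq: "(x + y)^2 \<le> 2 * (x ^ 2 + y ^ 2)" for x y :: real
    using sum_squares_ge_zero[of "x - y" 0] by (simp add: power2_eq_square algebra_simps)
  have "((a + b)^2)^2 \<le> (2 * (a ^ 2 + b ^ 2))^2"
    by (intro power_mono sq) auto
  also have "\<dots> = 4 * (a ^ 2 + b ^ 2)^2"
    by (subst power_mult_distrib) simp
  also have "(a ^ 2 + b ^ 2)^2 \<le> 2 * ((a ^ 2)^2 + (b ^ 2)^2)"
    by (rule sq)
  finally show ?thesis by (simp flip: power_mult)
qed

lemma shifted_power_bound:
  fixes c :: real assumes "i \<le> 4"
  shows "\<bar>(real x + c) ^ i\<bar> \<le> (9 + 8 * c ^ 4) * (1 + real x ^ 4)"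
proof -
  have "\<bar>(real x + c) ^ i\<bar> = \<bar>real x + c\<bar> ^ i" by (simp add: power_abs)
  also have "\<dots> \<le> 1 + \<bar>real x + c\<bar> ^ 4" using assms by (intro power_le_one_plus_fourth) auto
  also have "\<bar>real x + c\<bar> ^ 4 = (real x + c) ^ 4" by simp
  also have "(real x + c) ^ 4 \<le> 8 * (real x ^ 4 + c ^ 4)" by (rule fourth_power_add_le)
  also have "1 + 8 * (real x ^ 4 + c ^ 4) \<le> (9 + 8 * c ^ 4) * (1 + real x ^ 4)"
    by (simp add: algebra_simps)
  finally show ?thesis by simp
qed

lemma integrable_shifted_power:
  fixes c :: real
  assumes "integrable (measure_pmf p) (\<lambda>x. real x ^ 4)" and "i \<le> 4"
  shows "integrable (measure_pmf p) (\<lambda>x. (real x + c) ^ i)"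
  using assms(1) shifted_power_bound[OF assms(2)] by (rule integrable_fourth_moment_bound)

lemma integrable_fourth_power_add:
  assumes "integrable (measure_pmf p) (\<lambda>x. real x ^ 4)" "integrable (measure_pmf q) (\<lambda>x. real x ^ 4)"
  shows "integrable (measure_pmf (map_pmf (\<lambda>(x, y). x + y) (pair_pmf p q))) (\<lambda>x. real x ^ 4)"
proof -
  have 1: "integrable (measure_pmf (pair_pmf p q)) (\<lambda>z. real (fst z) ^ 4)"
    using assms(1) integrable_map_pmf_eq[of fst "pair_pmf p q" "\<lambda>x. real x ^ 4"]
    by (simp add: map_fst_pair_pmf)
  have 2: "integrable (measure_pmf (pair_pmf p q)) (\<lambda>z. real (snd z) ^ 4)"
    using assms(2) integrable_map_pmf_eq[of snd "pair_pmf p q" "\<lambda>x. real x ^ 4"]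
    by (simp add: map_snd_pair_pmf)
  have "integrable (measure_pmf (pair_pmf p q)) (\<lambda>z. real (fst z + snd z) ^ 4)"
  proof (rule Bochner_Integration.integrable_bound)
    show "integrable (measure_pmf (pair_pmf p q)) (\<lambda>z. 8 * (real (fst z) ^ 4 + real (snd z) ^ 4))"
      using 1 2 by simp
    show "AE z in measure_pmf (pair_pmf p q). norm (real (fst z + snd z) ^ 4) \<le> norm (8 * (real (fst z) ^ 4 + real (snd z) ^ 4))"
      using fourth_power_add_le by (intro AE_I2) simp
  qed simp
  then show ?thesis by (simp add: case_prod_unfold)
qed

lemma integrable_neg_binomial_fourth:
  "integrable (measure_pmf (neg_binomial_pmf n (1/2))) (\<lambda>x. real x ^ 4)"
proof (induction n)
  case 0
  show ?case by (simp add: integrable_measure_pmf_finite)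
next
  case (Suc n)
  have "summable (\<lambda>x. real x ^ 4 * (1/2) ^ x)"
  proof (rule summable_comparison_test_bigo)
    show "summable (\<lambda>x. norm ((3/4::real) ^ x))" by (simp add: summable_geometric)
    show "(\<lambda>x. real x ^ 4 * (1/2) ^ x) \<in> O(\<lambda>x. (3/4::real) ^ x)" by real_asymp
  qed
  then have "summable (\<lambda>x. (1/2) ^ x * (1/2) * real x ^ 4)"
    using summable_mult[of "\<lambda>x. real x ^ 4 * (1/2) ^ x" "1/2"] by (simp add: algebra_simps)
  then have "integrable (measure_pmf (geometric_pmf (1/2))) (\<lambda>x. real x ^ 4)"
    unfolding measure_pmf_eq_density
    by (subst integrable_density) (auto simp: integrable_count_space_nat_iff abs_mult power_abs)
  then show ?case
    unfolding neg_binomial_pmf_Suc by (rule integrable_fourth_power_add) (rule Suc.IH)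
qed

lemma expectation_bind_pmf_nonneg:
  fixes f :: "'b \<Rightarrow> real"
  assumes f: "\<And>y. f y \<ge> 0" and K: "\<And>x. x \<in> set_pmf p \<Longrightarrow> integrable (measure_pmf (K x)) f"
    and i: "integrable (measure_pmf p) (\<lambda>x. mean (K x) f)"
  shows "integrable (measure_pmf (bind_pmf p K)) f"
    and "mean (bind_pmf p K) f = mean p (\<lambda>x. mean (K x) f)"
proof -
  have "(\<integral>\<^sup>+x. ennreal (f x) \<partial>bind_pmf p K) = (\<integral>\<^sup>+x. \<integral>\<^sup>+y. ennreal (f y) \<partial>K x \<partial>p)" by simp
  also have "\<dots> = (\<integral>\<^sup>+x. ennreal (mean (K x) f) \<partial>p)"
    using K f by (intro nn_integral_cong_AE AE_pmfI nn_integral_eq_integral) auto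
  also have "\<dots> = ennreal (mean p (\<lambda>x. mean (K x) f))"
    using i f by (intro nn_integral_eq_integral) auto
  finally have *: "(\<integral>\<^sup>+x. ennreal (f x) \<partial>bind_pmf p K) = ennreal (mean p (\<lambda>x. mean (K x) f))" .
  show I: "integrable (measure_pmf (bind_pmf p K)) f"
    using * f by (intro integrableI_nonneg) auto
  show "mean (bind_pmf p K) f = mean p (\<lambda>x. mean (K x) f)"
    using * f by (subst integral_eq_nn_integral) (auto intro!: Bochner_Integration.integral_nonneg simp del: nn_integral_bind_pmf)
qed

lemma integrable_expectation_bind_pmf:
  fixes f :: "'b \<Rightarrow> real"
  assumes "integrable (measure_pmf (bind_pmf p K)) f"
  shows "integrable (measure_pmf p) (\<lambda>x. mean (K x) (\<lambda>y. \<bar>f y\<bar>))"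
    "x \<in> set_pmf p \<Longrightarrow> integrable (measure_pmf (K x)) f"
proof -
  have fin: "(\<integral>\<^sup>+x. \<integral>\<^sup>+y. ennreal \<bar>f y\<bar> \<partial>K x \<partial>p) < \<infinity>"
    using assms unfolding integrable_iff_bounded by simp
  then have "AE x in p. (\<integral>\<^sup>+y. ennreal \<bar>f y\<bar> \<partial>K x) \<noteq> \<infinity>"
    by (intro nn_integral_PInf_AE) auto
  then have K: "integrable (measure_pmf (K x)) f" if "x \<in> set_pmf p" for x
    using that by (auto simp: AE_measure_pmf_iff integrable_iff_bounded less_top)
  then show "x \<in> set_pmf p \<Longrightarrow> integrable (measure_pmf (K x)) f" by simp
  have "(\<integral>\<^sup>+x. ennreal (mean (K x) (\<lambda>y. \<bar>f y\<bar>)) \<partial>p) = (\<integral>\<^sup>+x. \<integral>\<^sup>+y. ennreal \<bar>f y\<bar> \<partial>K x \<partial>p)"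
    using K by (intro nn_integral_cong_AE AE_pmfI nn_integral_eq_integral[symmetric]) auto
  with fin show "integrable (measure_pmf p) (\<lambda>x. mean (K x) (\<lambda>y. \<bar>f y\<bar>))"
    by (intro integrableI_nonneg) auto
qed

lemma expectation_bind_pmf:
  fixes f :: "'b \<Rightarrow> real"
  assumes "integrable (measure_pmf (bind_pmf p K)) f"
  shows "mean (bind_pmf p K) f = mean p (\<lambda>x. mean (K x) f)"
proof -
  let ?B = "measure_pmf (bind_pmf p K)"
  note ik = integrable_expectation_bind_pmf(2)[OF assms]
  have nn: "mean (bind_pmf p K) g = mean p (\<lambda>x. mean (K x) g)
        \<and> integrable (measure_pmf p) (\<lambda>x. mean (K x) g)"
    if g: "integrable ?B g" "\<And>y. g y \<ge> 0" for g :: "'b \<Rightarrow> real"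
  proof -
    have "integrable (measure_pmf p) (\<lambda>x. mean (K x) g)"
      using integrable_expectation_bind_pmf(1)[OF g(1)] g(2) by (simp add: abs_of_nonneg)
    moreover from this have "mean (bind_pmf p K) g = mean p (\<lambda>x. mean (K x) g)"
      by (intro expectation_bind_pmf_nonneg(2)[OF g(2) integrable_expectation_bind_pmf(2)[OF g(1)]])
    ultimately show ?thesis by (rule conjI[rotated])
  qed
  let ?f = "\<lambda>y. max 0 (f y)" and ?g = "\<lambda>y. max 0 (- f y)"
  have f: "f = (\<lambda>y. ?f y - ?g y)" by (auto simp: fun_eq_iff max_def)
  have fg: "integrable ?B ?f" "integrable ?B ?g" using assms by auto
  have "mean (bind_pmf p K) f = mean (bind_pmf p K) ?f - mean (bind_pmf p K) ?g"
    by (subst f) (rule Bochner_Integration.integral_diff[OF fg])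
  also have "\<dots> = mean p (\<lambda>x. mean (K x) ?f - mean (K x) ?g)"
    using nn[OF fg(1)] nn[OF fg(2)] by (simp add: Bochner_Integration.integral_diff)
  also have "\<dots> = mean p (\<lambda>x. mean (K x) f)"
  proof (intro integral_cong_AE AE_pmfI)
    fix x assume "x \<in> set_pmf p"
    then have "integrable (measure_pmf (K x)) f" by (rule ik)
    then have "mean (K x) ?f - mean (K x) ?g = mean (K x) (\<lambda>y. ?f y - ?g y)"
      by (subst Bochner_Integration.integral_diff) auto
    then show "mean (K x) ?f - mean (K x) ?g = mean (K x) f"
      using f by simp
  qed auto
  finally show ?thesis .
qed


text \<open>
Conditioning on the first toss. As the law itself recurs on the right with weight one half, the equation can be solved for the
central moments one after the other.
\<close>

lemma expectation_neg_binomial_unfold: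
  fixes f :: "nat \<Rightarrow> real"
  assumes "\<And>x. \<bar>f x\<bar> \<le> c * (1 + real x ^ 4)" and "\<And>x. \<bar>f (Suc x)\<bar> \<le> c' * (1 + real x ^ 4)"
  shows "mean (neg_binomial_pmf (Suc n) (1/2)) f =
    (mean (neg_binomial_pmf n (1/2)) f + mean (neg_binomial_pmf (Suc n) (1/2)) (\<lambda>x. f (Suc x))) / 2"
proof -
  have "integrable (measure_pmf (neg_binomial_pmf (Suc n) (1/2))) f"
    by (rule integrable_fourth_moment_bound[OF integrable_neg_binomial_fourth assms(1)])
  then have *: "integrable (measure_pmf (bernoulli_pmf (1/2) \<bind> (\<lambda>b. if b then neg_binomial_pmf n (1/2) else map_pmf Suc (neg_binomial_pmf (Suc n) (1/2))))) f"
    by (subst (asm) neg_binomial_pmf_unfold) auto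
  show ?thesis
    by (subst neg_binomial_pmf_unfold, simp, subst expectation_bind_pmf[OF *]) simp
qed

lemma shifted_moments:
  fixes a c :: real
  assumes "integrable (measure_pmf p) (\<lambda>x. real x ^ 4)"
  defines "m \<equiv> \<lambda>i. mean p (\<lambda>x. (real x - a) ^ i)"
  defines "m' \<equiv> \<lambda>i. mean p (\<lambda>x. (real x - a + c) ^ i)"
  shows "m' 1 = m 1 + c"
    "m' 2 = m 2 + 2 * c * m 1 + c ^ 2"
    "m' 3 = m 3 + 3 * c * m 2 + 3 * c ^ 2 * m 1 + c ^ 3"
    "m' 4 = m 4 + 4 * c * m 3 + 6 * c ^ 2 * m 2 + 4 * c ^ 3 * m 1 + c ^ 4"
proof -
  have int: "integrable (measure_pmf p) (\<lambda>x. (real x - a) ^ i)" if "i \<le> 4" for i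
    using integrable_shifted_power[OF assms(1) that, of "- a"] by simp
  note i = int[of 1] int[of 2] int[of 3] int[of 4]
  have e: "(y + c) ^ 2 = y ^ 2 + (2 * c) * y ^ 1 + c ^ 2" "(y + c) ^ 3 = y ^ 3 + (3 * c) * y ^ 2 + (3 * c ^ 2) * y ^ 1 + c ^ 3"
     "(y + c) ^ 4 = y ^ 4 + (4 * c) * y ^ 3 + (6 * c ^ 2) * y ^ 2 + (4 * c ^ 3) * y ^ 1 + c ^ 4" for y :: real
    by (simp_all add: power2_eq_square power3_eq_cube power4_eq_xxxx algebra_simps)
  show "m' 1 = m 1 + c"
    unfolding m_def m'_def using i by simp
  show "m' 2 = m 2 + 2 * c * m 1 + c ^ 2"
    unfolding m_def m'_def e using i by (simp del: power_one_right One_nat_def)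
  show "m' 3 = m 3 + 3 * c * m 2 + 3 * c ^ 2 * m 1 + c ^ 3"
    unfolding m_def m'_def e using i by (simp del: power_one_right One_nat_def)
  show "m' 4 = m 4 + 4 * c * m 3 + 6 * c ^ 2 * m 2 + 4 * c ^ 3 * m 1 + c ^ 4"
    unfolding m_def m'_def e using i by (simp del: power_one_right One_nat_def)
qed

lemma neg_binomial_central_moments:
  defines "m \<equiv> \<lambda>n i. mean (neg_binomial_pmf n (1/2)) (\<lambda>x. (real x - real n) ^ i)"
  shows "m n 1 = 0" "m n 2 = 2 * real n" "m n 3 = 6 * real n" "m n 4 = 12 * real n ^ 2 + 26 * real n"
proof -
  define E where "E = (\<lambda>n (f :: nat \<Rightarrow> real). mean (neg_binomial_pmf n (1/2)) f)"
  have unf: "m (Suc n) i = (E n (\<lambda>x. (real x - real n - 1) ^ i) + E (Suc n) (\<lambda>x. (real x - real (Suc n) + 1) ^ i)) / 2"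
    if i: "i \<le> 4" for n i
  proof -
    note b = shifted_power_bound[OF i]
    show ?thesis unfolding m_def E_def
      using expectation_neg_binomial_unfold[of "\<lambda>x. (real x + (- real (Suc n))) ^ i" "9 + 8 * (- real (Suc n)) ^ 4" "9 + 8 * (- real n) ^ 4" n]
        b[of _ "- real (Suc n)"] b[of _ "- real n"]
      by (simp add: algebra_simps)
  qed
  have lin: "E n (\<lambda>x. (real x - real n + c) ^ 1) = m n 1 + c"
    "E n (\<lambda>x. (real x - real n + c) ^ 2) = m n 2 + 2 * c * m n 1 + c ^ 2"
    "E n (\<lambda>x. (real x - real n + c) ^ 3) = m n 3 + 3 * c * m n 2 + 3 * c ^ 2 * m n 1 + c ^ 3"
    "E n (\<lambda>x. (real x - real n + c) ^ 4) = m n 4 + 4 * c * m n 3 + 6 * c ^ 2 * m n 2 + 4 * c ^ 3 * m n 1 + c ^ 4" for n c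
    unfolding E_def m_def by (rule shifted_moments[OF integrable_neg_binomial_fourth])+
  note L = lin[of _ 1] lin[of _ "-1"]
  have 1: "m n 1 = 0" for n
  proof (induction n)
    case 0 show ?case by (simp add: m_def)
  next
    case (Suc n) then show ?case using unf[of 1 n] L[where n = n] L[where n = "Suc n"] by simp
  qed
  have 2: "m n 2 = 2 * real n" for n
  proof (induction n)
    case 0 show ?case by (simp add: m_def)
  next
    case (Suc n) then show ?case using unf[of 2 n] L[where n = n] L[where n = "Suc n"] 1 by simp
  qed
  have 3: "m n 3 = 6 * real n" for n
  proof (induction n)
    case 0 show ?case by (simp add: m_def)
  next
    case (Suc n) then show ?case using unf[of 3 n] L[where n = n] L[where n = "Suc n"] 1 2 by simp
  qed
  have 4: "m n 4 = 12 * real n ^ 2 + 26 * real n" for n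
  proof (induction n)
    case 0 show ?case by (simp add: m_def)
  next
    case (Suc n) then show ?case using unf[of 4 n] L[where n = n] L[where n = "Suc n"] 1 2 3
      by (simp add: power2_eq_square algebra_simps)
  qed
  from 1 2 3 4 show "m n 1 = 0" "m n 2 = 2 * real n" "m n 3 = 6 * real n" "m n 4 = 12 * real n ^ 2 + 26 * real n"
    by auto
qed

section \<open>The chain of crossing numbers\<close>

text \<open>
The law of the number of heads before the \<open>k\<close>-th tail when the first tosses are known to be \<open>bs\<close> and all later ones are fair.
\<close>

fun next_crossings :: "bool list \<Rightarrow> nat \<Rightarrow> nat pmf" where
  "next_crossings [] k = neg_binomial_pmf k (1/2)"
| "next_crossings (b # bs) 0 = return_pmf 0"
| "next_crossings (True # bs) (Suc k) = map_pmf Suc (next_crossings bs (Suc k))"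
| "next_crossings (False # bs) (Suc k) = next_crossings bs k"

definition coin_drift :: "bool list \<Rightarrow> real" where
  "coin_drift bs = (\<Sum>b\<leftarrow>bs. if b then 1 else - 1)"

lemma abs_coin_drift_le: "\<bar>coin_drift bs\<bar> \<le> real (length bs)"
  by (induction bs) (auto simp: coin_drift_def)

lemma next_crossings_0 [simp]: "next_crossings bs 0 = return_pmf 0"
  by (cases bs) auto

lemma integrable_next_crossings_fourth:
  "integrable (measure_pmf (next_crossings bs k)) (\<lambda>x. real x ^ 4)"
proof (induction bs k rule: next_crossings.induct)
  case (1 k)
  show ?case using integrable_neg_binomial_fourth by simp
next
  case (2 b bs)
  show ?case by (simp add: integrable_measure_pmf_finite)
next
  case (3 bs k)
  show ?case using integrable_shifted_power[OF 3, of 4 1] by (simp add: add.commute)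
qed simp

text \<open>
Each known toss changes \<open>x - k\<close> by \<open>\<plusminus>1\<close> and leads to the same problem with one known toss fewer, so the moments differ from
those of the negative binomial law by lower-order terms. With \<open>k\<close> no smaller than the number of known tosses all of them are
used, which makes the mean exactly \<open>coin_drift\<close>.
\<close>

lemma next_crossings_moments:
  "\<exists>C\<ge>0. \<forall>bs k. length bs = l \<longrightarrow> l \<le> k \<longrightarrow>
     mean (next_crossings bs k) (\<lambda>x. (real x - real k) ^ 1) = coin_drift bs \<and>
     \<bar>mean (next_crossings bs k) (\<lambda>x. (real x - real k) ^ 2) - 2 * real k\<bar> \<le> C \<and>
     \<bar>mean (next_crossings bs k) (\<lambda>x. (real x - real k) ^ 3)\<bar> \<le> C * (real k + 1) \<and>
     mean (next_crossings bs k) (\<lambda>x. (real x - real k) ^ 4) \<le> C * (real k + 1) ^ 2"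
  (is "\<exists>C\<ge>0. \<forall>bs k. length bs = l \<longrightarrow> l \<le> k \<longrightarrow> ?P C bs k")
proof (induction l)
  case 0
  have "?P 26 [] k" for k
  proof -
    have "12 * real k ^ 2 + 26 * real k \<le> 26 * (real k + 1) ^ 2"
      by (simp add: power2_eq_square algebra_simps)
    then show ?thesis
      using neg_binomial_central_moments[of k] by (simp add: coin_drift_def del: power_one_right)
  qed
  then show ?case by (intro exI[of _ 26]) auto
next
  case (Suc l)
  then obtain C where C: "C \<ge> 0" and IH: "\<And>bs k. length bs = l \<Longrightarrow> l \<le> k \<Longrightarrow> ?P C bs k" by blast
  \<comment> \<open>large enough for the binomial expansions of \<open>(y + c) ^ i\<close>, \<open>i \<le> 4\<close>, with \<open>c = \<plusminus>1\<close>\<close>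
  define C' where "C' = 11 * C + 4 * real l + 20"
  have step: "E1 = coin_drift bs + c \<and> \<bar>E2 - 2 * real k\<bar> \<le> C' \<and> \<bar>E3\<bar> \<le> C' * (real k + 1) \<and> E4 \<le> C' * (real k + 1) ^ 2"
    if l: "length bs = l" "l \<le> k'" and k: "k' \<le> k" "k \<le> k' + 1" and c: "c = 1 \<or> c = - 1"
      and E: "E1 = mean (next_crossings bs k') (\<lambda>x. (real x - real k' + c) ^ 1)"
        "E2 = mean (next_crossings bs k') (\<lambda>x. (real x - real k' + c) ^ 2)"
        "E3 = mean (next_crossings bs k') (\<lambda>x. (real x - real k' + c) ^ 3)"
        "E4 = mean (next_crossings bs k') (\<lambda>x. (real x - real k' + c) ^ 4)"
    for bs k k' c E1 E2 E3 E4
  proof -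
    define m where "m = (\<lambda>i. mean (next_crossings bs k') (\<lambda>x. (real x - real k') ^ i))"
    have P: "m 1 = coin_drift bs" "\<bar>m 2 - 2 * real k'\<bar> \<le> C" "\<bar>m 3\<bar> \<le> C * (real k' + 1)" "m 4 \<le> C * (real k' + 1) ^ 2"
      using IH[OF l] unfolding m_def by auto
    have D: "\<bar>m 1\<bar> \<le> real l" using abs_coin_drift_le[of bs] P(1) l by simp
    have S: "E1 = m 1 + c" "E2 = m 2 + 2 * c * m 1 + c ^ 2" "E3 = m 3 + 3 * c * m 2 + 3 * c ^ 2 * m 1 + c ^ 3"
      "E4 = m 4 + 4 * c * m 3 + 6 * c ^ 2 * m 2 + 4 * c ^ 3 * m 1 + c ^ 4"
      unfolding E m_def by (rule shifted_moments[OF integrable_next_crossings_fourth])+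
    define K where "K = real k + 1"
    have K: "K \<ge> 1" "real k' + 1 \<le> K" "real k' \<le> K" using k by (auto simp: K_def)
    have CK: "C * (real k' + 1) \<le> C * K" "C * (real k' + 1) ^ 2 \<le> C * K ^ 2"
      using C K k by (auto intro!: mult_left_mono power_mono)
    have K2: "K \<le> K ^ 2" "1 \<le> K ^ 2" using K(1) by (auto simp: power2_eq_square intro: order_trans[OF K(1)])
    have lK: "real l \<le> real l * K" "C \<le> C * K" "C * K \<le> C * K ^ 2" "real l * K \<le> real l * K ^ 2"
      using K(1) C K2 by (auto simp: mult_le_cancel_left1 mult_left_mono)
    have m2: "\<bar>m 2\<bar> \<le> C * K + 2 * K" using P(2) K lK(2) by linarith
    have m3: "\<bar>m 3\<bar> \<le> C * K" using P(3) CK(1) by (rule order_trans)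
    have m4: "m 4 \<le> C * K ^ 2" using P(4) CK(2) by (rule order_trans)
    have c2: "c ^ 2 = 1" "c ^ 3 = c" "c ^ 4 = 1" "\<bar>c\<bar> = 1" using c by auto
    have cm: "\<bar>c * m i\<bar> = \<bar>m i\<bar>" for i using c by auto
    have 2: "\<bar>E2 - 2 * real k\<bar> \<le> C'"
    proof -
      have "\<bar>c * m 1\<bar> \<le> real l" using D cm by simp
      moreover have "E2 = m 2 + 2 * (c * m 1) + 1" using S(2) c2 by simp
      moreover have "\<bar>real k - real k'\<bar> \<le> 1" using k by linarith
      ultimately show ?thesis using P(2) C unfolding C'_def by linarith
    qed
    have 3: "\<bar>E3\<bar> \<le> C' * K"
    proof -
      have "E3 = m 3 + 3 * (c * m 2) + 3 * m 1 + c" using S(3) c2 by simp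
      then have "\<bar>E3\<bar> \<le> \<bar>m 3\<bar> + 3 * \<bar>m 2\<bar> + 3 * real l + 1"
        using cm[of 2] D c2(4) by linarith
      also have "\<dots> \<le> C * K + 3 * (C * K + 2 * K) + 3 * (real l * K) + K"
        using m2 m3 lK(1) K(1) by (simp add: algebra_simps)
      also have "\<dots> \<le> C' * K" unfolding C'_def using lK C K by (simp add: algebra_simps)
      finally show ?thesis .
    qed
    have 4: "E4 \<le> C' * K ^ 2"
    proof -
      have "E4 = m 4 + 4 * (c * m 3) + 6 * m 2 + 4 * (c * m 1) + 1" using S(4) c2 by simp
      then have "E4 \<le> m 4 + 4 * \<bar>m 3\<bar> + 6 * \<bar>m 2\<bar> + 4 * real l + 1"
        using cm[of 3] cm[of 1] D by linarith
      also have "\<dots> \<le> C * K ^ 2 + 4 * (C * K ^ 2) + 6 * (C * K ^ 2 + 2 * K ^ 2) + 4 * (real l * K ^ 2) + K ^ 2"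
        using m2 m3 m4 lK K2 by (simp add: algebra_simps)
      also have "\<dots> \<le> C' * K ^ 2" unfolding C'_def using K2 by (simp add: algebra_simps)
      finally show ?thesis .
    qed
    show ?thesis using S(1) P(1) 2 3 4 by (simp add: K_def)
  qed
  have "?P C' bs k" if bs_k: "length bs = Suc l" "Suc l \<le> k" for bs k
  proof -
    obtain b cs where bs: "bs = b # cs" "length cs = l" using bs_k by (cases bs) auto
    obtain k' where k: "k = Suc k'" "l \<le> k'" using bs_k by (cases k) auto
    show ?thesis
    proof (cases b)
      case True
      have e: "real (Suc x) - real (Suc k') = real x - real (Suc k') + 1" for x by simp
      show ?thesis
        using step[OF bs(2), of "Suc k'" "Suc k'" 1, OF _ _ _ _ refl refl refl refl] k True bs(1)
        by (simp add: e coin_drift_def add.commute[of _ "sum_list _"] del: of_nat_Suc power_one_right)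
    next
      case False
      have e: "real x - real (Suc k') = real x - real k' + (- 1)" for x by simp
      show ?thesis
        using step[OF bs(2), of k' k "- 1", OF _ _ _ _ refl refl refl refl] k False bs(1)
        by (simp only: e next_crossings.simps) (simp add: coin_drift_def del: power_one_right)
    qed
  qed
  moreover have "C' \<ge> 0" using C by (simp add: C'_def)
  ultimately show ?case by blast
qed

lemma expectation_next_crossings_le:
  "mean (next_crossings bs k) real \<le> real k + real (length bs)"
proof (induction bs k rule: next_crossings.induct)
  case (1 k)
  have "mean (neg_binomial_pmf k (1/2)) (\<lambda>x. (real x - real k + real k) ^ 1) = real k"
    using shifted_moments(1)[OF integrable_neg_binomial_fourth, of k "real k" "real k"]
      neg_binomial_central_moments(1)[of k] by simp
  then show ?case by simp
next
  case (3 bs k)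
  have "integrable (measure_pmf (next_crossings bs (Suc k))) real"
    using integrable_shifted_power[OF integrable_next_crossings_fourth, of 1 bs "Suc k" 0] by simp
  with 3 show ?case by simp
qed auto

text \<open>
The stack at a site enters only through the law \<open>\<theta>\<close> of its first \<open>M\<close> tosses, as all later ones are fair. The two support
conditions are what weak ellipticity gives: every state can be absorbed in one step, and from \<open>1\<close> every large state can be
reached.
\<close>

locale cookie_chain =
  fixes \<theta> :: "bool list pmf" and M :: nat
  assumes length_coins: "bs \<in> set_pmf \<theta> \<Longrightarrow> length bs = M"
    and all_True: "replicate M True \<in> set_pmf \<theta>"
    and all_False: "replicate M False \<in> set_pmf \<theta>"
begin

definition mean_drift :: real where
  "mean_drift = mean \<theta> coin_drift"

definition kernel :: "nat \<Rightarrow> nat pmf" where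
  "kernel k = bind_pmf \<theta> (\<lambda>bs. next_crossings bs k)"

primrec crossings :: "nat \<Rightarrow> nat pmf" where
  "crossings 0 = return_pmf 1"
| "crossings (Suc n) = bind_pmf (crossings n) kernel"

definition survival :: "nat \<Rightarrow> real" where
  "survival n = measure_pmf.prob (crossings n) {1..}"

lemma finite_coins: "finite (set_pmf \<theta>)"
  by (rule finite_subset[OF _ finite_lists_length_eq[of UNIV M]]) (auto dest: length_coins)

lemma kernel_0 [simp]: "kernel 0 = return_pmf 0"
  by (simp add: kernel_def)

lemma integrable_kernel_fourth: "integrable (measure_pmf (kernel k)) (\<lambda>x. real x ^ 4)"
  unfolding kernel_def
  by (rule expectation_bind_pmf_nonneg(1))
    (auto intro: integrable_next_crossings_fourth integrable_measure_pmf_finite[OF finite_coins])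

lemma expectation_kernel:
  fixes f :: "nat \<Rightarrow> real"
  assumes "integrable (measure_pmf (kernel k)) f"
  shows "mean (kernel k) f = mean \<theta> (\<lambda>bs. mean (next_crossings bs k) f)"
  using expectation_bind_pmf[of \<theta> "\<lambda>bs. next_crossings bs k" f] assms unfolding kernel_def by simp

lemma integrable_kernel_real: "integrable (measure_pmf (kernel k)) real"
  using integrable_shifted_power[OF integrable_kernel_fourth, of 1 k 0] by simp

lemma expectation_coins_le:
  assumes "\<And>bs. bs \<in> set_pmf \<theta> \<Longrightarrow> f bs \<le> (c :: real)"
  shows "mean \<theta> f \<le> c"
proof -
  have "mean \<theta> f \<le> mean \<theta> (\<lambda>_. c)"
    using assms by (intro integral_mono_AE integrable_measure_pmf_finite[OF finite_coins] AE_pmfI) auto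
  then show ?thesis by simp
qed

lemma kernel_mean_le: "mean (kernel k) real \<le> real k + real M"
  unfolding expectation_kernel[OF integrable_kernel_real]
  using expectation_next_crossings_le by (intro expectation_coins_le) (metis length_coins)

lemma kernel_moments:
  obtains C where "C \<ge> 0"
    and "\<And>k. k \<ge> M \<Longrightarrow> mean (kernel k) (\<lambda>x. real x - real k) = mean_drift"
    and "\<And>k. k \<ge> M \<Longrightarrow> \<bar>mean (kernel k) (\<lambda>x. (real x - real k) ^ 2) - 2 * real k\<bar> \<le> C"
    and "\<And>k. k \<ge> M \<Longrightarrow> \<bar>mean (kernel k) (\<lambda>x. (real x - real k) ^ 3)\<bar> \<le> C * (real k + 1)"
    and "\<And>k. k \<ge> M \<Longrightarrow> mean (kernel k) (\<lambda>x. (real x - real k) ^ 4) \<le> C * (real k + 1) ^ 2"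
proof -
  obtain C where C: "C \<ge> 0" and P: "\<And>bs k. length bs = M \<Longrightarrow> M \<le> k \<Longrightarrow>
     mean (next_crossings bs k) (\<lambda>x. (real x - real k) ^ 1) = coin_drift bs \<and>
     \<bar>mean (next_crossings bs k) (\<lambda>x. (real x - real k) ^ 2) - 2 * real k\<bar> \<le> C \<and>
     \<bar>mean (next_crossings bs k) (\<lambda>x. (real x - real k) ^ 3)\<bar> \<le> C * (real k + 1) \<and>
     mean (next_crossings bs k) (\<lambda>x. (real x - real k) ^ 4) \<le> C * (real k + 1) ^ 2"
    using next_crossings_moments[of M] by blast
  define m where "m = (\<lambda>i k bs. mean (next_crossings bs k) (\<lambda>x. (real x - real k) ^ i))"
  have K: "mean (kernel k) (\<lambda>x. (real x - real k) ^ i) = mean \<theta> (m i k)" if "i \<le> 4" for i k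
    unfolding m_def
    using integrable_shifted_power[OF integrable_kernel_fourth that, of k "- real k"] by (intro expectation_kernel) simp
  have abs: "\<bar>mean \<theta> f\<bar> \<le> c" if "\<And>bs. bs \<in> set_pmf \<theta> \<Longrightarrow> \<bar>f bs\<bar> \<le> c" for f and c :: real
  proof -
    have "mean \<theta> f \<le> c" using that by (intro expectation_coins_le) fastforce
    moreover have "mean \<theta> (\<lambda>bs. - f bs) \<le> c" using that by (intro expectation_coins_le) fastforce
    ultimately show ?thesis by simp
  qed
  show ?thesis
  proof
    show "C \<ge> 0" by fact
    fix k assume k: "k \<ge> M"
    have P: "m 1 k bs = coin_drift bs" "\<bar>m 2 k bs - 2 * real k\<bar> \<le> C" "\<bar>m 3 k bs\<bar> \<le> C * (real k + 1)" "m 4 k bs \<le> C * (real k + 1) ^ 2"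
      if "bs \<in> set_pmf \<theta>" for bs
      using P[OF length_coins[OF that] k] unfolding m_def by auto
    have "mean \<theta> (m 1 k) = mean_drift"
      unfolding mean_drift_def using P(1) by (intro integral_cong_AE AE_pmfI) auto
    then show "mean (kernel k) (\<lambda>x. real x - real k) = mean_drift"
      using K[of 1 k] by simp
    have "\<bar>mean \<theta> (\<lambda>bs. m 2 k bs - 2 * real k)\<bar> \<le> C"
      by (intro abs P(2))
    moreover have "mean \<theta> (\<lambda>bs. m 2 k bs - 2 * real k) = mean \<theta> (m 2 k) - 2 * real k"
      by (subst Bochner_Integration.integral_diff) (auto intro!: integrable_measure_pmf_finite[OF finite_coins])
    ultimately show "\<bar>mean (kernel k) (\<lambda>x. (real x - real k) ^ 2) - 2 * real k\<bar> \<le> C"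
      using K[of 2 k] by simp
    show "\<bar>mean (kernel k) (\<lambda>x. (real x - real k) ^ 3)\<bar> \<le> C * (real k + 1)"
      using K[of 3 k] abs[OF P(3)] by simp
    show "mean (kernel k) (\<lambda>x. (real x - real k) ^ 4) \<le> C * (real k + 1) ^ 2"
      using K[of 4 k] expectation_coins_le[OF P(4)] by simp
  qed
qed

end

section \<open>Taylor bounds\<close>

text \<open>
An odd Taylor polynomial bounds the logarithm from above on its whole domain; so the third moment, which is only of order
\<open>k\<close>, controls the error on this side without any tail estimate.
\<close>

lemma ln_le_cubic:
  fixes t :: real assumes "t > - 1"
  shows "ln (1 + t) \<le> t - t^2 / 2 + t^3 / 3"
proof -
  define h where "h = (\<lambda>t::real. t - t^2 / 2 + t^3 / 3 - ln (1 + t))"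
  have d: "(h has_real_derivative x ^ 3 / (1 + x)) (at x)" if "x > - 1" for x
    unfolding h_def using that
    by (auto intro!: derivative_eq_intros simp: divide_simps) (simp add: algebra_simps power2_eq_square power3_eq_cube)
  have "h 0 \<le> h t"
  proof (cases "t \<ge> 0")
    case True
    show ?thesis
    proof (rule DERIV_nonneg_imp_nondecreasing[OF True])
      fix x :: real assume "0 \<le> x" "x \<le> t"
      then show "\<exists>y. (h has_real_derivative y) (at x) \<and> 0 \<le> y"
        using d[of x] by (intro exI[of _ "x ^ 3 / (1 + x)"]) auto
    qed
  next
    case False
    then have "t \<le> 0" by simp
    show ?thesis
    proof (rule DERIV_nonpos_imp_nonincreasing[OF \<open>t \<le> 0\<close>])
      fix x :: real assume x: "t \<le> x" "x \<le> 0"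
      then have "x ^ 3 / (1 + x) \<le> 0" using assms
        by (auto simp: divide_le_0_iff power_le_zero_eq)
      then show "\<exists>y. (h has_real_derivative y) (at x) \<and> y \<le> 0"
        using d[of x] x assms by (intro exI[of _ "x ^ 3 / (1 + x)"]) auto
    qed
  qed
  then show ?thesis by (simp add: h_def)
qed

text \<open>
Here a lower bound of this form can only hold away from \<open>-1\<close>; smaller \<open>t\<close> is paid for by the fourth moment in
\<open>log_scale_drift\<close>.
\<close>

lemma ln_ge_quartic:
  fixes t :: real assumes "t \<ge> - 1 / 2"
  shows "ln (1 + t) \<ge> t - t^2 / 2 + t^3 / 3 - t^4"
proof -
  define h where "h = (\<lambda>t::real. ln (1 + t) - (t - t^2 / 2 + t^3 / 3 - t^4))"
  have d: "(h has_real_derivative x ^ 3 * (4 - 1 / (1 + x))) (at x)" if "x > - 1" for x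
    unfolding h_def using that
    by (auto intro!: derivative_eq_intros simp: divide_simps) (simp add: algebra_simps power2_eq_square power3_eq_cube power4_eq_xxxx)
  have pos: "4 - 1 / (1 + x) \<ge> 0" if "x \<ge> - 1 / 2" for x :: real
    using that by (simp add: divide_simps)
  have "h 0 \<le> h t"
  proof (cases "t \<ge> 0")
    case True
    show ?thesis
    proof (rule DERIV_nonneg_imp_nondecreasing[OF True])
      fix x :: real assume "0 \<le> x" "x \<le> t"
      then show "\<exists>y. (h has_real_derivative y) (at x) \<and> 0 \<le> y"
        using d[of x] pos[of x] by (intro exI[of _ "x ^ 3 * (4 - 1 / (1 + x))"]) auto
    qed
  next
    case False
    then have "t \<le> 0" by simp
    show ?thesis
    proof (rule DERIV_nonpos_imp_nonincreasing[OF \<open>t \<le> 0\<close>])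
      fix x :: real assume x: "t \<le> x" "x \<le> 0"
      then have "x ^ 3 * (4 - 1 / (1 + x)) \<le> 0" using assms pos[of x]
        by (intro mult_nonpos_nonneg) (auto simp: power_le_zero_eq)
      then show "\<exists>y. (h has_real_derivative y) (at x) \<and> y \<le> 0"
        using d[of x] x assms by (intro exI[of _ "x ^ 3 * (4 - 1 / (1 + x))"]) auto
    qed
  qed
  then show ?thesis by (simp add: h_def)
qed

text \<open>
With \<open>u = sqrt (1 + t)\<close> the difference is \<open>(u - 1) ^ 4\<close> times a polynomial with positive coefficients.
\<close>

lemma inverse_sqrt_ge_cubic:
  fixes t :: real assumes "t > - 1"
  shows "1 / sqrt (1 + t) \<ge> 1 - t / 2 + 3 * t^2 / 8 - 5 * t^3 / 16"
proof -
  define u where "u = sqrt (1 + t)"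
  have u: "u > 0" "u ^ 2 = 1 + t" using assms by (auto simp: u_def)
  have u0: "u \<ge> 0" using u by simp
  have t: "t = u ^ 2 - 1" using u by simp
  have "16 - 16 * u * (1 - t / 2 + 3 * t^2 / 8 - 5 * t^3 / 16) = (u - 1) ^ 4 * (5 * u ^ 3 + 20 * u ^ 2 + 29 * u + 16)"
    unfolding t by (simp add: field_simps power2_eq_square power3_eq_cube power4_eq_xxxx)
  also have "\<dots> \<ge> 0" by (intro mult_nonneg_nonneg add_nonneg_nonneg) (simp_all add: u0)
  finally have "u * (1 - t / 2 + 3 * t^2 / 8 - 5 * t^3 / 16) \<le> 1" by simp
  then show ?thesis unfolding u_def[symmetric] using u(1) by (simp add: pos_le_divide_eq mult.commute)
qed

lemma ln_le_two_sqrt: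
  fixes x :: real assumes "x \<ge> 1" shows "ln x \<le> 2 * sqrt x - 2"
proof -
  have "ln x = 2 * ln (sqrt x)" using assms by (simp add: ln_sqrt)
  also have "ln (sqrt x) \<le> sqrt x - 1" using assms by (intro ln_le_minus_one) auto
  finally show ?thesis by simp
qed

section \<open>Absorption and occupation\<close>

lemma zero_in_set_next_crossings: "0 \<in> set_pmf (next_crossings (replicate m False) k)"
proof (induction m arbitrary: k)
  case 0
  show ?case by (simp add: set_pmf_iff pmf_neg_binomial)
next
  case (Suc m)
  then show ?case by (cases k) auto
qed

lemma large_in_set_next_crossings: "m + j \<in> set_pmf (next_crossings (replicate m True) 1)"
proof (induction m)
  case 0
  show ?case by (simp add: set_pmf_geometric)
next
  case (Suc m)
  then show ?case by simp
qed

context cookie_chain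
begin

lemma kernel_killing: "pmf (kernel k) 0 > 0"
proof -
  have "0 \<in> set_pmf (kernel k)"
    unfolding kernel_def using zero_in_set_next_crossings all_False by auto
  then show ?thesis by (rule pmf_positive)
qed

lemma kernel_1_unbounded: "\<exists>m'\<ge>m. m' \<in> set_pmf (kernel 1)"
proof (intro exI conjI)
  show "M + m \<in> set_pmf (kernel 1)"
    unfolding kernel_def set_bind_pmf using large_in_set_next_crossings[of M m] all_True by blast
qed simp

lemma integrable_bounded: "(\<And>x. \<bar>f x\<bar> \<le> (c :: real)) \<Longrightarrow> integrable (measure_pmf p) f"
  by (rule measure_pmf.integrable_const_bound[of _ c], rule AE_I2) simp_all

lemma crossings_mean:
  "integrable (measure_pmf (crossings n)) real"
  "mean (crossings n) real \<le> 1 + real M * real n"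
proof -
  have "integrable (measure_pmf (crossings n)) real \<and> mean (crossings n) real \<le> 1 + real M * real n"
  proof (induction n)
    case 0
    show ?case by (simp add: integrable_measure_pmf_finite)
  next
    case (Suc n)
    then have i: "integrable (measure_pmf (crossings n)) real" by simp
    have e0: "0 \<le> mean (kernel k) real" for k by (intro Bochner_Integration.integral_nonneg) auto
    have K: "integrable (measure_pmf (crossings n)) (\<lambda>k. mean (kernel k) real)"
    proof (rule Bochner_Integration.integrable_bound)
      show "integrable (measure_pmf (crossings n)) (\<lambda>k. real k + real M)" using i by simp
      show "AE k in measure_pmf (crossings n). norm (mean (kernel k) real) \<le> norm (real k + real M)"
        using kernel_mean_le e0 by (intro AE_I2) (simp add: abs_of_nonneg)
    qed simp
    note B = expectation_bind_pmf_nonneg[where f = real, OF _ integrable_kernel_real K]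
    have "mean (crossings (Suc n)) real = mean (crossings n) (\<lambda>k. mean (kernel k) real)"
      using B(2) by simp
    also have "\<dots> \<le> mean (crossings n) (\<lambda>k. real k + real M)"
      using kernel_mean_le i by (intro integral_mono K) auto
    also have "\<dots> = mean (crossings n) real + real M" using i by simp
    finally show ?case using B(1) Suc by (simp add: algebra_simps)
  qed
  then show "integrable (measure_pmf (crossings n)) real"
    "mean (crossings n) real \<le> 1 + real M * real n" by auto
qed

text \<open>
Nonnegative functions of linear growth are integrable throughout, which covers all test functions below.
\<close>

lemma
  fixes f :: "nat \<Rightarrow> real"
  assumes f: "\<And>k. 0 \<le> f k" "\<And>k. f k \<le> c * (real k + 1)"
  shows integrable_crossings: "integrable (measure_pmf (crossings n)) f"
    and integrable_kernel: "integrable (measure_pmf (kernel k)) f"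
    and integrable_crossings_kernel: "integrable (measure_pmf (crossings n)) (\<lambda>k. mean (kernel k) f)"
    and expectation_crossings_Suc: "mean (crossings (Suc n)) f =
        mean (crossings n) (\<lambda>k. mean (kernel k) f)"
    and expectation_kernel_le: "mean (kernel k) f \<le> c * (real k + real M + 1)"
proof -
  have c: "c \<ge> 0" using f(1)[of 0] f(2)[of 0] by simp
  have bound: "integrable (measure_pmf p) real \<Longrightarrow> integrable (measure_pmf p) f" for p
    by (rule Bochner_Integration.integrable_bound[where f = "\<lambda>k. c * (real k + 1)"])
      (use f c in \<open>auto simp: abs_of_nonneg\<close>)
  show "integrable (measure_pmf (crossings n)) f" by (intro bound crossings_mean)
  show iK: "integrable (measure_pmf (kernel k)) f" for k by (intro bound integrable_kernel_real)
  show eK: "mean (kernel k) f \<le> c * (real k + real M + 1)" for k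
  proof -
    have "mean (kernel k) f \<le> mean (kernel k) (\<lambda>k. c * (real k + 1))"
      using f by (intro integral_mono iK) (auto intro!: integrable_kernel_real)
    also have "\<dots> = c * (mean (kernel k) real + 1)"
      using integrable_kernel_real[of k] by simp
    also have "\<dots> \<le> c * (real k + real M + 1)" using kernel_mean_le[of k] c by (intro mult_left_mono) auto
    finally show ?thesis .
  qed
  have e0: "0 \<le> mean (kernel k) f" for k using f by (intro Bochner_Integration.integral_nonneg) auto
  show i: "integrable (measure_pmf (crossings n)) (\<lambda>k. mean (kernel k) f)"
  proof (rule Bochner_Integration.integrable_bound)
    show "integrable (measure_pmf (crossings n)) (\<lambda>k. c * (real k + real M + 1))" using crossings_mean by simp
    show "AE k in measure_pmf (crossings n). norm (mean (kernel k) f) \<le> norm (c * (real k + real M + 1))"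
      using eK e0 c by (intro AE_I2) (simp add: abs_of_nonneg)
  qed simp
  show "mean (crossings (Suc n)) f = mean (crossings n) (\<lambda>k. mean (kernel k) f)"
    using expectation_bind_pmf_nonneg(2)[where f = f, OF f(1) iK i] by simp
qed

text \<open>
If a nonnegative function gains at least \<open>w\<close> in each step on average, then the expected sum of \<open>w\<close> along the path is at most the
total gain.
\<close>

lemma drift_telescope:
  fixes f w :: "nat \<Rightarrow> real"
  assumes f: "\<And>k. 0 \<le> f k" "\<And>k. f k \<le> c * (real k + 1)"
    and w: "\<And>n. integrable (measure_pmf (crossings n)) w"
    and drift: "\<And>k. f k + w k \<le> mean (kernel k) f"
  shows "(\<Sum>n<N. mean (crossings n) w) \<le> mean (crossings N) f - f 1"
proof (induction N)
  case 0
  show ?case by simp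
next
  case (Suc N)
  have "mean (crossings N) f + mean (crossings N) w =
    mean (crossings N) (\<lambda>k. f k + w k)"
    using integrable_crossings[OF f] w by simp
  also have "\<dots> \<le> mean (crossings N) (\<lambda>k. mean (kernel k) f)"
    using integrable_crossings[OF f] w integrable_crossings_kernel[OF f] drift by (intro integral_mono) auto
  finally show ?case using Suc expectation_crossings_Suc[OF f, of N] by simp
qed

lemma expectation_alive: "mean p (indicator {1..}) = measure_pmf.prob p {1..}"
  by simp

lemma survival_0 [simp]: "survival 0 = 1"
  by (simp add: survival_def)

lemma survival_nonneg: "survival n \<ge> 0"
  by (simp add: survival_def)

text \<open>
Time spent among small states costs survival probability, because each of them is absorbed with probability at least \<open>c\<close>.
\<close>

lemma killing_sum:
  assumes "c \<ge> 0" and c: "\<And>k. k \<in> {1..<K} \<Longrightarrow> c \<le> pmf (kernel k) 0"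
  shows "c * measure_pmf.prob (crossings n) {1..<K} \<le> survival n - survival (Suc n)"
proof -
  have f: "0 \<le> (indicator {1..} k :: real)" "indicator {1..} k \<le> (1::real) * (real k + 1)" for k :: nat
    by (auto simp: indicator_def)
  have 1: "mean (kernel k) (indicator {1..}) = 1 - pmf (kernel k) 0" for k
  proof -
    have "{1..} = UNIV - {0::nat}" by auto
    then show ?thesis
      by (simp add: measure_pmf.prob_compl[of "{0}", simplified] measure_pmf_single)
  qed
  have "survival (Suc n) = mean (crossings n) (\<lambda>k. mean (kernel k) (indicator {1..}))"
    unfolding survival_def expectation_alive[symmetric] by (rule expectation_crossings_Suc[OF f])
  also have "\<dots> \<le> mean (crossings n) (\<lambda>k. indicator {1..} k - c * indicator {1..<K} k)"
  proof (intro integral_mono integrable_crossings_kernel[OF f] integrable_bounded[where c = "1 + c"])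
    fix k
    show "mean (kernel k) (indicator {1..}) \<le> indicator {1..} k - c * indicator {1..<K} k"
      unfolding 1 using c[of k] pmf_nonneg[of "kernel k" 0] by (cases "k = 0") (auto simp: indicator_def)
    show "\<bar>indicator {1..} k - c * indicator {1..<K} k\<bar> \<le> 1 + c" using assms(1) by (auto simp: indicator_def)
  qed
  also have "\<dots> = survival n - c * measure_pmf.prob (crossings n) {1..<K}"
    unfolding survival_def
    by (subst Bochner_Integration.integral_diff)
      (simp_all add: integrable_bounded[where c = 1] indicator_le_1 del: One_nat_def)
  finally show ?thesis by simp
qed

lemma survival_decreasing: "m \<le> n \<Longrightarrow> survival n \<le> survival m"
proof (rule lift_Suc_antimono_le[of survival])
  fix n
  have "0 * measure_pmf.prob (crossings n) {1..<0} \<le> survival n - survival (Suc n)"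
    by (rule killing_sum) simp_all
  then show "survival (Suc n) \<le> survival n" by simp
qed

lemma visits_bounded:
  obtains C where "C \<ge> 0" "\<And>N. (\<Sum>n<N. measure_pmf.prob (crossings n) {1..<K}) \<le> C"
proof -
  \<comment> \<open>the smallest absorption probability of the states below \<open>K\<close>; the element \<open>1\<close> makes the set nonempty\<close>
  define c where "c = Min (insert 1 ((\<lambda>k. pmf (kernel k) 0) ` {1..<K}))"
  have c: "c > 0" "\<And>k. k \<in> {1..<K} \<Longrightarrow> c \<le> pmf (kernel k) 0"
    unfolding c_def by (auto simp: kernel_killing simp del: Min_insert intro!: Min_le)
  have "(\<Sum>n<N. measure_pmf.prob (crossings n) {1..<K}) \<le> 1 / c" for N
  proof -
    have "c * (\<Sum>n<N. measure_pmf.prob (crossings n) {1..<K}) \<le> (\<Sum>n<N. survival n - survival (Suc n))"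
      unfolding sum_distrib_left using c by (intro sum_mono killing_sum) auto
    also have "\<dots> = survival 0 - survival N" by (rule sum_lessThan_telescope')
    also have "\<dots> \<le> 1" using survival_nonneg by simp
    finally show ?thesis using c(1) by (simp add: field_simps)
  qed
  then show ?thesis using that[of "1 / c"] c(1) by simp
qed

end

section \<open>Drift of the test functions in the critical case\<close>

locale critical_cookie_chain = cookie_chain +
  assumes critical: "mean_drift = 1"
begin

lemma expectation_kernel_polynomial:
  "mean (kernel k) (\<lambda>x. c0 + c1 * (real x - real k) + c2 * (real x - real k) ^ 2
      + c3 * (real x - real k) ^ 3 + c4 * (real x - real k) ^ 4) =
    c0 + c1 * mean (kernel k) (\<lambda>x. real x - real k)
       + c2 * mean (kernel k) (\<lambda>x. (real x - real k) ^ 2)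
       + c3 * mean (kernel k) (\<lambda>x. (real x - real k) ^ 3)
       + c4 * mean (kernel k) (\<lambda>x. (real x - real k) ^ 4)"
  "integrable (measure_pmf (kernel k)) (\<lambda>x. c0 + c1 * (real x - real k) + c2 * (real x - real k) ^ 2
      + c3 * (real x - real k) ^ 3 + c4 * (real x - real k) ^ 4)"
proof -
  have i: "integrable (measure_pmf (kernel k)) (\<lambda>x. (real x - real k) ^ i)" if "i \<le> 4" for i
    using integrable_shifted_power[OF integrable_kernel_fourth that, of k "- real k"] by simp
  have i1: "integrable (measure_pmf (kernel k)) (\<lambda>x. real x - real k)" using i[of 1] by simp
  show "mean (kernel k) (\<lambda>x. c0 + c1 * (real x - real k) + c2 * (real x - real k) ^ 2
      + c3 * (real x - real k) ^ 3 + c4 * (real x - real k) ^ 4) =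
    c0 + c1 * mean (kernel k) (\<lambda>x. real x - real k)
       + c2 * mean (kernel k) (\<lambda>x. (real x - real k) ^ 2)
       + c3 * mean (kernel k) (\<lambda>x. (real x - real k) ^ 3)
       + c4 * mean (kernel k) (\<lambda>x. (real x - real k) ^ 4)"
    using i1 i[of 2] i[of 3] i[of 4]
    by (simp add: Bochner_Integration.integral_add integral_mult_right_zero Bochner_Integration.integral_diff
        del: Bochner_Integration.integral_diff)
  show "integrable (measure_pmf (kernel k)) (\<lambda>x. c0 + c1 * (real x - real k) + c2 * (real x - real k) ^ 2
      + c3 * (real x - real k) ^ 3 + c4 * (real x - real k) ^ 4)"
    using i1 i[of 2] i[of 3] i[of 4]
    by (intro Bochner_Integration.integrable_add integrable_mult_right) auto
qed

text \<open>
All Taylor errors are bounded by multiples of this function; the exponent \<open>3/2\<close> is the drift of \<open>1 / sqrt (k + 1)\<close>.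
\<close>

definition error_weight :: "nat \<Rightarrow> real" where
  "error_weight k = of_bool (k \<ge> 1) / ((real k + 1) * sqrt (real k + 1))"

lemma error_weight_nonneg: "0 \<le> error_weight k" and error_weight_le_1: "error_weight k \<le> 1"
proof -
  show "0 \<le> error_weight k" by (simp add: error_weight_def)
  have "1 * 1 \<le> (real k + 1) * sqrt (real k + 1)" by (intro mult_mono) auto
  then show "error_weight k \<le> 1" by (auto simp: error_weight_def divide_le_eq)
qed

lemma error_weight_ge_square:
  assumes "k \<ge> 1" shows "1 / (real k + 1) ^ 2 \<le> error_weight k"
proof -
  have "sqrt (real k + 1) \<le> sqrt ((real k + 1) ^ 2)"
    by (intro real_sqrt_le_mono) (simp add: power2_eq_square)
  then have "(real k + 1) * sqrt (real k + 1) \<le> (real k + 1) ^ 2"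
    by (simp add: power2_eq_square mult_left_mono)
  then show ?thesis using assms
    by (auto simp: error_weight_def intro!: divide_left_mono mult_pos_pos)
qed

text \<open>
The generator \<open>k f'' + f'\<close> maps \<open>f = k powr (-1/2)\<close> to \<open>k powr (-3/2) / 4\<close>; half of that absorbs the error terms once \<open>k\<close> is
large.
\<close>

lemma inverse_sqrt_drift:
  obtains K where "K \<ge> M" and
    "\<And>k. k \<ge> K \<Longrightarrow> 1 / sqrt (real k + 1) + error_weight k / 8
        \<le> mean (kernel k) (\<lambda>x. 1 / sqrt (real x + 1))"
proof -
  obtain C where C: "C \<ge> 0" "\<And>k. k \<ge> M \<Longrightarrow> mean (kernel k) (\<lambda>x. real x - real k) = mean_drift"
    "\<And>k. k \<ge> M \<Longrightarrow> \<bar>mean (kernel k) (\<lambda>x. (real x - real k) ^ 2) - 2 * real k\<bar> \<le> C"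
    "\<And>k. k \<ge> M \<Longrightarrow> \<bar>mean (kernel k) (\<lambda>x. (real x - real k) ^ 3)\<bar> \<le> C * (real k + 1)"
    using kernel_moments by metis
  obtain K where K: "real K \<ge> 8 * (1 + C)" using real_arch_simple by blast
  have main: "1 / sqrt (real k + 1) + error_weight k / 8
        \<le> mean (kernel k) (\<lambda>x. 1 / sqrt (real x + 1))" if k: "k \<ge> max K M" for k
  proof -
    define s where "s = real k + 1"
    define m2 where "m2 = mean (kernel k) (\<lambda>x. (real x - real k) ^ 2)"
    define m3 where "m3 = mean (kernel k) (\<lambda>x. (real x - real k) ^ 3)"
    have s: "s \<ge> 1" "s > 0" "s \<ge> 8 * (1 + C)" using k K by (auto simp: s_def)
    have m2: "m2 \<ge> 2 * (s - 1) - C" using C(3)[of k] k by (auto simp: m2_def s_def abs_le_iff)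
    have m3: "m3 \<le> C * s" using C(4)[of k] k by (auto simp: m3_def s_def abs_le_iff)
    define q where "q = (\<lambda>x. 1 + (- 1 / (2 * s)) * (real x - real k) + (3 / (8 * s ^ 2)) * (real x - real k) ^ 2
      + (- 5 / (16 * s ^ 3)) * (real x - real k) ^ 3 + 0 * (real x - real k) ^ 4)"
    have qi: "integrable (measure_pmf (kernel k)) q" unfolding q_def by (rule expectation_kernel_polynomial)
    have "mean (kernel k) q = 1 - 1 / (2 * s) + 3 * m2 / (8 * s ^ 2) - 5 * m3 / (16 * s ^ 3)"
      unfolding q_def expectation_kernel_polynomial(1) m2_def m3_def using C(2)[of k] k critical by simp
    moreover have "3 * m2 / (8 * s ^ 2) \<ge> 3 * (2 * (s - 1) - C) / (8 * s ^ 2)"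
      using m2 s by (intro divide_right_mono mult_left_mono) auto
    moreover have "5 * m3 / (16 * s ^ 3) \<le> 5 * (C * s) / (16 * s ^ 3)"
      using m3 s by (intro divide_right_mono mult_left_mono) auto
    ultimately have "mean (kernel k) q \<ge>
       1 - 1 / (2 * s) + 3 * (2 * (s - 1) - C) / (8 * s ^ 2) - 5 * (C * s) / (16 * s ^ 3)" by linarith
    moreover have "1 - 1 / (2 * s) + 3 * (2 * (s - 1) - C) / (8 * s ^ 2) - 5 * (C * s) / (16 * s ^ 3)
        = 1 + 1 / (4 * s) - ((6 + 3 * C) / 8 + 5 * C / 16) / s ^ 2"
      using s(2) by (simp add: field_simps power2_eq_square power3_eq_cube)
    moreover have "((6 + 3 * C) / 8 + 5 * C / 16) / s ^ 2 \<le> (1 + C) / s ^ 2"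
      using C(1) by (intro divide_right_mono) (simp_all add: field_simps)
    moreover have "(1 + C) / s ^ 2 \<le> (s / 8) / s ^ 2"
      using s by (intro divide_right_mono) auto
    moreover have "(s / 8) / s ^ 2 = 1 / (8 * s)" using s by (simp add: power2_eq_square)
    moreover have "1 / (4 * s) = 2 * (1 / (8 * s))" by simp
    ultimately have q: "mean (kernel k) q \<ge> 1 + 1 / (8 * s)" by linarith
    have "1 / sqrt s + error_weight k / 8 \<le> 1 / sqrt s * (1 + 1 / (8 * s))"
    proof -
      have "error_weight k \<le> 1 / (s * sqrt s)"
        using s(2) unfolding error_weight_def s_def[symmetric] by (intro divide_right_mono) auto
      moreover have "1 / sqrt s * (1 + 1 / (8 * s)) = 1 / sqrt s + 1 / (s * sqrt s) / 8"
        by (simp add: ring_distribs)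
      ultimately show ?thesis by simp
    qed
    also have "\<dots> \<le> 1 / sqrt s * mean (kernel k) q"
      using q s by (intro mult_left_mono) auto
    also have "\<dots> = mean (kernel k) (\<lambda>x. 1 / sqrt s * q x)" by simp
    also have "\<dots> \<le> mean (kernel k) (\<lambda>x. 1 / sqrt (real x + 1))"
    proof (intro integral_mono integrable_mult_right qi integrable_bounded[where c = 1])
      fix x
      show "\<bar>1 / sqrt (real x + 1)\<bar> \<le> 1" by simp
      define t where "t = (real x - real k) / s"
      have t: "1 + t = (real x + 1) / s" using s by (simp add: t_def s_def field_simps)
      have "1 / sqrt (1 + t) \<ge> 1 - t / 2 + 3 * t^2 / 8 - 5 * t^3 / 16"
      proof (rule inverse_sqrt_ge_cubic)
        have "1 + t > 0" unfolding t using s by simp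
        then show "t > - 1" by simp
      qed
      moreover have "q x = 1 - t / 2 + 3 * t^2 / 8 - 5 * t^3 / 16"
        by (simp add: q_def t_def power_divide)
      moreover have "1 / sqrt (1 + t) = sqrt s / sqrt (real x + 1)"
        unfolding t by (simp add: real_sqrt_divide)
      ultimately have "1 / sqrt s * q x \<le> 1 / sqrt s * (sqrt s / sqrt (real x + 1))"
        using s by (intro mult_left_mono) auto
      then show "1 / sqrt s * q x \<le> 1 / sqrt (real x + 1)" using s by simp
    qed
    finally show ?thesis by (simp add: s_def)
  qed
  show ?thesis by (rule that[of "max K M"]) (use main in auto)
qed

text \<open>
The bounded function \<open>1 / sqrt (k + 1)\<close> cannot gain more than \<open>1\<close>, and the finitely many small states where its drift has no
sign are visited a bounded expected number of times.
\<close>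

lemma error_weight_summable:
  obtains C where "C \<ge> 0" "\<And>N. (\<Sum>n<N. mean (crossings n) error_weight) \<le> C"
proof -
  obtain K where K: "K \<ge> M" "\<And>k. k \<ge> K \<Longrightarrow> 1 / sqrt (real k + 1) + error_weight k / 8
        \<le> mean (kernel k) (\<lambda>x. 1 / sqrt (real x + 1))"
    using inverse_sqrt_drift by blast
  obtain C where C: "C \<ge> 0" "\<And>N. (\<Sum>n<N. measure_pmf.prob (crossings n) {1..<K}) \<le> C"
    using visits_bounded by blast
  define f where "f = (\<lambda>x. 1 / sqrt (real x + 1))"
  \<comment> \<open>below \<open>K\<close> the function may lose up to \<open>1\<close> in a step, which the second term outweighs\<close>
  define w where "w = (\<lambda>k. error_weight k / 8 - 2 * indicator {1..<K} k)"
  have f: "0 \<le> f k" "f k \<le> 1" "f k \<le> 1 * (real k + 1)" for k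
  proof -
    show "0 \<le> f k" "f k \<le> 1" by (auto simp: f_def divide_le_eq)
    then show "f k \<le> 1 * (real k + 1)" by simp
  qed
  have iW: "integrable (measure_pmf p) error_weight" for p
    using error_weight_nonneg error_weight_le_1 by (intro integrable_bounded[where c = 1]) (simp add: abs_of_nonneg)
  have iI: "integrable (measure_pmf p) (indicator {1..<K} :: nat \<Rightarrow> real)" for p
    by (intro integrable_bounded[where c = 1]) (simp add: indicator_def)
  have "f k + w k \<le> mean (kernel k) f" for k
  proof -
    consider "k = 0" | "k \<in> {1..<K}" | "k \<ge> K" by force
    then show ?thesis
    proof cases
      case 1
      then show ?thesis by (simp add: w_def error_weight_def)
    next
      case 2
      have "0 \<le> mean (kernel k) f" using f by (intro Bochner_Integration.integral_nonneg) auto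
      then show ?thesis using 2 f(2)[of k] error_weight_le_1[of k] by (simp add: w_def)
    next
      case 3
      then show ?thesis using K(2)[of k] by (simp add: w_def f_def)
    qed
  qed
  note T = drift_telescope[OF f(1,3) _ this]
  have "(\<Sum>n<N. mean (crossings n) error_weight) \<le> 8 * (1 + 2 * C)" for N
  proof -
    have "(\<Sum>n<N. mean (crossings n) w) \<le> mean (crossings N) f - f 1"
      by (rule T) (unfold w_def, intro Bochner_Integration.integrable_diff integrable_mult_right integrable_divide iW iI)
    also have "\<dots> \<le> mean (crossings N) (\<lambda>_. 1) - 0"
      using f by (intro diff_mono integral_mono integrable_bounded[where c = 1]) (auto simp: abs_of_nonneg)
    finally have "(\<Sum>n<N. mean (crossings n) w) \<le> 1" by simp
    moreover have "mean (crossings n) w = mean (crossings n) error_weight / 8 - 2 * measure_pmf.prob (crossings n) {1..<K}" for n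
      unfolding w_def
      by (subst Bochner_Integration.integral_diff) (simp_all add: iW iI integrable_divide integrable_mult_right del: One_nat_def)
    ultimately have "(\<Sum>n<N. mean (crossings n) error_weight) / 8 - 2 * (\<Sum>n<N. measure_pmf.prob (crossings n) {1..<K}) \<le> 1"
      by (simp add: sum_subtractf sum_distrib_left sum_divide_distrib)
    then show ?thesis using C(2)[of N] by simp
  qed
  then show ?thesis using that[of "8 * (1 + 2 * C)"] C(1) by simp
qed

definition log_scale :: "real \<Rightarrow> nat \<Rightarrow> real" where
  "log_scale a k = ln (1 + real k / a)"

lemma log_scale_nonneg: "a \<ge> 1 \<Longrightarrow> 0 \<le> log_scale a k"
  by (simp add: log_scale_def)

lemma log_scale_le: "a \<ge> 1 \<Longrightarrow> log_scale a k \<le> real k"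
proof -
  assume a: "a \<ge> 1"
  have "log_scale a k \<le> real k / a" unfolding log_scale_def using a by (intro ln_add_one_self_le_self) auto
  also have "\<dots> \<le> real k / 1" using a by (intro divide_left_mono) auto
  finally show ?thesis by simp
qed

lemma log_scale_linear: "a \<ge> 1 \<Longrightarrow> log_scale a k \<le> 1 * (real k + 1)"
  using log_scale_le[of a k] by simp

text \<open>
The generator \<open>k f'' + f'\<close> maps \<open>f = ln (a + k)\<close> to \<open>a / (a + k) ^ 2\<close>. The constant does not depend on \<open>a\<close>, so the same estimate
serves for the convergence of \<open>E ln (1 + Z n)\<close> (\<open>a = 1\<close>) and for occupation times (large \<open>a\<close>).
\<close>

lemma log_scale_drift:
  obtains C where "C \<ge> 0" and
    "\<And>a k. a \<ge> 1 \<Longrightarrow> \<bar>mean (kernel k) (log_scale a) - log_scale a k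
        - of_bool (k \<ge> 1) * a / (a + real k) ^ 2\<bar> \<le> C * error_weight k"
proof -
  obtain C where C: "C \<ge> 0" "\<And>k. k \<ge> M \<Longrightarrow> mean (kernel k) (\<lambda>x. real x - real k) = mean_drift"
    "\<And>k. k \<ge> M \<Longrightarrow> \<bar>mean (kernel k) (\<lambda>x. (real x - real k) ^ 2) - 2 * real k\<bar> \<le> C"
    "\<And>k. k \<ge> M \<Longrightarrow> \<bar>mean (kernel k) (\<lambda>x. (real x - real k) ^ 3)\<bar> \<le> C * (real k + 1)"
    "\<And>k. k \<ge> M \<Longrightarrow> mean (kernel k) (\<lambda>x. (real x - real k) ^ 4) \<le> C * (real k + 1) ^ 2"
    using kernel_moments by metis
  define C' where "C' = 64 * C + (3 * real M + 2) * (real M + 1) ^ 2"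
  have C': "C' \<ge> 64 * C" "C' \<ge> (3 * real M + 2) * (real M + 1) ^ 2" "C' \<ge> 0" using C(1) by (auto simp: C'_def)
  have main: "\<bar>mean (kernel k) (log_scale a) - log_scale a k
        - of_bool (k \<ge> 1) * a / (a + real k) ^ 2\<bar> \<le> C' * error_weight k" if a: "a \<ge> 1" for a k
  proof -
    consider "k = 0" | "k \<ge> 1" "k < M" | "k \<ge> 1" "k \<ge> M" by linarith
    then show ?thesis
    proof cases
      case 1
      then show ?thesis by (simp add: log_scale_def error_weight_def)
    next
      case 2
      have "0 \<le> mean (kernel k) (log_scale a)"
        using log_scale_nonneg[OF a] by (intro Bochner_Integration.integral_nonneg) auto
      moreover have "mean (kernel k) (log_scale a) \<le> 1 * (real k + real M + 1)"
        by (rule expectation_kernel_le[OF log_scale_nonneg[OF a] log_scale_linear[OF a]])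
      moreover have "0 \<le> a / (a + real k) ^ 2" "a / (a + real k) ^ 2 \<le> 1"
      proof -
        have "a * 1 \<le> (a + real k) * (a + real k)" using a by (intro mult_mono) auto
        then show "0 \<le> a / (a + real k) ^ 2" "a / (a + real k) ^ 2 \<le> 1"
          using a by (auto simp: divide_le_eq power2_eq_square)
      qed
      ultimately have "\<bar>mean (kernel k) (log_scale a) - log_scale a k
        - of_bool (k \<ge> 1) * a / (a + real k) ^ 2\<bar> \<le> 3 * real M + 2"
        using 2 log_scale_nonneg[OF a, of k] log_scale_le[OF a, of k] by (simp add: abs_le_iff)
      also have "\<dots> = ((3 * real M + 2) * (real M + 1) ^ 2) * (1 / (real M + 1) ^ 2)" by simp
      also have "\<dots> \<le> C' * (1 / (real k + 1) ^ 2)"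
        using C' 2 by (intro mult_mono divide_left_mono power_mono) auto
      also have "\<dots> \<le> C' * error_weight k" using C' 2 by (intro mult_left_mono error_weight_ge_square) auto
      finally show ?thesis .
    next
      case 3
      define s where "s = a + real k"
      have s: "s > 0" "s \<ge> 1" "s \<ge> real k + 1" using a by (auto simp: s_def)
      define m where "m = (\<lambda>i. mean (kernel k) (\<lambda>x. (real x - real k) ^ i))"
      have m: "m 1 = 1" "\<bar>m 2 - 2 * real k\<bar> \<le> C" "\<bar>m 3\<bar> \<le> C * (real k + 1)" "m 4 \<le> C * (real k + 1) ^ 2"
        using C(2-5)[OF 3(2)] critical by (auto simp: m_def)
      have m4: "m 4 \<ge> 0" unfolding m_def by (intro Bochner_Integration.integral_nonneg) auto
      \<comment> \<open>for \<open>t < -1/2\<close> one has \<open>16 t ^ 4 \<ge> 1\<close>, so this coefficient covers the worst case \<open>ln (1 + t) \<ge> - ln (1 + k)\<close>\<close>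
      define R where "R = 1 + 16 * ln (1 + real k)"
      have R: "R \<ge> 1" by (simp add: R_def)
      define qu where "qu = (\<lambda>x. log_scale a k + (1 / s) * (real x - real k) + (- 1 / (2 * s ^ 2)) * (real x - real k) ^ 2
          + (1 / (3 * s ^ 3)) * (real x - real k) ^ 3 + 0 * (real x - real k) ^ 4)"
      define ql where "ql = (\<lambda>x. log_scale a k + (1 / s) * (real x - real k) + (- 1 / (2 * s ^ 2)) * (real x - real k) ^ 2
          + (1 / (3 * s ^ 3)) * (real x - real k) ^ 3 + (- R / s ^ 4) * (real x - real k) ^ 4)"
      have i: "integrable (measure_pmf (kernel k)) qu" "integrable (measure_pmf (kernel k)) ql"
        "integrable (measure_pmf (kernel k)) (log_scale a)"
        unfolding qu_def ql_def by (rule expectation_kernel_polynomial integrable_kernel[OF log_scale_nonneg[OF a] log_scale_linear[OF a]])+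
      have ulog: "log_scale a x \<le> qu x" and llog: "ql x \<le> log_scale a x" for x
      proof -
        define t where "t = (real x - real k) / s"
        have t1: "1 + t = (a + real x) / s" using s by (simp add: t_def s_def field_simps)
        have t: "t > - 1"
        proof -
          have "1 + t > 0" unfolding t1 using s a by (intro divide_pos_pos) auto
          then show ?thesis by simp
        qed
        have lx: "log_scale a x = log_scale a k + ln (1 + t)"
        proof -
          have "1 + real x / a = (1 + real k / a) * (1 + t)"
          proof -
            have "(1 + real k / a) * a = s" "(1 + real x / a) * a = a + real x" using a by (auto simp: s_def field_simps)
            then have "((1 + real k / a) * a) * ((a + real x) / s) = (1 + real x / a) * a" using s(1) by simp
            then have "(1 + real k / a) * ((a + real x) / s) * a = (1 + real x / a) * a" by (simp only: mult.commute mult.left_commute)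
            moreover have "a \<noteq> 0" using a by simp
            ultimately show ?thesis unfolding t1 by (metis mult_right_cancel)
          qed
          then show ?thesis unfolding log_scale_def
            using a t ln_mult_pos[of "1 + real k / a" "1 + t"] by (simp add: add_pos_nonneg)
        qed
        have qt: "qu x = log_scale a k + (t - t^2 / 2 + t^3 / 3)" "ql x = log_scale a k + (t - t^2 / 2 + t^3 / 3 - R * t^4)"
          by (simp_all add: qu_def ql_def t_def power_divide)
        show "log_scale a x \<le> qu x" unfolding lx qt using ln_le_cubic[OF t] by simp
        have "t - t^2 / 2 + t^3 / 3 - R * t^4 \<le> ln (1 + t)"
        proof (cases "t \<ge> - 1 / 2")
          case True
          have "1 * t^4 \<le> R * t^4" using R by (intro mult_right_mono) auto
          then show ?thesis using ln_ge_quartic[OF True] by linarith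
        next
          case False
          have "(1/2) ^ 4 \<le> (- t) ^ 4" using False by (intro power_mono) auto
          then have t4: "1 / 16 \<le> t ^ 4" by (simp add: power_divide)
          have "- ln (1 + real k) \<le> ln (1 + t)"
          proof -
            have "log_scale a k \<le> log_scale 1 k"
              unfolding log_scale_def using a by (intro ln_mono) (auto intro!: add_pos_nonneg divide_left_mono simp: divide_le_eq mult_le_cancel_left1)
            then show ?thesis using lx log_scale_nonneg[OF a, of x] by (simp add: log_scale_def)
          qed
          moreover have "R * (1 / 16) \<le> R * t ^ 4" using t4 R by (intro mult_left_mono) auto
          moreover have "ln (1 + real k) \<le> R * (1 / 16)" by (simp add: R_def)
          moreover have "t < 0" using False by simp
          moreover have "t ^ 3 \<le> 0" using \<open>t < 0\<close> by (simp add: power_le_zero_eq)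
          moreover have "t ^ 2 \<ge> 0" by simp
          ultimately show ?thesis by linarith
        qed
        then show "ql x \<le> log_scale a x" unfolding lx qt by simp
      qed
      have eu: "mean (kernel k) qu = log_scale a k + 1 / s - m 2 / (2 * s ^ 2) + m 3 / (3 * s ^ 3)"
        unfolding qu_def expectation_kernel_polynomial(1) using m(1) by (simp add: m_def)
      have el: "mean (kernel k) ql = log_scale a k + 1 / s - m 2 / (2 * s ^ 2) + m 3 / (3 * s ^ 3) - R * m 4 / s ^ 4"
        unfolding ql_def expectation_kernel_polynomial(1) using m(1) by (simp add: m_def)
      define D where "D = mean (kernel k) (log_scale a) - log_scale a k"
      have D: "D \<le> 1 / s - m 2 / (2 * s ^ 2) + m 3 / (3 * s ^ 3)"
        "1 / s - m 2 / (2 * s ^ 2) + m 3 / (3 * s ^ 3) - R * m 4 / s ^ 4 \<le> D"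
        using integral_mono[OF i(3) i(1) ulog] integral_mono[OF i(2) i(3) llog] unfolding eu el D_def by linarith+
      define r where "r = 1 / (real k + 1) ^ 2"
      have b2: "\<bar>1 / s - m 2 / (2 * s ^ 2) - a / s ^ 2\<bar> \<le> C / 2 * r"
      proof -
        have "1 / s - m 2 / (2 * s ^ 2) - a / s ^ 2 = - (m 2 - 2 * real k) / (2 * s ^ 2)"
          using s(1) by (simp add: field_simps power2_eq_square) (simp add: s_def algebra_simps)
        then have "\<bar>1 / s - m 2 / (2 * s ^ 2) - a / s ^ 2\<bar> = \<bar>m 2 - 2 * real k\<bar> / (2 * s ^ 2)"
          by (simp add: abs_minus_commute)
        also have "\<dots> \<le> C / (2 * (real k + 1) ^ 2)"
          using m(2) s C(1) by (intro frac_le mult_left_mono power_mono) auto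
        finally show ?thesis by (simp add: r_def)
      qed
      have b3: "\<bar>m 3 / (3 * s ^ 3)\<bar> \<le> C / 3 * r"
      proof -
        have "\<bar>m 3 / (3 * s ^ 3)\<bar> = \<bar>m 3\<bar> / (3 * s ^ 3)" using s by (simp add: abs_mult)
        also have "\<dots> \<le> (C * (real k + 1)) / (3 * (real k + 1) ^ 3)"
          using m(3) s C(1) by (intro frac_le mult_left_mono power_mono) auto
        also have "\<dots> = C / 3 * r" by (simp add: r_def power2_eq_square power3_eq_cube)
        finally show ?thesis .
      qed
      have b4: "R * m 4 / s ^ 4 \<le> R * C * r"
      proof -
        have "R * m 4 / s ^ 4 \<le> (R * (C * (real k + 1) ^ 2)) / (real k + 1) ^ 4"
          using m(4) m4 s R C(1) by (intro frac_le mult_left_mono power_mono mult_nonneg_nonneg) auto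
        also have "\<dots> = R * C * r" by (simp add: r_def power2_eq_square power4_eq_xxxx)
        finally show ?thesis .
      qed
      have r: "r \<ge> 0" by (simp add: r_def)
      have "0 \<le> C * r" using C(1) r by simp
      moreover have "1 * (C * r) \<le> R * (C * r)" using R C(1) r by (intro mult_right_mono) auto
      ultimately have "\<bar>D - a / s ^ 2\<bar> \<le> 2 * (R * C * r)"
        using b2 b3 b4 D unfolding abs_le_iff by (simp add: mult.assoc)
      also have "\<dots> \<le> C' * error_weight k"
      proof -
        define q where "q = sqrt (real k + 1)"
        have q: "q \<ge> 1" "q ^ 2 = real k + 1" by (auto simp: q_def)
        have "ln (1 + real k) \<le> 2 * sqrt (1 + real k) - 2" by (rule ln_le_two_sqrt) auto
        then have "R \<le> 32 * q" unfolding R_def q_def by (simp add: add.commute)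
        then have "2 * (R * C * r) \<le> 2 * (32 * q * C * r)"
          using C(1) r by (intro mult_left_mono mult_right_mono) auto
        also have "\<dots> = 64 * C * error_weight k"
          using 3 q unfolding error_weight_def r_def q_def[symmetric] q(2)[symmetric] by (simp add: field_simps power2_eq_square)
        also have "\<dots> \<le> C' * error_weight k" using C'(1) error_weight_nonneg by (intro mult_right_mono) auto
        finally show ?thesis .
      qed
      finally show ?thesis using 3 by (simp add: D_def s_def)
    qed
  qed
  show ?thesis by (rule that[of C']) (use main C' in auto)
qed

end

section \<open>Survival of the critical chain\<close>

text \<open>
Exponents will only be known up to \<open>e\<close>; this lets \<open>e\<close> tend to \<open>0\<close> after \<open>n\<close> has tended to infinity.
\<close>

lemma tendsto_sandwich_family:
  fixes x :: "nat \<Rightarrow> real" and A B :: "real \<Rightarrow> real"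
  assumes "\<And>e. 0 < e \<Longrightarrow> e < 1 \<Longrightarrow> \<exists>l u. (\<forall>\<^sub>F n in sequentially. l n \<le> x n \<and> x n \<le> u n) \<and> l \<longlonglongrightarrow> A e \<and> u \<longlonglongrightarrow> B e"
    and A: "(A \<longlongrightarrow> L) (at_right 0)" and B: "(B \<longlongrightarrow> L) (at_right 0)"
  shows "x \<longlonglongrightarrow> L"
proof -
  have small: "\<forall>\<^sub>F e in at_right (0::real). 0 < e \<and> e < 1"
    by (auto simp: eventually_at_right_field intro: exI[of _ 1])
  show ?thesis
  proof (rule order_tendstoI)
    fix r assume "r < L"
    with A have "\<forall>\<^sub>F e in at_right 0. r < A e" by (rule order_tendstoD)
    with small have "\<forall>\<^sub>F e in at_right 0. 0 < e \<and> e < 1 \<and> r < A e" by eventually_elim auto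
    then obtain e where e: "0 < e" "e < 1" "r < A e"
      using eventually_happens'[OF trivial_limit_at_right_real] by blast
    obtain l u where lu: "\<forall>\<^sub>F n in sequentially. l n \<le> x n \<and> x n \<le> u n" and l2: "l \<longlonglongrightarrow> A e"
      using assms(1)[OF e(1,2)] by blast
    from lu have l1: "\<forall>\<^sub>F n in sequentially. l n \<le> x n" by (rule eventually_mono) simp
    have "\<forall>\<^sub>F n in sequentially. r < l n" using l2 e(3) by (rule order_tendstoD)
    with l1 show "\<forall>\<^sub>F n in sequentially. r < x n" by eventually_elim auto
  next
    fix r assume "L < r"
    with B have "\<forall>\<^sub>F e in at_right 0. B e < r" by (rule order_tendstoD)
    with small have "\<forall>\<^sub>F e in at_right 0. 0 < e \<and> e < 1 \<and> B e < r" by eventually_elim auto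
    then obtain e where e: "0 < e" "e < 1" "B e < r"
      using eventually_happens'[OF trivial_limit_at_right_real] by blast
    obtain l u where lu: "\<forall>\<^sub>F n in sequentially. l n \<le> x n \<and> x n \<le> u n" and u2: "u \<longlonglongrightarrow> B e"
      using assms(1)[OF e(1,2)] by blast
    from lu have u1: "\<forall>\<^sub>F n in sequentially. x n \<le> u n" by (rule eventually_mono) simp
    have "\<forall>\<^sub>F n in sequentially. u n < r" using u2 e(3) by (rule order_tendstoD)
    with u1 show "\<forall>\<^sub>F n in sequentially. x n < r" by eventually_elim auto
  qed
qed

context critical_cookie_chain
begin

definition mean_log :: "nat \<Rightarrow> real" where
  "mean_log n = mean (crossings n) (log_scale 1)"

lemma integrable_error_weight: "integrable (measure_pmf p) error_weight"
  using error_weight_nonneg error_weight_le_1 by (intro integrable_bounded[where c = 1]) (simp add: abs_of_nonneg)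

text \<open>
The increments are dominated by the summable means of \<open>error_weight\<close>.
\<close>

lemma mean_log_convergent: "convergent mean_log"
proof -
  obtain C where C: "C \<ge> 0" and drift: "\<And>a k. a \<ge> 1 \<Longrightarrow> \<bar>mean (kernel k) (log_scale a) - log_scale a k
        - of_bool (k \<ge> 1) * a / (a + real k) ^ 2\<bar> \<le> C * error_weight k"
    using log_scale_drift by blast
  note drift1 = drift[OF order_refl]
  obtain B where B: "\<And>N. (\<Sum>n<N. mean (crossings n) error_weight) \<le> B"
    using error_weight_summable by blast
  have b: "\<bar>mean (kernel k) (log_scale 1) - log_scale 1 k\<bar> \<le> (C + 1) * error_weight k" for k
  proof -
    have "\<bar>of_bool (k \<ge> 1) * 1 / (1 + real k) ^ 2\<bar> \<le> error_weight k"
      using error_weight_ge_square[of k] error_weight_nonneg[of k] by (cases "k \<ge> 1") (auto simp: add.commute)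
    moreover have "(C + 1) * error_weight k = C * error_weight k + error_weight k" by (simp add: algebra_simps)
    ultimately show ?thesis using drift1[of k] unfolding abs_le_iff by linarith
  qed
  note ls = log_scale_nonneg[of 1, OF order_refl] log_scale_linear[of 1, OF order_refl]
  have inc: "\<bar>mean_log (Suc n) - mean_log n\<bar> \<le> (C + 1) * mean (crossings n) error_weight" for n
  proof -
    have "mean_log (Suc n) - mean_log n = mean (crossings n) (\<lambda>k. mean (kernel k) (log_scale 1) - log_scale 1 k)"
      unfolding mean_log_def expectation_crossings_Suc[OF ls]
      by (intro Bochner_Integration.integral_diff[symmetric] integrable_crossings_kernel[OF ls] integrable_crossings[OF ls])
    also have "\<bar>\<dots>\<bar> \<le> mean (crossings n) (\<lambda>k. (C + 1) * error_weight k)"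
      by (rule order_trans[OF integral_abs_bound], intro integral_mono)
        (auto intro!: b integrable_error_weight integrable_abs integrable_crossings_kernel[OF ls] integrable_crossings[OF ls])
    finally show ?thesis by simp
  qed
  have "summable (\<lambda>n. mean (crossings n) error_weight)"
    by (rule summableI_nonneg_bounded[of _ B]) (auto intro!: B Bochner_Integration.integral_nonneg error_weight_nonneg)
  then have "summable (\<lambda>n. (C + 1) * mean (crossings n) error_weight)"
    by (rule summable_mult)
  then have "summable (\<lambda>n. mean_log (Suc n) - mean_log n)"
  proof (rule summable_comparison_test'[where N = 0])
    show "norm (mean_log (Suc n) - mean_log n) \<le> (C + 1) * mean (crossings n) error_weight" for n
      unfolding real_norm_def by (rule inc)
  qed
  then have "(\<lambda>n. \<Sum>i<n. mean_log (Suc i) - mean_log i) \<longlonglongrightarrow> (\<Sum>n. mean_log (Suc n) - mean_log n)"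
    by (rule summable_LIMSEQ)
  then have "(\<lambda>n. mean_log n - mean_log 0) \<longlonglongrightarrow> (\<Sum>n. mean_log (Suc n) - mean_log n)"
    by (simp add: sum_lessThan_telescope)
  from tendsto_add[OF this tendsto_const[of "mean_log 0"]] show ?thesis
    by (auto simp: convergent_def)
qed

text \<open>
Adding a multiple of \<open>1 / sqrt (k + 1)\<close> compensates the negative part of the drift of the logarithm above \<open>K\<close>, and truncating at a
level that the sum does not exceed below \<open>K\<close> gives a submartingale \<open>h\<close> that vanishes at the small states. Its mean is positive
after one step and never decreases.
\<close>

lemma mean_log_limit_positive: "lim mean_log > 0"
proof -
  obtain C where C: "C \<ge> 0" and drift: "\<And>a k. a \<ge> 1 \<Longrightarrow> \<bar>mean (kernel k) (log_scale a) - log_scale a k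
        - of_bool (k \<ge> 1) * a / (a + real k) ^ 2\<bar> \<le> C * error_weight k"
    using log_scale_drift by blast
  note drift1 = drift[OF order_refl]
  obtain K where K: "K \<ge> M" "\<And>k. k \<ge> K \<Longrightarrow> 1 / sqrt (real k + 1) + error_weight k / 8
        \<le> mean (kernel k) (\<lambda>x. 1 / sqrt (real x + 1))"
    using inverse_sqrt_drift by blast
  define f where "f = (\<lambda>x. 1 / sqrt (real x + 1))"
  have f: "0 \<le> f k" "f k \<le> 1" for k by (auto simp: f_def divide_le_eq)
  have f1: "f k \<le> 1 * (real k + 1)" for k using f(2)[of k] by simp
  note ls = log_scale_nonneg[of 1, OF order_refl] log_scale_linear[of 1, OF order_refl]
  define A where "A = 8 * C"
  define B where "B = ln (1 + real K) + A"
  define g where "g = (\<lambda>k. log_scale 1 k + A * f k - B)"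
  define h where "h = (\<lambda>k. max 0 (g k))"
  have A: "A \<ge> 0" using C by (simp add: A_def)
  have gls: "g k \<le> log_scale 1 k" for k
  proof -
    have "A * f k \<le> A * 1" using f A by (intro mult_left_mono) auto
    moreover have "0 \<le> ln (1 + real K)" by simp
    ultimately show ?thesis unfolding g_def B_def by linarith
  qed
  have h: "0 \<le> h k" "h k \<le> log_scale 1 k" for k using gls ls(1) by (auto simp: h_def)
  have hlin: "h k \<le> 1 * (real k + 1)" for k using h(2) ls(2) by (rule order_trans)
  note hint = integrable_kernel[OF h(1) hlin] integrable_crossings[OF h(1) hlin]
    integrable_crossings_kernel[OF h(1) hlin]
  have sub: "h k \<le> mean (kernel k) h" for k
  proof (cases "k < K")
    case True
    have "log_scale 1 k \<le> ln (1 + real K)" unfolding log_scale_def using True by (subst ln_le_cancel_iff) auto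
    moreover have "A * f k \<le> A * 1" using f A by (intro mult_left_mono) auto
    ultimately have "h k = 0" by (simp add: h_def g_def B_def)
    then show ?thesis using h by (simp add: Bochner_Integration.integral_nonneg)
  next
    case False
    have "mean (kernel k) (log_scale 1) \<ge> log_scale 1 k - C * error_weight k"
    proof -
      have "0 \<le> of_bool (k \<ge> 1) * 1 / (1 + real k) ^ 2" by simp
      then show ?thesis using drift1[of k] unfolding abs_le_iff by linarith
    qed
    moreover have "A * (f k + error_weight k / 8) \<le> A * mean (kernel k) f"
      using K(2)[of k] False A by (intro mult_left_mono) (auto simp: f_def)
    moreover have "A * (f k + error_weight k / 8) = A * f k + C * error_weight k"
      by (simp add: A_def algebra_simps)
    moreover have "mean (kernel k) g = mean (kernel k) (log_scale 1) + A * mean (kernel k) f - B"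
      unfolding g_def using integrable_kernel[OF ls] integrable_kernel[OF f(1) f1] by simp
    moreover have "integrable (measure_pmf (kernel k)) g"
      unfolding g_def using integrable_kernel[OF ls] integrable_kernel[OF f(1) f1] by simp
    moreover from this have "mean (kernel k) g \<le> mean (kernel k) h"
      by (intro integral_mono hint) (auto simp: h_def)
    ultimately have "g k \<le> mean (kernel k) h" by (simp add: g_def)
    then show ?thesis using h by (simp add: h_def Bochner_Integration.integral_nonneg)
  qed
  define H where "H = (\<lambda>n. mean (crossings n) h)"
  have Hinc: "H n \<le> H (Suc n)" for n
    unfolding H_def expectation_crossings_Suc[OF h(1) hlin] by (intro integral_mono hint sub)
  have mono: "H 1 \<le> H (Suc n)" for n by (rule lift_Suc_mono_le[of H, OF Hinc]) simp
  obtain m where m: "real m \<ge> exp B" using real_arch_simple by blast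
  obtain m' where m': "m' \<ge> m" "m' \<in> set_pmf (kernel 1)" using kernel_1_unbounded by blast
  have "h m' > 0"
  proof -
    have "B = ln (exp B)" by simp
    also have "\<dots> < ln (1 + real m')" using m m'(1) by (subst ln_less_cancel_iff) (auto intro: add_pos_nonneg)
    finally have "B < ln (1 + real m')" .
    moreover have "0 \<le> A * f m'" using A f by simp
    ultimately have "0 < g m'" unfolding g_def log_scale_def by simp
    then show ?thesis by (simp add: h_def)
  qed
  then have "0 < h m' * pmf (kernel 1) m'" using m'(2) by (simp add: pmf_positive)
  also have "\<dots> = mean (kernel 1) (\<lambda>x. h m' * indicator {m'} x)"
    by (simp add: measure_pmf_single)
  also have "\<dots> \<le> mean (kernel 1) h"
    using h by (intro integral_mono hint integrable_mult_right integrable_bounded[where c = 1]) (auto simp: indicator_def)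
  also have "\<dots> = H 1" by (simp add: H_def bind_return_pmf)
  finally have pos: "0 < H 1" .
  have "H 1 \<le> mean_log n" if "n \<ge> 1" for n
  proof -
    have "H 1 \<le> H n" using mono[of "n - 1"] that by simp
    also have "\<dots> \<le> mean_log n" unfolding H_def mean_log_def by (intro integral_mono hint integrable_crossings[OF ls] h)
    finally show ?thesis .
  qed
  then have "H 1 \<le> lim mean_log"
    using mean_log_convergent unfolding convergent_LIMSEQ_iff by (rule_tac LIMSEQ_le_const) auto
  with pos show ?thesis by simp
qed

text \<open>
The drift of \<open>log_scale a\<close> is at least \<open>1 / (4 a)\<close> on \<open>{1..a}\<close>, up to summable errors, while its mean is at most that of
\<open>log_scale 1\<close> and hence bounded.
\<close>

lemma occupation_bound:
  obtains C where "C \<ge> 0" and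
    "\<And>a N. a \<ge> 1 \<Longrightarrow> (\<Sum>n<N. measure_pmf.prob (crossings n) {k. k \<ge> 1 \<and> real k \<le> a}) \<le> C * a"
proof -
  obtain C where C: "C \<ge> 0" "\<And>a k. a \<ge> 1 \<Longrightarrow> \<bar>mean (kernel k) (log_scale a) - log_scale a k
        - of_bool (k \<ge> 1) * a / (a + real k) ^ 2\<bar> \<le> C * error_weight k"
    using log_scale_drift by blast
  obtain B where B: "B \<ge> 0" "\<And>N. (\<Sum>n<N. mean (crossings n) error_weight) \<le> B"
    using error_weight_summable by blast
  obtain D where D: "\<And>n. mean_log n \<le> D"
    using convergent_imp_Bseq[OF mean_log_convergent] by (auto simp: Bseq_def abs_le_iff)
  define C' where "C' = 4 * (\<bar>D\<bar> + C * B)"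
  have "(\<Sum>n<N. measure_pmf.prob (crossings n) {k. k \<ge> 1 \<and> real k \<le> a}) \<le> C' * a" if a: "a \<ge> 1" for a N
  proof -
    define w where "w = (\<lambda>k. 1 / (4 * a) * indicator {k. k \<ge> 1 \<and> real k \<le> a} k - C * error_weight k)"
    note ls = log_scale_nonneg[OF a] log_scale_linear[OF a]
    have iI: "integrable (measure_pmf p) (indicator {k. k \<ge> 1 \<and> real k \<le> a} :: nat \<Rightarrow> real)" for p
      by (intro integrable_bounded[where c = 1]) (simp add: indicator_def)
    have "log_scale a k + w k \<le> mean (kernel k) (log_scale a)" for k
    proof -
      have "1 / (4 * a) * indicator {k. k \<ge> 1 \<and> real k \<le> a} k \<le> of_bool (k \<ge> 1) * a / (a + real k) ^ 2"
      proof (cases "k \<ge> 1 \<and> real k \<le> a")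
        case True
        have "1 / (4 * a) = a / (2 * a) ^ 2" using a by (simp add: power2_eq_square)
        also have "\<dots> \<le> a / (a + real k) ^ 2" using True a by (intro divide_left_mono power_mono) auto
        finally show ?thesis using True by simp
      qed (use a in auto)
      then show ?thesis using C(2)[OF a, of k] unfolding w_def abs_le_iff by linarith
    qed
    moreover have "integrable (measure_pmf (crossings n)) w" for n
      unfolding w_def by (intro Bochner_Integration.integrable_diff integrable_mult_right iI integrable_error_weight)
    ultimately have "(\<Sum>n<N. mean (crossings n) w) \<le> mean (crossings N) (log_scale a) - log_scale a 1"
      by (intro drift_telescope[OF ls])
    also have "\<dots> \<le> mean (crossings N) (log_scale 1) - 0"
    proof (intro diff_mono integral_mono integrable_crossings[OF ls]
        integrable_crossings[OF log_scale_nonneg[of 1, OF order_refl] log_scale_linear[of 1, OF order_refl]])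
      fix k
      show "log_scale a k \<le> log_scale 1 k"
        unfolding log_scale_def using a by (intro ln_mono) (auto intro!: add_pos_nonneg divide_left_mono simp: divide_le_eq mult_le_cancel_left1)
    qed (rule ls)
    also have "\<dots> \<le> \<bar>D\<bar>" using D[of N] by (simp add: mean_log_def)
    finally have "(\<Sum>n<N. mean (crossings n) w) \<le> \<bar>D\<bar>" .
    moreover have "mean (crossings n) w =
        measure_pmf.prob (crossings n) {k. k \<ge> 1 \<and> real k \<le> a} / (4 * a) - C * mean (crossings n) error_weight" for n
      unfolding w_def
      by (subst Bochner_Integration.integral_diff) (simp_all add: iI integrable_error_weight integrable_divide integrable_mult_right del: One_nat_def)
    ultimately have "(\<Sum>n<N. measure_pmf.prob (crossings n) {k. k \<ge> 1 \<and> real k \<le> a}) / (4 * a)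
        - C * (\<Sum>n<N. mean (crossings n) error_weight) \<le> \<bar>D\<bar>"
      by (simp add: sum_subtractf sum_distrib_left sum_divide_distrib)
    moreover have "C * (\<Sum>n<N. mean (crossings n) error_weight) \<le> C * B"
      using B C by (intro mult_left_mono) auto
    ultimately have "(\<Sum>n<N. measure_pmf.prob (crossings n) {k. k \<ge> 1 \<and> real k \<le> a}) / (4 * a) \<le> \<bar>D\<bar> + C * B" by linarith
    then show ?thesis using a by (simp add: C'_def field_simps)
  qed
  moreover have "C' \<ge> 0" using B C by (simp add: C'_def)
  ultimately show ?thesis using that by blast
qed

end

context critical_cookie_chain
begin

text \<open>
This is the tangent bound \<open>ln y \<le> ln b + y / b - 1\<close>, applied on survival; it replaces conditioning on survival and Jensen's
inequality.
\<close>

lemma mean_log_le_survival: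
  assumes b: "b \<ge> 1"
  shows "mean_log n \<le> survival n * ln b + (2 + real M * real n) / b"
proof -
  note ls = log_scale_nonneg[of 1, OF order_refl] log_scale_linear[of 1, OF order_refl]
  have ind: "integrable (measure_pmf p) (indicator A :: nat \<Rightarrow> real)" for p A
    by (intro integrable_bounded[where c = 1]) (simp add: indicator_def)
  have i: "integrable (measure_pmf (crossings n)) (\<lambda>k. indicator {1..} k * ln b + (real k + 1) / b)"
    by (intro Bochner_Integration.integrable_add integrable_mult_left integrable_divide measure_pmf.integrable_const crossings_mean ind)
  have "mean_log n \<le> mean (crossings n) (\<lambda>k. indicator {1..} k * ln b + (real k + 1) / b)"
    unfolding mean_log_def
  proof (intro integral_mono i integrable_crossings[OF ls])
    fix k :: nat
    show "log_scale 1 k \<le> indicator {1..} k * ln b + (real k + 1) / b"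
    proof (cases "k \<ge> 1")
      case True
      have "ln (1 + real k) = ln b + ln ((1 + real k) / b)" using b by (simp add: ln_div)
      also have "ln ((1 + real k) / b) \<le> (1 + real k) / b - 1" using b by (intro ln_le_minus_one) auto
      finally show ?thesis using True by (simp add: log_scale_def add.commute)
    next
      case False
      then have "k = 0" by simp
      then show ?thesis using b by (simp add: log_scale_def)
    qed
  qed
  also have "\<dots> = survival n * ln b + (mean (crossings n) real + 1) / b"
    unfolding survival_def using crossings_mean(1)[of n]
    by (simp add: Bochner_Integration.integral_add ind integrable_mult_left integrable_divide del: One_nat_def)
  also have "\<dots> \<le> survival n * ln b + (2 + real M * real n) / b"
    using crossings_mean(2)[of n] b by (intro add_left_mono divide_right_mono) auto
  finally show ?thesis .
qed

text \<open>
By the occupation bound some time in \<open>{N..<2 N}\<close> has small probability to find the chain in \<open>{1..a}\<close>. Survival up to \<open>2 N\<close> then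
forces a value above \<open>a\<close> at that time, where the logarithm is at least \<open>ln a\<close>.
\<close>

lemma survival_small_level:
  assumes C: "\<And>a N. a \<ge> 1 \<Longrightarrow> (\<Sum>n<N. measure_pmf.prob (crossings n) {k. k \<ge> 1 \<and> real k \<le> a}) \<le> C * a"
    and a: "a \<ge> 1" and N: "N \<ge> 1"
  obtains x where "N \<le> x" "x < 2 * N" "survival (2 * N) * ln a \<le> C * a / real N * ln a + mean_log x"
proof -
  define p where "p = (\<lambda>n. measure_pmf.prob (crossings n) {k. k \<ge> 1 \<and> real k \<le> a})"
  have "\<exists>x\<in>{N..<2*N}. p x \<le> C * a / real N"
  proof (rule ccontr)
    assume "\<not> ?thesis"
    then have "(\<Sum>x\<in>{N..<2*N}. C * a / real N) < (\<Sum>x\<in>{N..<2*N}. p x)"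
      using N by (intro sum_strict_mono) (auto simp: not_le)
    also have "\<dots> \<le> (\<Sum>x<2*N. p x)" by (intro sum_mono2) (auto simp: p_def)
    also have "\<dots> \<le> C * a" unfolding p_def by (rule C[OF a])
    finally show False using N by simp
  qed
  then obtain x where x: "x \<in> {N..<2*N}" "p x \<le> C * a / real N" by blast
  note ls = log_scale_nonneg[of 1, OF order_refl] log_scale_linear[of 1, OF order_refl]
  define q where "q = measure_pmf.prob (crossings x) {k. k \<ge> 1 \<and> real k > a}"
  have "survival x = p x + q"
    unfolding survival_def p_def q_def
    by (subst measure_pmf.finite_measure_Union[symmetric]) (auto intro!: arg_cong[where f = "measure _"])
  moreover have "survival (2 * N) \<le> survival x" using x by (intro survival_decreasing) auto
  moreover have la: "ln a \<ge> 0" using a by simp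
  ultimately have "survival (2 * N) * ln a \<le> (p x + q) * ln a" by (intro mult_right_mono) auto
  also have "\<dots> = p x * ln a + q * ln a" by (simp add: ring_distribs)
  also have "p x * ln a \<le> C * a / real N * ln a" using x la by (intro mult_right_mono) auto
  also have "q * ln a \<le> mean_log x"
  proof -
    have "q * ln a = mean (crossings x) (\<lambda>k. ln a * indicator {k. k \<ge> 1 \<and> real k > a} k)"
      by (simp add: q_def mult.commute)
    also have "\<dots> \<le> mean_log x" unfolding mean_log_def
    proof (intro integral_mono integrable_crossings[OF ls] integrable_mult_right integrable_bounded[where c = 1])
      fix k :: nat
      have "ln a \<le> ln (1 + real k)" if "real k > a" using that a by (subst ln_le_cancel_iff) auto
      then show "ln a * indicator {k. k \<ge> 1 \<and> real k > a} k \<le> log_scale 1 k"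
        using ls(1)[of k] by (auto simp: indicator_def log_scale_def)
    qed (auto simp: indicator_def)
    finally show ?thesis .
  qed
  finally show ?thesis using that x by auto
qed

lemma mean_log_tendsto: "mean_log \<longlonglongrightarrow> lim mean_log"
  using mean_log_convergent by (simp add: convergent_LIMSEQ_iff)

text \<open>
The lower bound takes \<open>b = n powr (1 + e)\<close> in \<open>mean_log_le_survival\<close>, the upper bound \<open>a = N powr (1 - e)\<close> in
\<open>survival_small_level\<close> with \<open>N = n div 2\<close>.
\<close>

theorem survival_asymptotics: "(\<lambda>n. ln (real n) * survival n) \<longlonglongrightarrow> lim mean_log"
proof (rule tendsto_sandwich_family)
  define L where "L = lim mean_log"
  obtain C where C: "C \<ge> 0" "\<And>a N. a \<ge> 1 \<Longrightarrow> (\<Sum>n<N. measure_pmf.prob (crossings n) {k. k \<ge> 1 \<and> real k \<le> a}) \<le> C * a"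
    using occupation_bound by blast
  fix e :: real assume e: "0 < e" "e < 1"
  define l where "l = (\<lambda>n. (mean_log n - (2 + real M * real n) / (real n powr (1 + e))) / (1 + e))"
  define u where "u = (\<lambda>n. C * (ln (real n) * (real n / 3) powr (- e)) + ((L + e) / (1 - e)) * (ln (real n) / ln (real n / 3)))"
  have "l \<longlonglongrightarrow> (L - 0) / (1 + e)"
  proof -
    have "(\<lambda>n. 2 * (1 / real n powr (1 + e)) + real M * (real n / real n powr (1 + e))) \<longlonglongrightarrow> 2 * 0 + real M * 0"
      using e by (intro tendsto_intros; real_asymp)
    then have "(\<lambda>n. (2 + real M * real n) / (real n powr (1 + e))) \<longlonglongrightarrow> 0"
      by (simp add: add_divide_distrib)
    then show ?thesis unfolding l_def L_def using e by (intro tendsto_intros mean_log_tendsto) auto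
  qed
  moreover have "u \<longlonglongrightarrow> C * 0 + ((L + e) / (1 - e)) * 1"
    unfolding u_def using e by (intro tendsto_intros; real_asymp)
  moreover have "\<forall>\<^sub>F n in sequentially. l n \<le> ln (real n) * survival n"
    using eventually_ge_at_top[of 1]
  proof eventually_elim
    case (elim n)
    have "real n powr (1 + e) \<ge> 1" using elim e by (intro ge_one_powr_ge_zero) auto
    from mean_log_le_survival[OF this, of n]
    have "mean_log n - (2 + real M * real n) / (real n powr (1 + e)) \<le> (1 + e) * (ln (real n) * survival n)"
      using elim by (simp add: ln_powr algebra_simps)
    then show ?case using e by (simp add: l_def divide_le_eq mult.commute)
  qed
  moreover have "\<forall>\<^sub>F n in sequentially. ln (real n) * survival n \<le> u n"
  proof -
    have "\<forall>\<^sub>F n in sequentially. mean_log n < L + e"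
      using mean_log_tendsto e by (intro order_tendstoD) (auto simp: L_def)
    then obtain n0 where n0: "\<And>n. n \<ge> n0 \<Longrightarrow> mean_log n < L + e" by (auto simp: eventually_sequentially)
    show ?thesis using eventually_ge_at_top[of "2 * n0 + 6"]
    proof eventually_elim
      case (elim n)
      define N where "N = n div 2"
      have N: "N \<ge> n0" "N \<ge> 3" "real N \<ge> real n / 3" "2 * N \<le> n" using elim by (auto simp: N_def)
      define a where "a = real N powr (1 - e)"
      have a: "a \<ge> 1" unfolding a_def using N e by (intro ge_one_powr_ge_zero) auto
      have la: "ln a = (1 - e) * ln (real N)" using N by (simp add: a_def ln_powr)
      have lN: "ln (real N) > 0" using N by simp
      have aN: "a / real N = real N powr (- e)" 
      proof -
        have "real N powr (1 - e) / real N powr 1 = real N powr (1 - e - 1)" by (rule powr_diff[symmetric])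
        then show ?thesis using N by (simp add: a_def)
      qed
      obtain x where x: "N \<le> x" "survival (2 * N) * ln a \<le> C * a / real N * ln a + mean_log x"
      proof (rule survival_small_level[OF C(2) a])
        show "1 \<le> N" using N by simp
      qed blast+
      have "survival n * ln a \<le> survival (2 * N) * ln a"
        using N a by (intro mult_right_mono survival_decreasing) auto
      also note x(2)
      also have "mean_log x \<le> L + e" using n0[of x] x N by simp
      also have "C * a / real N * ln a = C * real N powr (- e) * ln a" using aN by (simp flip: aN)
      finally have "survival n * ln a \<le> C * real N powr (- e) * ln a + (L + e)" by simp
      then have "survival n * ln a / ln a \<le> (C * real N powr (- e) * ln a + (L + e)) / ln a"
        using la lN e by (intro divide_right_mono) auto
      then have "survival n \<le> C * real N powr (- e) + (L + e) / ((1 - e) * ln (real N))"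
        using lN e unfolding la by (simp add: add_divide_distrib)
      also have "\<dots> \<le> C * (real n / 3) powr (- e) + (L + e) / ((1 - e) * ln (real n / 3))"
      proof (intro add_mono mult_left_mono divide_left_mono)
        show "real N powr - e \<le> (real n / 3) powr - e" using N e elim by (intro powr_mono2') auto
        show "ln (real n / 3) \<le> ln (real N)" using N elim by (intro ln_mono) auto
        show "0 \<le> L + e" using mean_log_limit_positive e by (simp add: L_def)
        show "0 < (1 - e) * ln (real N) * ((1 - e) * ln (real n / 3))" using e lN elim by (intro mult_pos_pos) auto
      qed (use C e in auto)
      finally have "ln (real n) * survival n \<le> ln (real n) * (C * (real n / 3) powr (- e) + (L + e) / ((1 - e) * ln (real n / 3)))"
        using elim by (intro mult_left_mono) auto
      also have "\<dots> = u n" using e by (simp add: u_def field_simps)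
      finally show ?case .
    qed
  qed
  ultimately show "\<exists>l u. (\<forall>\<^sub>F n in sequentially. l n \<le> ln (real n) * survival n \<and> ln (real n) * survival n \<le> u n) \<and>
      l \<longlonglongrightarrow> lim mean_log / (1 + e) \<and> u \<longlonglongrightarrow> (lim mean_log + e) / (1 - e)"
    by (intro exI[of _ l] exI[of _ u]) (auto simp: L_def eventually_conj_iff)
next
  show "((\<lambda>e. lim mean_log / (1 + e)) \<longlongrightarrow> lim mean_log) (at_right 0)"
    by (rule tendsto_eq_intros refl | simp)+
  show "((\<lambda>e. (lim mean_log + e) / (1 - e)) \<longlongrightarrow> lim mean_log) (at_right 0)"
    by (rule tendsto_eq_intros refl | simp)+
qed

text \<open>
The two assumptions are the crude comparisons between duration and height: a long excursion is high or has many crossings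
below \<open>N\<close>; a high excursion is long unless the chain is small during half of the time in \<open>{N..<2 N}\<close>. Heights
\<open>n powr ((1 - e) / 2)\<close> and \<open>n powr ((1 + e) / 2)\<close> make the correction terms negligible, and \<open>ln n\<close> exceeds the logarithm of these
heights by a factor close to \<open>2\<close>.
\<close>

theorem lifetime_asymptotics:
  fixes \<tau> :: "nat \<Rightarrow> real"
  assumes upper: "\<And>n N. n \<ge> 1 \<Longrightarrow> \<tau> n \<le> survival N + (1 + 2 * real N * (1 + real M * real N)) / real n"
    and lower: "\<And>n N a. N \<ge> 1 \<Longrightarrow> real n \<le> real N * a / 2 \<Longrightarrow>
      survival (2 * N) - (2 / real N) * (\<Sum>x<2*N. measure_pmf.prob (crossings x) {k. k \<ge> 1 \<and> real k \<le> a}) \<le> \<tau> n"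
  shows "(\<lambda>n. ln (real n) * \<tau> n) \<longlonglongrightarrow> 2 * lim mean_log"
proof (rule tendsto_sandwich_family)
  define L where "L = lim mean_log"
  obtain C where C: "C \<ge> 0" "\<And>a N. a \<ge> 1 \<Longrightarrow> (\<Sum>n<N. measure_pmf.prob (crossings n) {k. k \<ge> 1 \<and> real k \<le> a}) \<le> C * a"
    using occupation_bound by blast
  fix e :: real assume e: "0 < e" "e < 1"
  have S: "(\<lambda>n. ln (real (N n)) * survival (N n)) \<longlonglongrightarrow> L" if "filterlim N at_top sequentially" for N :: "nat \<Rightarrow> nat"
    unfolding L_def using filterlim_compose[OF survival_asymptotics that] .
  define N1 where "N1 = (\<lambda>n::nat. nat \<lfloor>real n powr ((1 - e) / 2)\<rfloor>)"
  define N2 where "N2 = (\<lambda>n::nat. nat \<lceil>real n powr ((1 + e) / 2)\<rceil>)"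
  have N1r: "real (N1 n) = real_of_int \<lfloor>real n powr ((1 - e) / 2)\<rfloor>" for n by (simp add: N1_def)
  have N2r: "real (N2 n) = real_of_int \<lceil>real n powr ((1 + e) / 2)\<rceil>" for n by (simp add: N2_def)
  have N1t: "filterlim N1 at_top sequentially"
  proof -
    have "filterlim (\<lambda>n. real (N1 n)) at_top sequentially" unfolding N1r using e by real_asymp
    then show ?thesis by (simp add: filterlim_sequentially_iff_filterlim_real)
  qed
  have N2t: "filterlim (\<lambda>n. 2 * N2 n) at_top sequentially"
  proof -
    have "filterlim (\<lambda>n. real (2 * N2 n)) at_top sequentially" unfolding of_nat_mult N2r using e by real_asymp
    then show ?thesis by (simp only: filterlim_sequentially_iff_filterlim_real)
  qed
  define u where "u = (\<lambda>n. (ln (real n) / ln (real (N1 n))) * (ln (real (N1 n)) * survival (N1 n))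
      + (3 + 2 * real M) * (ln (real n) * (real n powr ((1 - e) / 2)) ^ 2 / real n))"
  define l where "l = (\<lambda>n. (ln (real n) / ln (real (2 * N2 n))) * (ln (real (2 * N2 n)) * survival (2 * N2 n))
      - (4 * C) * (ln (real n) * real n / (real n powr ((1 + e) / 2)) ^ 2))"
  have "u \<longlonglongrightarrow> (2 / (1 - e)) * L + (3 + 2 * real M) * 0"
  proof -
    have 1: "(\<lambda>n. ln (real n) / ln (real (N1 n))) \<longlonglongrightarrow> 2 / (1 - e)"
      unfolding N1r using e by real_asymp
    have 2: "(\<lambda>n. ln (real n) * (real n powr ((1 - e) / 2)) ^ 2 / real n) \<longlonglongrightarrow> 0"
      using e by real_asymp
    show ?thesis unfolding u_def
      by (rule tendsto_add[OF tendsto_mult[OF 1 S[OF N1t]] tendsto_mult[OF tendsto_const 2]])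
  qed
  moreover have "l \<longlonglongrightarrow> (2 / (1 + e)) * L - (4 * C) * 0"
  proof -
    have 1: "(\<lambda>n. ln (real n) / ln (real (2 * N2 n))) \<longlonglongrightarrow> 2 / (1 + e)"
      unfolding of_nat_mult N2r using e by real_asymp
    have 2: "(\<lambda>n. ln (real n) * real n / (real n powr ((1 + e) / 2)) ^ 2) \<longlonglongrightarrow> 0"
      using e by real_asymp
    show ?thesis unfolding l_def
      by (rule tendsto_diff[OF tendsto_mult[OF 1 S[OF N2t]] tendsto_mult[OF tendsto_const 2]])
  qed
  moreover have "\<forall>\<^sub>F n in sequentially. ln (real n) * \<tau> n \<le> u n"
  proof -
    have "\<forall>\<^sub>F n in sequentially. real (N1 n) \<ge> 2" unfolding N1r using e by real_asymp
    then show ?thesis using eventually_ge_at_top[of 2]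
    proof eventually_elim
      case (elim n)
      define y where "y = real n powr ((1 - e) / 2)"
      have y: "real (N1 n) \<le> y" "y \<ge> 1" "y \<ge> 0" using elim unfolding N1r y_def by (linarith, linarith, simp)
      have lN: "ln (real (N1 n)) > 0" using elim by simp
      have y2: "y \<le> y ^ 2" "1 \<le> y ^ 2" using y by (auto simp: power2_eq_square intro: order_trans[OF y(2)])
      have "1 + 2 * real (N1 n) * (1 + real M * real (N1 n)) \<le> 1 + 2 * y * (1 + real M * y)"
        using y by (intro add_left_mono mult_mono add_mono) auto
      also have "\<dots> = 1 + 2 * y + 2 * real M * y ^ 2" by (simp add: algebra_simps power2_eq_square)
      also have "\<dots> \<le> (3 + 2 * real M) * y ^ 2" using y2 by (simp add: algebra_simps)
      finally have "(1 + 2 * real (N1 n) * (1 + real M * real (N1 n))) / real n \<le> (3 + 2 * real M) * y ^ 2 / real n"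
        by (intro divide_right_mono) auto
      with upper[of n "N1 n"] elim have "\<tau> n \<le> survival (N1 n) + (3 + 2 * real M) * y ^ 2 / real n" by simp
      then have "ln (real n) * \<tau> n \<le> ln (real n) * (survival (N1 n) + (3 + 2 * real M) * y ^ 2 / real n)"
        using elim by (intro mult_left_mono) auto
      also have "\<dots> = u n" unfolding u_def y_def[symmetric] using lN by (simp add: field_simps)
      finally show ?case .
    qed
  qed
  moreover have "\<forall>\<^sub>F n in sequentially. l n \<le> ln (real n) * \<tau> n"
  proof -
    have "\<forall>\<^sub>F n in sequentially. real (N2 n) \<le> 2 * real n" unfolding N2r using e by real_asymp
    then show ?thesis using eventually_ge_at_top[of 2]
    proof eventually_elim
      case (elim n)
      define y where "y = real n powr ((1 + e) / 2)"
      have y: "real (N2 n) \<ge> y" "y \<ge> 1"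
      proof -
        show "real (N2 n) \<ge> y" unfolding N2r y_def by linarith
        show "y \<ge> 1" unfolding y_def using elim e by (intro ge_one_powr_ge_zero) auto
      qed
      have N: "N2 n \<ge> 1" using y by (auto simp: Suc_le_eq intro!: gr0I)
      have lN: "ln (real (2 * N2 n)) > 0" using N by simp
      \<comment> \<open>the smallest level allowed by the assumption \<open>lower\<close>\<close>
      define a where "a = 2 * real n / real (N2 n)"
      have a: "a \<ge> 1" "real n \<le> real (N2 n) * a / 2" using N elim by (auto simp: a_def)
      have "(2 / real (N2 n)) * (\<Sum>x<2*N2 n. measure_pmf.prob (crossings x) {k. k \<ge> 1 \<and> real k \<le> a}) \<le> (2 / real (N2 n)) * (C * a)"
        by (intro mult_left_mono C(2) a) auto
      also have "\<dots> = 4 * C * real n / real (N2 n) ^ 2" by (simp add: a_def power2_eq_square)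
      also have "\<dots> \<le> 4 * C * real n / y ^ 2"
        using y C N by (intro divide_left_mono power_mono mult_pos_pos) auto
      finally have "survival (2 * N2 n) - 4 * C * real n / y ^ 2 \<le> \<tau> n" using lower[OF N a(2)] by simp
      then have "ln (real n) * (survival (2 * N2 n) - 4 * C * real n / y ^ 2) \<le> ln (real n) * \<tau> n"
        using elim by (intro mult_left_mono) auto
      moreover have "ln (real n) * (survival (2 * N2 n) - 4 * C * real n / y ^ 2) = l n"
        unfolding l_def y_def[symmetric] using lN by (simp add: algebra_simps)
      ultimately show ?case by simp
    qed
  qed
  ultimately show "\<exists>l u. (\<forall>\<^sub>F n in sequentially. l n \<le> ln (real n) * \<tau> n \<and> ln (real n) * \<tau> n \<le> u n) \<and>
      l \<longlonglongrightarrow> 2 / (1 + e) * lim mean_log \<and> u \<longlonglongrightarrow> 2 / (1 - e) * lim mean_log"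
    by (intro exI[of _ l] exI[of _ u]) (auto simp: L_def eventually_conj_iff)
next
  show "((\<lambda>e. 2 / (1 + e) * lim mean_log) \<longlongrightarrow> 2 * lim mean_log) (at_right 0)"
    by (rule tendsto_eq_intros refl | simp)+
  show "((\<lambda>e. 2 / (1 - e) * lim mean_log) \<longlongrightarrow> 2 * lim mean_log) (at_right 0)"
    by (rule tendsto_eq_intros refl | simp)+
qed

end

context cookie_chain
begin

text \<open>
From \<open>M\<close> or more crossings the mean decreases by one in each step, so the expected time spent alive is bounded by the initial
state and the bounded time among small states; as survival decreases, \<open>n\<close> times it is at most this expected time.
\<close>

lemma survival_subcritical:
  assumes "mean_drift = - 1"
  obtains C where "\<And>n. n \<ge> 1 \<Longrightarrow> survival n \<le> C / real n"
proof -
  obtain V where V: "V \<ge> 0" "\<And>N. (\<Sum>n<N. measure_pmf.prob (crossings n) {1..<M}) \<le> V"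
    using visits_bounded by blast
  obtain C :: real where mean: "\<And>k. k \<ge> M \<Longrightarrow> mean (kernel k) (\<lambda>x. real x - real k) = mean_drift"
    using kernel_moments by blast
  have drift: "mean (kernel k) real \<le> real k - indicator {1..} k + (real M + 1) * indicator {1..<M} k" for k
  proof (cases "k \<ge> M")
    case True
    then have "mean (kernel k) real = real k - 1"
      using mean[of k] assms integrable_kernel_real[of k] by (simp add: Bochner_Integration.integral_diff)
    then show ?thesis using True by (simp add: indicator_def)
  next
    case False
    then show ?thesis using kernel_mean_le[of k] by (cases "k = 0") (auto simp: indicator_def)
  qed
  have r: "0 \<le> real k" "real k \<le> 1 * (real k + 1)" for k by auto
  define e where "e = (\<lambda>n. mean (crossings n) real)"
  have ind: "integrable (measure_pmf p) (indicator A :: nat \<Rightarrow> real)" for p A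
    by (intro integrable_bounded[where c = 1]) (simp add: indicator_def)
  have step: "survival n \<le> e n - e (Suc n) + (real M + 1) * measure_pmf.prob (crossings n) {1..<M}" for n
  proof -
    have "e (Suc n) = mean (crossings n) (\<lambda>k. mean (kernel k) real)"
      unfolding e_def by (rule expectation_crossings_Suc[OF r])
    also have "\<dots> \<le> mean (crossings n) (\<lambda>k. real k - indicator {1..} k + (real M + 1) * indicator {1..<M} k)"
      by (intro integral_mono drift integrable_crossings_kernel[OF r] Bochner_Integration.integrable_add
          Bochner_Integration.integrable_diff integrable_mult_right ind crossings_mean)
    also have "\<dots> = e n - survival n + (real M + 1) * measure_pmf.prob (crossings n) {1..<M}"
      unfolding e_def survival_def using ind crossings_mean(1)[of n]
      by (simp add: Bochner_Integration.integral_diff Bochner_Integration.integral_add del: One_nat_def)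
    finally show ?thesis by simp
  qed
  define D where "D = 1 + (real M + 1) * V"
  have "survival n \<le> D / real n" if "n \<ge> 1" for n
  proof -
    have "real n * survival n = (\<Sum>i<n. survival n)" by simp
    also have "\<dots> \<le> (\<Sum>i<n. survival i)" by (intro sum_mono survival_decreasing) auto
    also have "\<dots> \<le> (\<Sum>i<n. e i - e (Suc i) + (real M + 1) * measure_pmf.prob (crossings i) {1..<M})"
      by (intro sum_mono step)
    also have "\<dots> = (e 0 - e n) + (real M + 1) * (\<Sum>i<n. measure_pmf.prob (crossings i) {1..<M})"
      unfolding sum.distrib sum_distrib_left sum_lessThan_telescope' ..
    also have "\<dots> \<le> 1 + (real M + 1) * V"
    proof (intro add_mono mult_left_mono V)
      have "e n \<ge> 0" unfolding e_def by (intro Bochner_Integration.integral_nonneg) auto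
      then show "e 0 - e n \<le> 1" by (simp add: e_def)
    qed auto
    finally show ?thesis using that by (simp add: D_def field_simps)
  qed
  then show ?thesis by (rule that)
qed

end

section \<open>Crossings during a right excursion\<close>

text \<open>
The number of heads before the \<open>k\<close>-th tail, counting from position \<open>i\<close>. The starting position allows one to remove known tosses
one by one; the value is meaningful if there are at least \<open>k\<close> tails, and the cardinality of an infinite set is \<open>0\<close>.
\<close>

definition heads_before :: "nat \<Rightarrow> (nat \<Rightarrow> bool) \<Rightarrow> nat \<Rightarrow> nat" where
  "heads_before i c k = card {n. i \<le> n \<and> c n \<and> card {m. i \<le> m \<and> m < n \<and> \<not> c m} < k}"

lemma finite_heads_before:
  fixes c :: "nat \<Rightarrow> bool"
  assumes "infinite {m. \<not> c m}"
  shows "finite {n. i \<le> n \<and> c n \<and> card {m. i \<le> m \<and> m < n \<and> \<not> c m} < k}"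
proof -
  have "infinite ({m. \<not> c m} - {..<i})" by (rule Diff_infinite_finite[OF finite_lessThan assms])
  moreover have "{m. \<not> c m} - {..<i} = {m. i \<le> m \<and> \<not> c m}" by auto
  ultimately obtain T where T: "finite T" "card T = k" "T \<subseteq> {m. i \<le> m \<and> \<not> c m}"
    using infinite_arbitrarily_large by metis
  obtain b where b: "\<And>m. m \<in> T \<Longrightarrow> m < b" using finite_nat_set_iff_bounded[of T] T(1) by blast
  have "{n. i \<le> n \<and> c n \<and> card {m. i \<le> m \<and> m < n \<and> \<not> c m} < k} \<subseteq> {..<b}"
  proof safe
    fix n assume n: "card {m. i \<le> m \<and> m < n \<and> \<not> c m} < k"
    show "n < b"
    proof (rule ccontr)
      assume "\<not> n < b"
      then have "T \<subseteq> {m. i \<le> m \<and> m < n \<and> \<not> c m}" using T(3) b by fastforce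
      then have "card T \<le> card {m. i \<le> m \<and> m < n \<and> \<not> c m}" by (intro card_mono) auto
      with n T(2) show False by simp
    qed
  qed
  then show ?thesis by (rule finite_subset) simp
qed

primrec branching :: "(int \<times> nat \<Rightarrow> bool) \<Rightarrow> nat \<Rightarrow> nat" where
  "branching \<eta> 0 = 1"
| "branching \<eta> (Suc x) = heads_before 1 (\<lambda>m. \<eta> (int (Suc x), m)) (branching \<eta> x)"

lemma erw_positive:
  assumes "\<And>k. k \<le> n \<Longrightarrow> erw 1 \<eta> k \<noteq> 0"
  shows "erw 1 \<eta> n > 0"
  using assms
proof (induction n)
  case (Suc n)
  then have "erw 1 \<eta> n > 0" by simp
  moreover have "erw 1 \<eta> (Suc n) = erw 1 \<eta> n + 1 \<or> erw 1 \<eta> (Suc n) = erw 1 \<eta> n - 1"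
    by (auto simp: of_bool_def)
  ultimately show ?case using Suc.prems[of "Suc n"] by linarith
qed simp

text \<open>
Without enough tails at a site the walk might step to the right from it forever.
\<close>

locale excursion =
  fixes \<eta> :: "int \<times> nat \<Rightarrow> bool"
  assumes infinite_tails: "x \<ge> 1 \<Longrightarrow> infinite {m. \<not> \<eta> (int x, m)}"
begin

abbreviation X :: "nat \<Rightarrow> int" where "X \<equiv> erw 1 \<eta>"

abbreviation Z :: "nat \<Rightarrow> nat" where "Z \<equiv> branching \<eta>"

definition local_time :: "int \<Rightarrow> nat \<Rightarrow> nat" where
  "local_time x n = card {k. k < n \<and> X k = x}"

definition ups :: "int \<Rightarrow> nat \<Rightarrow> nat" where
  "ups x n = card {m. 1 \<le> m \<and> m \<le> local_time x n \<and> \<eta> (x, m)}"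

definition downs :: "int \<Rightarrow> nat \<Rightarrow> nat" where
  "downs x n = card {m. 1 \<le> m \<and> m \<le> local_time x n \<and> \<not> \<eta> (x, m)}"

lemma local_time_0 [simp]: "local_time x 0 = 0"
  by (simp add: local_time_def)

lemma local_time_Suc: "local_time x (Suc n) = local_time x n + of_bool (X n = x)"
proof -
  have "{k. k < Suc n \<and> X k = x} = {k. k < n \<and> X k = x} \<union> (if X n = x then {n} else {})"
    by (auto simp: less_Suc_eq)
  then show ?thesis unfolding local_time_def by (subst card_Un_disjoint[symmetric] | simp)+
qed

lemma walk_Suc: "X (Suc n) = X n + 2 * of_bool (\<eta> (X n, Suc (local_time (X n) n))) - 1"
proof -
  have "{k. k \<le> n \<and> X k = X n} = insert n {k. k < n \<and> X k = X n}" by auto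
  then have "card {k. k \<le> n \<and> X k = X n} = Suc (local_time (X n) n)"
    unfolding local_time_def by simp
  then show ?thesis by simp
qed

lemma ups_0 [simp]: "ups x 0 = 0" and downs_0 [simp]: "downs x 0 = 0"
  by (simp_all add: ups_def downs_def)

lemma ups_Suc: "ups x (Suc n) = ups x n + of_bool (X n = x \<and> X (Suc n) = x + 1)"
proof (cases "X n = x")
  case True
  have "{m. 1 \<le> m \<and> m \<le> Suc (local_time x n) \<and> \<eta> (x, m)} =
    {m. 1 \<le> m \<and> m \<le> local_time x n \<and> \<eta> (x, m)} \<union> (if \<eta> (x, Suc (local_time x n)) then {Suc (local_time x n)} else {})"
    by (auto simp: le_Suc_eq)
  moreover have "X (Suc n) = x + 1 \<longleftrightarrow> \<eta> (x, Suc (local_time x n))"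
    using True walk_Suc[of n] by (auto simp: of_bool_def simp del: erw.simps)
  ultimately show ?thesis using True unfolding ups_def local_time_Suc
    by (simp add: card_Un_disjoint del: erw.simps)
qed (simp add: ups_def local_time_Suc del: erw.simps)

lemma downs_Suc: "downs x (Suc n) = downs x n + of_bool (X n = x \<and> X (Suc n) = x - 1)"
proof (cases "X n = x")
  case True
  have "{m. 1 \<le> m \<and> m \<le> Suc (local_time x n) \<and> \<not> \<eta> (x, m)} =
    {m. 1 \<le> m \<and> m \<le> local_time x n \<and> \<not> \<eta> (x, m)} \<union> (if \<not> \<eta> (x, Suc (local_time x n)) then {Suc (local_time x n)} else {})"
    by (auto simp: le_Suc_eq)
  moreover have "X (Suc n) = x - 1 \<longleftrightarrow> \<not> \<eta> (x, Suc (local_time x n))"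
    using True walk_Suc[of n] by (auto simp: of_bool_def simp del: erw.simps)
  ultimately show ?thesis using True unfolding downs_def local_time_Suc
    by (simp add: card_Un_disjoint del: erw.simps)
qed (simp add: downs_def local_time_Suc del: erw.simps)

lemma local_time_eq: "local_time x n = ups x n + downs x n"
proof -
  have "{1..local_time x n} = {m. 1 \<le> m \<and> m \<le> local_time x n \<and> \<eta> (x, m)} \<union> {m. 1 \<le> m \<and> m \<le> local_time x n \<and> \<not> \<eta> (x, m)}"
    by auto
  then have "card {1..local_time x n} = ups x n + downs x n"
    unfolding ups_def downs_def by (simp only:, subst card_Un_disjoint) auto
  then show ?thesis by simp
qed

lemma walk_step: "X (Suc n) = X n + 1 \<or> X (Suc n) = X n - 1"
  using walk_Suc[of n] by (auto simp: of_bool_def simp del: erw.simps)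

lemma walk_positive: "(\<And>k. k < n \<Longrightarrow> X k \<noteq> 0) \<Longrightarrow> k < n \<Longrightarrow> X k > 0"
  by (rule erw_positive) simp

text \<open>
The arrivals at \<open>x + 1\<close> from the left; the convention at \<open>0\<close> counts the start at \<open>1\<close> as an arrival from \<open>0\<close>.
\<close>

definition inflow :: "nat \<Rightarrow> nat \<Rightarrow> nat" where
  "inflow x n = (if x = 0 then 1 else ups (int x) n)"

text \<open>
Steps across the edge between \<open>x\<close> and \<open>x + 1\<close> alternate, starting with a step to the right, so the two counts differ by one
exactly while the walk is to the right of \<open>x\<close>.
\<close>

lemma flow:
  assumes "\<And>k. k < n \<Longrightarrow> X k \<noteq> 0"
  shows "inflow x n = downs (int (Suc x)) n + of_bool (X n > int x)"
  using assms
proof (induction n)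
  case 0
  show ?case by (auto simp: inflow_def)
next
  case (Suc n)
  have pos: "X n > 0" using walk_positive[of "Suc n" n] Suc.prems by simp
  have IH: "inflow x n = downs (int (Suc x)) n + of_bool (X n > int x)" using Suc by simp
  have infl: "inflow x (Suc n) = inflow x n + of_bool (X n = int x \<and> X (Suc n) = int x + 1)"
    using pos unfolding inflow_def ups_Suc by (auto simp del: erw.simps)
  from walk_step[of n] show ?case
  proof
    assume up: "X (Suc n) = X n + 1"
    then show ?case unfolding infl downs_Suc IH by (auto simp: of_bool_def simp del: erw.simps)
  next
    assume down: "X (Suc n) = X n - 1"
    then show ?case unfolding infl downs_Suc IH by (auto simp: of_bool_def simp del: erw.simps)
  qed
qed

text \<open>
When the walk is at \<open>x + 1\<close> it has left that site to the left fewer than \<open>inflow x\<close> times; so each head used there so far precedes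
the \<open>Z x\<close>-th tail.
\<close>

lemma inflow_le:
  assumes "\<And>k. k < n \<Longrightarrow> X k \<noteq> 0"
  shows "inflow x n \<le> Z x"
  using assms
proof (induction x arbitrary: n)
  case 0
  show ?case by (simp add: inflow_def)
next
  case (Suc x)
  note IHx = Suc.IH
  let ?c = "\<lambda>m. \<eta> (int (Suc x), m)"
  let ?S = "{m. 1 \<le> m \<and> ?c m \<and> card {m'. 1 \<le> m' \<and> m' < m \<and> \<not> ?c m'} < Z x}"
  have "{m. 1 \<le> m \<and> m \<le> local_time (int (Suc x)) n \<and> ?c m} \<subseteq> ?S"
    using Suc.prems
  proof (induction n)
    case 0
    show ?case by auto
  next
    case (Suc n)
    show ?case
    proof (cases "X n = int (Suc x)")
      case True
      have "card {m'. 1 \<le> m' \<and> m' < Suc (local_time (int (Suc x)) n) \<and> \<not> ?c m'} = downs (int (Suc x)) n"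
        unfolding downs_def by (simp add: less_Suc_eq_le)
      also have "\<dots> < inflow x n" using flow[of n x] Suc.prems True by (simp del: erw.simps)
      also have "inflow x n \<le> Z x" using IHx[of n] Suc.prems by simp
      finally have "card {m'. 1 \<le> m' \<and> m' < Suc (local_time (int (Suc x)) n) \<and> \<not> ?c m'} < Z x" .
      moreover have "{m. 1 \<le> m \<and> m \<le> local_time (int (Suc x)) n \<and> ?c m} \<subseteq> ?S" using Suc by simp
      ultimately show ?thesis using True by (auto simp: local_time_Suc le_Suc_eq simp del: erw.simps)
    next
      case False
      then show ?thesis using Suc by (simp add: local_time_Suc del: erw.simps)
    qed
  qed
  moreover have "finite ?S" by (intro finite_heads_before infinite_tails) simp
  ultimately have "card {m. 1 \<le> m \<and> m \<le> local_time (int (Suc x)) n \<and> ?c m} \<le> card ?S"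
    by (rule card_mono[rotated])
  then show ?case by (simp add: inflow_def ups_def heads_before_def)
qed

text \<open>
When the walk has died, all arrivals at \<open>x + 1\<close> from the left have been undone. So at least \<open>Z x\<close> tails have been used there, and every
head that precedes them has been used as well.
\<close>

lemma inflow_ge:
  assumes "\<And>k. k < n \<Longrightarrow> X k \<noteq> 0" and "X n = 0"
  shows "Z x \<le> inflow x n"
proof (induction x)
  case 0
  show ?case by (simp add: inflow_def)
next
  case (Suc x)
  let ?c = "\<lambda>m. \<eta> (int (Suc x), m)"
  let ?S = "{m. 1 \<le> m \<and> ?c m \<and> card {m'. 1 \<le> m' \<and> m' < m \<and> \<not> ?c m'} < Z x}"
  have "?S \<subseteq> {m. 1 \<le> m \<and> m \<le> local_time (int (Suc x)) n \<and> ?c m}"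
  proof safe
    fix m assume m: "card {m'. 1 \<le> m' \<and> m' < m \<and> \<not> ?c m'} < Z x"
    show "m \<le> local_time (int (Suc x)) n"
    proof (rule ccontr)
      assume "\<not> m \<le> local_time (int (Suc x)) n"
      then have "downs (int (Suc x)) n \<le> card {m'. 1 \<le> m' \<and> m' < m \<and> \<not> ?c m'}"
        unfolding downs_def by (intro card_mono) auto
      moreover have "inflow x n = downs (int (Suc x)) n" using flow[of n x, OF assms(1)] assms(2) by simp
      ultimately show False using m Suc by simp
    qed
  qed
  then have "card ?S \<le> card {m. 1 \<le> m \<and> m \<le> local_time (int (Suc x)) n \<and> ?c m}"
    by (intro card_mono) auto
  then show ?case by (simp add: inflow_def ups_def heads_before_def)
qed

lemma sum_local_time:
  "(\<Sum>x=1..N. local_time (int x) n) = card {k. k < n \<and> X k \<in> {1..int N}}"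
proof -
  have eq: "{k. k < n \<and> X k \<in> {1..int N}} = (\<Union>x\<in>{1..N}. {k. k < n \<and> X k = int x})"
  proof safe
    fix k assume k: "k < n" "X k \<in> {1..int N}"
    then show "k \<in> (\<Union>x\<in>{1..N}. {k. k < n \<and> X k = int x})"
      by (intro UN_I[of "nat (X k)"]) auto
  qed auto
  have "card {k. k < n \<and> X k \<in> {1..int N}} = (\<Sum>x=1..N. card {k. k < n \<and> X k = int x})"
    unfolding eq by (rule card_UN_disjoint) auto
  then show ?thesis by (simp add: local_time_def)
qed

text \<open>
Every step is counted as an up or a down step from its site, and the down steps from \<open>x\<close> are bounded by the up steps from
\<open>x - 1\<close>.
\<close>

lemma time_le_of_confined:
  assumes "\<And>k. k < n \<Longrightarrow> 0 < X k \<and> X k \<le> int N"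
  shows "n \<le> 1 + 2 * (\<Sum>x=1..N. Z x)"
proof -
  have nz: "X k \<noteq> 0" if "k < n" for k using assms[OF that] by simp
  have "{k. k < n \<and> X k \<in> {1..int N}} = {..<n}" using assms by force
  then have "(\<Sum>x=1..N. local_time (int x) n) = card {..<n}" unfolding sum_local_time by (rule arg_cong)
  then have "n = (\<Sum>x=1..N. local_time (int x) n)" by simp
  also have "\<dots> \<le> (\<Sum>x=1..N. Z x + Z (x - 1))"
  proof (rule sum_mono)
    fix x assume x: "x \<in> {1..N}"
    have "ups (int x) n \<le> Z x" using inflow_le[of n x, OF nz] x by (simp add: inflow_def)
    moreover have "downs (int x) n \<le> Z (x - 1)"
      using flow[of n "x - 1", OF nz] inflow_le[of n "x - 1", OF nz] x by simp
    ultimately show "local_time (int x) n \<le> Z x + Z (x - 1)" by (simp add: local_time_eq)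
  qed
  also have "\<dots> = (\<Sum>x=1..N. Z x) + (\<Sum>x=1..N. Z (x - 1))" by (rule sum.distrib)
  also have "(\<Sum>x=1..N. Z (x - 1)) = (\<Sum>x=0..<N. Z x)"
    by (rule sum.reindex_bij_witness[of _ Suc "\<lambda>x. x - 1"]) auto
  also have "\<dots> \<le> (\<Sum>x=0..N. Z x)" by (intro sum_mono2) auto
  also have "\<dots> = 1 + (\<Sum>x=1..N. Z x)" by (simp add: sum.atLeast_Suc_atMost)
  finally show ?thesis by simp
qed

lemma hitting_time_leI: "X n = k \<Longrightarrow> hitting_time k X \<le> enat n"
  unfolding hitting_time_def by (intro Inf_lower) auto

lemma hitting_time_cases:
  obtains n where "hitting_time k X = enat n" "X n = k" "\<And>m. m < n \<Longrightarrow> X m \<noteq> k"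
  | "hitting_time k X = \<infinity>" "\<And>m. X m \<noteq> k"
proof (cases "\<exists>n. X n = k")
  case True
  define n where "n = (LEAST n. X n = k)"
  have n: "X n = k" unfolding n_def using True by (rule LeastI_ex)
  have m: "X m \<noteq> k" if "m < n" for m using that not_less_Least unfolding n_def by blast
  have "hitting_time k X = enat n"
  proof (rule antisym)
    show "enat n \<le> hitting_time k X" unfolding hitting_time_def
    proof (rule Inf_greatest, safe)
      fix m assume "k = X m"
      then show "enat n \<le> enat m" using m[of m] by (cases "m < n") auto
    qed
  qed (rule hitting_time_leI[OF n])
  then show ?thesis using that(1) n m by blast
next
  case False
  then have "hitting_time k X = \<infinity>" unfolding hitting_time_def by (simp add: top_enat_def)
  then show ?thesis using that(2) False by blast
qed

lemma hitting_time_0_le: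
  assumes "Z N = 0"
  shows "hitting_time 0 X \<le> enat (1 + 2 * (\<Sum>x=1..N. Z x))"
proof (rule ccontr)
  define B where "B = 1 + 2 * (\<Sum>x=1..N. Z x)"
  assume "\<not> ?thesis"
  then have nz: "X k \<noteq> 0" if "k < Suc B" for k
    using hitting_time_leI[of k 0] that unfolding B_def[symmetric]
    by (meson enat_ord_simps(1) less_Suc_eq_le order_trans)
  have "Suc B \<le> 1 + 2 * (\<Sum>x=1..N. Z x)"
  proof (rule time_le_of_confined)
    fix k assume k: "k < Suc B"
    then have nzk: "X j \<noteq> 0" if "j < k" for j using nz that by simp
    have "X k > 0" using walk_positive[of "Suc B" k, OF nz] k by simp
    moreover have "\<not> X k > int N" using inflow_le[of k N, OF nzk] flow[of k N, OF nzk] assms by (auto simp: of_bool_def split: if_splits)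
    ultimately show "0 < X k \<and> X k \<le> int N" by simp
  qed
  then show False by (simp add: B_def)
qed

lemma hitting_time_0_ge: "enat (\<Sum>x=1..N. Z x) \<le> hitting_time 0 X"
proof (cases rule: hitting_time_cases[of 0])
  case (1 n)
  have "(\<Sum>x=1..N. Z x) \<le> (\<Sum>x=1..N. local_time (int x) n)"
  proof (rule sum_mono)
    fix x assume "x \<in> {1..N}"
    then show "Z x \<le> local_time (int x) n"
      using inflow_ge[of n x, OF 1(3,2)] by (simp add: inflow_def local_time_eq)
  qed
  also have "\<dots> \<le> card {..<n}" unfolding sum_local_time by (intro card_mono) auto
  finally show ?thesis using 1(1) by simp
qed simp

text \<open>
An excursion that never reaches \<open>n\<close> either ends, and then \<open>Z (n - 1)\<close> equals its zero number of up steps from \<open>n - 1\<close>; or it stays in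
\<open>{1..n - 1}\<close> forever, which bounded crossing numbers exclude.
\<close>

lemma reaches_iff_branching_survives:
  assumes "n \<ge> 1"
  shows "hitting_time (int n) X < hitting_time 0 X \<longleftrightarrow> Z (n - 1) > 0"
proof
  assume less: "hitting_time (int n) X < hitting_time 0 X"
  obtain t where t: "hitting_time (int n) X = enat t" "X t = int n"
  proof (cases rule: hitting_time_cases[of "int n"])
    case (1 t)
    then show ?thesis using that by blast
  next
    case 2
    then show ?thesis using less by simp
  qed
  have nz: "X k \<noteq> 0" if "k < t" for k
  proof
    assume "X k = 0"
    then have "hitting_time 0 X \<le> enat k" by (rule hitting_time_leI)
    also have "\<dots> < hitting_time (int n) X" using t that by simp
    finally show False using less by simp
  qed
  have "inflow (n - 1) t \<ge> 1" using flow[of t "n - 1", OF nz] t assms by simp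
  then show "Z (n - 1) > 0" using inflow_le[of t "n - 1", OF nz] by simp
next
  assume pos: "Z (n - 1) > 0"
  show "hitting_time (int n) X < hitting_time 0 X"
  proof (rule ccontr)
    assume not: "\<not> ?thesis"
    show False
    proof (cases rule: hitting_time_cases[of 0])
      case (1 t)
      have "inflow (n - 1) t \<ge> 1" using inflow_ge[of t "n - 1", OF 1(3,2)] pos by simp
      then have "downs (int n) t \<ge> 1" using flow[of t "n - 1", OF 1(3)] 1(2) assms by simp
      then have "local_time (int n) t \<ge> 1" by (simp add: local_time_eq)
      then have "{k. k < t \<and> X k = int n} \<noteq> {}" unfolding local_time_def by fastforce
      then obtain k where "k < t" "X k = int n" by auto
      then have "hitting_time (int n) X \<le> enat k" "enat k < hitting_time 0 X"
        using hitting_time_leI[of k "int n"] 1(1) by auto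
      with not show False by simp
    next
      case 2
      then have nh: "X k \<noteq> int n" for k
        using hitting_time_leI[of k "int n"] not by (auto simp: less_le)
      have conf: "0 < X k \<and> X k \<le> int (n - 1)" for k
      proof (induction k)
        case 0
        show ?case using nh[of 0] assms by (cases "n = 1") auto
      next
        case (Suc k)
        then show ?case using walk_step[of k] 2(2)[of "Suc k"] nh[of "Suc k"] assms by (auto simp del: erw.simps)
      qed
      have "Suc (1 + 2 * (\<Sum>x=1..n - 1. Z x)) \<le> 1 + 2 * (\<Sum>x=1..n - 1. Z x)"
        by (rule time_le_of_confined) (rule conf)
      then show False by simp
    qed
  qed
qed

end

section \<open>Coins under the averaged law\<close>

(* From here on index sets {1..} occur in types of measures; rewriting 1 to Suc 0 inside them would
   make equal product spaces syntactically different. *)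
declare One_nat_def [simp del]

abbreviation coin_stack_space :: "(nat \<Rightarrow> bool) measure" where
  "coin_stack_space \<equiv> PiM {1..} (\<lambda>_. count_space UNIV)"

definition coin_stack :: "int \<Rightarrow> (int \<times> nat \<Rightarrow> bool) \<Rightarrow> nat \<Rightarrow> bool" where
  "coin_stack x \<eta> = (\<lambda>i\<in>{1..}. \<eta> (x, i))"

definition stack_coins :: "(nat \<Rightarrow> real) \<Rightarrow> (nat \<Rightarrow> bool) measure" where
  "stack_coins w = PiM {1..} (\<lambda>i. measure_pmf (bernoulli_pmf (w i)))"

lemma sets_stack_coins: "sets (stack_coins w) = sets coin_stack_space"
  unfolding stack_coins_def by (intro sets_PiM_cong) auto

lemma prob_space_stack_coins: "prob_space (stack_coins w)"
  unfolding stack_coins_def by (intro prob_space_PiM measure_pmf.prob_space_axioms)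

lemma prob_space_coin_measure: "prob_space (coin_measure \<omega>)"
  unfolding coin_measure_def by (intro prob_space_PiM measure_pmf.prob_space_axioms)

lemma measurable_coin_stack: "coin_stack x \<in> measurable coin_space coin_stack_space"
  unfolding coin_stack_def by (rule measurable_restrict) (auto intro!: measurable_component_singleton)

lemma distr_coin_stack: "distr (coin_measure \<omega>) coin_stack_space (coin_stack x) = stack_coins (stack x \<omega>)"
proof -
  let ?B = "\<lambda>k. measure_pmf (bernoulli_pmf (\<omega> k))"
  have "distr (PiM cookies ?B) (PiM {1..} (\<lambda>i. ?B (x, i))) (\<lambda>\<eta>. \<lambda>i\<in>{1..}. \<eta> (x, i)) = PiM {1..} (\<lambda>i. ?B (x, i))"
    by (rule distr_PiM_reindex) (auto intro!: measure_pmf.prob_space_axioms inj_onI)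
  moreover have "PiM {1..} (\<lambda>i. ?B (x, i)) = stack_coins (stack x \<omega>)"
    unfolding stack_coins_def by (rule PiM_cong) (auto simp: stack_def)
  moreover have "distr (coin_measure \<omega>) coin_stack_space (coin_stack x)
      = distr (PiM cookies ?B) (PiM {1..} (\<lambda>i. ?B (x, i))) (\<lambda>\<eta>. \<lambda>i\<in>{1..}. \<eta> (x, i))"
    unfolding coin_measure_def coin_stack_def by (intro distr_cong refl sets_PiM_cong) auto
  ultimately show ?thesis by simp
qed

text \<open>
Placing the stack at every site reduces this to the kernel of the whole environment.
\<close>

lemma measurable_stack_coins: "stack_coins \<in> measurable stack_space (prob_algebra coin_stack_space)"
proof -
  define e where "e = (\<lambda>(w :: nat \<Rightarrow> real). \<lambda>k\<in>cookies. w (snd (k :: int \<times> nat)))"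
  have e: "e \<in> measurable stack_space env_space"
    unfolding e_def stack_space_def env_space_def
    by (rule measurable_restrict) (auto intro!: measurable_component_singleton)
  have "stack_coins w = distr (coin_measure (e w)) coin_stack_space (coin_stack 0)" for w
    unfolding distr_coin_stack unfolding stack_coins_def
    by (rule PiM_cong) (auto simp: stack_def e_def)
  then have "stack_coins = (\<lambda>w. distr (coin_measure (e w)) coin_stack_space (coin_stack 0))"
    by (rule ext)
  also have "\<dots> \<in> measurable stack_space (prob_algebra coin_stack_space)"
    by (rule measurable_compose[OF e measurable_compose[OF measurable_coin_measure measurable_distr_prob_space[OF measurable_coin_stack]]])
  finally show ?thesis .
qed

lemma indep_coordinates:
  assumes "\<And>i. i \<in> I \<Longrightarrow> prob_space (M i)" and "I \<noteq> {}"
  shows "prob_space.indep_vars (PiM I M) M (\<lambda>i \<omega>. \<omega> i) I"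
proof -
  interpret prob_space "PiM I M" by (rule prob_space_PiM) fact
  have "distr (PiM I M) (PiM I M) (\<lambda>x. \<lambda>i\<in>I. x i) = distr (PiM I M) (PiM I M) (\<lambda>x. x)"
    by (rule distr_cong) (auto simp: space_PiM)
  also have "\<dots> = PiM I M" by (rule distr_id)
  also have "\<dots> = PiM I (\<lambda>i. distr (PiM I M) (M i) (\<lambda>\<omega>. \<omega> i))"
    using assms(1) by (intro PiM_cong refl distr_PiM_component[symmetric]) auto
  finally show ?thesis
    using assms(2) by (subst indep_vars_iff_distr_eq_PiM') (auto intro!: measurable_component_singleton)
qed

lemma quenched_indep_coin_stacks:
  "prob_space.indep_vars (coin_measure \<omega>) (\<lambda>_. coin_stack_space) coin_stack UNIV"
proof -
  interpret prob_space "coin_measure \<omega>" by (rule prob_space_coin_measure)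
  let ?B = "\<lambda>k. measure_pmf (bernoulli_pmf (\<omega> k))"
  have "indep_vars ?B (\<lambda>k \<eta>. \<eta> k) cookies"
    unfolding coin_measure_def by (rule indep_coordinates) (auto intro!: measure_pmf.prob_space_axioms)
  then have "indep_vars (\<lambda>x. PiM ({x} \<times> {1..}) ?B) (\<lambda>x \<eta>. restrict \<eta> ({x} \<times> {1..})) UNIV"
    by (rule indep_vars_restrict) (auto simp: disjoint_family_on_def)
  then have "indep_vars (\<lambda>_. coin_stack_space) (\<lambda>x \<eta>. coin_stack x (restrict \<eta> ({x} \<times> {1..}))) UNIV"
  proof (rule indep_vars_compose2)
    fix x :: int
    show "coin_stack x \<in> measurable (PiM ({x} \<times> {1..}) ?B) coin_stack_space"
      unfolding coin_stack_def
    proof (rule measurable_restrict)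
      fix i :: nat assume "i \<in> {1..}"
      then have "(\<lambda>\<eta>. \<eta> (x, i)) \<in> measurable (PiM ({x} \<times> {1..}) ?B) (?B (x, i))"
        by (intro measurable_component_singleton) auto
      then show "(\<lambda>\<eta>. \<eta> (x, i)) \<in> measurable (PiM ({x} \<times> {1..}) ?B) (count_space UNIV)"
        by simp
    qed
  qed
  moreover have "coin_stack x (restrict \<eta> ({x} \<times> {1..})) = coin_stack x \<eta>" for x \<eta>
    by (auto simp: coin_stack_def fun_eq_iff)
  ultimately show ?thesis by simp
qed

definition coin_law :: "(int \<times> nat \<Rightarrow> real) measure \<Rightarrow> (int \<times> nat \<Rightarrow> bool) measure" where
  "coin_law P = P \<bind> coin_measure"

definition stack_coin_law :: "(int \<times> nat \<Rightarrow> real) measure \<Rightarrow> (nat \<Rightarrow> bool) measure" where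
  "stack_coin_law P = distr (coin_law P) coin_stack_space (coin_stack 0)"

locale random_environment =
  fixes P :: "(int \<times> nat \<Rightarrow> real) measure"
  assumes law: "environment_law P"
begin

sublocale prob_space P using law by (simp add: environment_law_def)

lemma sets_P [measurable_cong]: "sets P = sets env_space"
  using law by (simp add: environment_law_def)

lemma space_P: "space P = space env_space"
  by (rule sets_eq_imp_space_eq[OF sets_P])

lemma P_in_prob_algebra: "P \<in> space (prob_algebra env_space)"
  using sets_P by (simp add: space_prob_algebra prob_space_axioms)

lemma measurable_coin_measure_P: "coin_measure \<in> measurable P (subprob_algebra coin_space)"
  using measurable_prob_algebraD[OF measurable_coin_measure]
  by (simp add: measurable_cong_sets[OF sets_P refl])

lemma sets_coin_law: "sets (coin_law P) = sets coin_space"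
  unfolding coin_law_def by (rule sets_bind'[OF P_in_prob_algebra measurable_coin_measure])

lemma prob_space_coin_law: "prob_space (coin_law P)"
  unfolding coin_law_def by (rule prob_space_bind'[OF P_in_prob_algebra measurable_coin_measure])

lemma space_coin_law: "space (coin_law P) = space coin_space"
  by (rule sets_eq_imp_space_eq[OF sets_coin_law])

lemma measure_coin_law:
  "A \<in> sets coin_space \<Longrightarrow> measure (coin_law P) A = (\<integral>\<omega>. measure (coin_measure \<omega>) A \<partial>P)"
  unfolding coin_law_def by (rule measure_bind[OF measurable_coin_measure_P])

lemma averaged_prob_eq:
  assumes A: "Measurable.pred path_space A"
  shows "averaged_prob P x A = measure (coin_law P) {\<eta> \<in> space coin_space. A (erw x \<eta>)}"
proof -
  have sA: "{X \<in> space path_space. A X} \<in> sets path_space" using A by (simp add: pred_def)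
  have "erw x -` {X \<in> space path_space. A X} \<inter> space coin_space = {\<eta> \<in> space coin_space. A (erw x \<eta>)}"
    using measurable_space[OF measurable_erw[of x]] by auto
  moreover have "erw x -` {X \<in> space path_space. A X} \<inter> space coin_space \<in> sets coin_space"
    by (rule measurable_sets[OF measurable_erw sA])
  ultimately have s: "{\<eta> \<in> space coin_space. A (erw x \<eta>)} \<in> sets coin_space" by simp
  have "measure (quenched_law \<omega> x) {X \<in> space (quenched_law \<omega> x). A X} = measure (coin_measure \<omega>) {\<eta> \<in> space coin_space. A (erw x \<eta>)}" for \<omega>
  proof -
    have sp: "space (coin_measure \<omega>) = space coin_space" by (rule sets_eq_imp_space_eq[OF sets_coin_measure])
    have "measure (quenched_law \<omega> x) {X \<in> space path_space. A X} = measure (coin_measure \<omega>) (erw x -` {X \<in> space path_space. A X} \<inter> space (coin_measure \<omega>))"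
      unfolding quenched_law_def
      by (rule measure_distr[OF _ sA]) (use measurable_erw[of x] in \<open>simp add: measurable_cong_sets[OF sets_coin_measure refl]\<close>)
    then show ?thesis
      using \<open>erw x -` _ \<inter> space coin_space = _\<close> by (simp add: sp quenched_law_def)
  qed
  then show ?thesis unfolding averaged_prob_def measure_coin_law[OF s] by simp
qed

lemma measurable_stack_coins_measure:
  assumes "B \<in> sets coin_stack_space"
  shows "(\<lambda>w. measure (stack_coins w) B) \<in> borel_measurable stack_space"
  using measurable_compose[OF measurable_prob_algebraD[OF measurable_stack_coins] measurable_measure_subprob_algebra[OF assms]] .

lemma measurable_stack_P: "stack x \<in> measurable P stack_space"
  using measurable_stack by (simp add: measurable_cong_sets[OF sets_P refl])

lemma measure_coin_stack:
  assumes B: "B \<in> sets coin_stack_space"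
  shows "measure (coin_law P) (coin_stack x -` B \<inter> space coin_space) = (\<integral>\<omega>. measure (stack_coins (stack x \<omega>)) B \<partial>P)"
proof -
  have "coin_stack x -` B \<inter> space coin_space \<in> sets coin_space" by (rule measurable_sets[OF measurable_coin_stack B])
  then have "measure (coin_law P) (coin_stack x -` B \<inter> space coin_space) = (\<integral>\<omega>. measure (coin_measure \<omega>) (coin_stack x -` B \<inter> space coin_space) \<partial>P)"
    by (rule measure_coin_law)
  also have "\<dots> = (\<integral>\<omega>. measure (stack_coins (stack x \<omega>)) B \<partial>P)"
  proof (rule Bochner_Integration.integral_cong[OF refl])
    fix \<omega>
    have sp: "space (coin_measure \<omega>) = space coin_space" by (rule sets_eq_imp_space_eq[OF sets_coin_measure])
    have "coin_stack x \<in> measurable (coin_measure \<omega>) coin_stack_space"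
      using measurable_coin_stack[of x] by (simp add: measurable_cong_sets[OF sets_coin_measure refl])
    from measure_distr[OF this B]
    show "measure (coin_measure \<omega>) (coin_stack x -` B \<inter> space coin_space) = measure (stack_coins (stack x \<omega>)) B"
      by (simp add: distr_coin_stack sp)
  qed
  finally show ?thesis .
qed

end

locale iid_environment = random_environment +
  assumes iid: "iid_stacks P"
begin

lemma indep_stacks: "indep_vars (\<lambda>_. stack_space) stack UNIV"
  using iid by (simp add: iid_stacks_def)

lemma distr_stack: "distr P stack_space (stack x) = distr P stack_space (stack 0)"
  using iid unfolding iid_stacks_def by blast

lemma measure_coin_stack_law:
  assumes B: "B \<in> sets coin_stack_space"
  shows "measure (coin_law P) (coin_stack x -` B \<inter> space coin_space) = measure (stack_coin_law P) B"
proof -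
  have e: "measure (coin_law P) (coin_stack x -` B \<inter> space coin_space) = (\<integral>w. measure (stack_coins w) B \<partial>(distr P stack_space (stack x)))" for x
    unfolding measure_coin_stack[OF B]
    by (rule integral_distr[symmetric, OF measurable_stack_P measurable_stack_coins_measure[OF B]])
  have "measure (stack_coin_law P) B = measure (coin_law P) (coin_stack 0 -` B \<inter> space coin_space)"
    unfolding stack_coin_law_def space_coin_law[symmetric]
    by (rule measure_distr[OF _ B]) (simp add: measurable_cong_sets[OF sets_coin_law refl] measurable_coin_stack)
  then show ?thesis unfolding e distr_stack[of x] by (rule sym)
qed

text \<open>
Given the environment the coin stacks are independent, and the conditional probability of an event at site \<open>x\<close> depends on the
environment through its stack at \<open>x\<close> only; the independence of these stacks then makes the expectation of the product factorise.
\<close>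

lemma indep_coin_stacks: "prob_space.indep_vars (coin_law P) (\<lambda>_. coin_stack_space) coin_stack UNIV"
proof -
  interpret Q: prob_space "coin_law P" by (rule prob_space_coin_law)
  have m: "coin_stack x \<in> measurable (coin_law P) coin_stack_space" for x
    using measurable_coin_stack by (simp add: measurable_cong_sets[OF sets_coin_law refl])
  show ?thesis unfolding Q.indep_vars_def2 Q.indep_sets_def
  proof (intro conjI ballI allI impI m)
    fix x :: int
    show "{coin_stack x -` A \<inter> space (coin_law P) |A. A \<in> sets coin_stack_space} \<subseteq> Q.events"
      using measurable_sets[OF m] by auto
  next
    fix J :: "int set" and A
    assume J: "J \<noteq> {}" "finite J" and A: "A \<in> (\<Pi> j\<in>J. {coin_stack j -` A \<inter> space (coin_law P) |A. A \<in> sets coin_stack_space})"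
    then have "\<forall>j\<in>J. \<exists>B. B \<in> sets coin_stack_space \<and> A j = coin_stack j -` B \<inter> space coin_space"
      by (fastforce simp: Pi_iff space_coin_law)
    then obtain B where B: "\<And>j. j \<in> J \<Longrightarrow> B j \<in> sets coin_stack_space" "\<And>j. j \<in> J \<Longrightarrow> A j = coin_stack j -` B j \<inter> space coin_space"
      by metis
    have eq: "(\<Inter>j\<in>J. A j) = (\<Inter>j\<in>J. coin_stack j -` B j \<inter> space coin_space)"
      by (intro INF_cong refl B)
    have "(\<Inter>j\<in>J. coin_stack j -` B j \<inter> space coin_space) \<in> sets coin_space"
      using J B by (intro sets.finite_INT measurable_sets[OF measurable_coin_stack]) auto
    then have "Q.prob (\<Inter>j\<in>J. A j) = (\<integral>\<omega>. measure (coin_measure \<omega>) (\<Inter>j\<in>J. coin_stack j -` B j \<inter> space coin_space) \<partial>P)"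
      unfolding eq by (rule measure_coin_law)
    also have "\<dots> = (\<integral>\<omega>. (\<Prod>j\<in>J. measure (stack_coins (stack j \<omega>)) (B j)) \<partial>P)"
    proof (rule Bochner_Integration.integral_cong[OF refl])
      fix \<omega>
      interpret C: prob_space "coin_measure \<omega>" by (rule prob_space_coin_measure)
      have sp: "space (coin_measure \<omega>) = space coin_space" by (rule sets_eq_imp_space_eq[OF sets_coin_measure])
      have "C.prob (\<Inter>j\<in>J. coin_stack j -` B j \<inter> space (coin_measure \<omega>)) = (\<Prod>j\<in>J. C.prob (coin_stack j -` B j \<inter> space (coin_measure \<omega>)))"
        using J B by (intro C.indep_varsD[OF quenched_indep_coin_stacks]) auto
      also have "\<dots> = (\<Prod>j\<in>J. measure (stack_coins (stack j \<omega>)) (B j))"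
      proof (rule prod.cong[OF refl])
        fix j assume "j \<in> J"
        have "coin_stack j \<in> measurable (coin_measure \<omega>) coin_stack_space"
          using measurable_coin_stack[of j] by (simp add: measurable_cong_sets[OF sets_coin_measure refl])
        from measure_distr[OF this B(1)[OF \<open>j \<in> J\<close>]]
        show "C.prob (coin_stack j -` B j \<inter> space (coin_measure \<omega>)) = measure (stack_coins (stack j \<omega>)) (B j)"
          by (simp add: distr_coin_stack)
      qed
      finally show "measure (coin_measure \<omega>) (\<Inter>j\<in>J. coin_stack j -` B j \<inter> space coin_space) = (\<Prod>j\<in>J. measure (stack_coins (stack j \<omega>)) (B j))"
        by (simp add: sp)
    qed
    also have "\<dots> = (\<Prod>j\<in>J. \<integral>\<omega>. measure (stack_coins (stack j \<omega>)) (B j) \<partial>P)"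
    proof (rule indep_vars_lebesgue_integral[OF J(2)])
      show "indep_vars (\<lambda>_. borel) (\<lambda>j \<omega>. measure (stack_coins (stack j \<omega>)) (B j)) J"
        by (rule indep_vars_compose2[OF indep_vars_subset[OF indep_stacks]])
          (auto intro!: measurable_stack_coins_measure B)
      fix j assume j: "j \<in> J"
      show "integrable P (\<lambda>\<omega>. measure (stack_coins (stack j \<omega>)) (B j))"
        by (rule integrable_const_bound[where B = 1])
          (auto intro!: measurable_compose[OF measurable_stack_P measurable_stack_coins_measure] B j
            prob_space.prob_le_1[OF prob_space_stack_coins])
    qed
    also have "\<dots> = (\<Prod>j\<in>J. Q.prob (A j))"
      by (intro prod.cong refl) (simp add: B measure_coin_stack)
    finally show "Q.prob (\<Inter>j\<in>J. A j) = (\<Prod>j\<in>J. Q.prob (A j))" .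
  qed
qed

end

section \<open>The coins at a single site\<close>

lemma stack_coins_cylinder:
  assumes "finite J" "J \<subseteq> {1..}"
  shows "measure (stack_coins w) {c \<in> space coin_stack_space. \<forall>i\<in>J. c i = b i} = (\<Prod>i\<in>J. pmf (bernoulli_pmf (w i)) (b i))"
proof -
  interpret product_prob_space "\<lambda>i. measure_pmf (bernoulli_pmf (w i))" "{1..}" by unfold_locales
  have sp: "space coin_stack_space = space (stack_coins w)"
    by (rule sets_eq_imp_space_eq[OF sets_stack_coins[symmetric]])
  have "emeasure (stack_coins w) {c \<in> space coin_stack_space. \<forall>i\<in>J. c i \<in> {b i}} = (\<Prod>i\<in>J. emeasure (measure_pmf (bernoulli_pmf (w i))) {b i})"
    unfolding sp unfolding stack_coins_def by (rule emeasure_PiM_Collect) (use assms in auto)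
  also have "\<dots> = ennreal (\<Prod>i\<in>J. pmf (bernoulli_pmf (w i)) (b i))"
    by (simp add: emeasure_pmf_single prod_ennreal)
  finally show ?thesis by (simp add: measure_def prod_nonneg)
qed

lemma stack_coins_split:
  assumes A: "A \<in> sets (PiM {1..i} (\<lambda>_. count_space (UNIV :: bool set)))"
    and B: "B \<in> sets (PiM {i<..} (\<lambda>_. count_space (UNIV :: bool set)))"
  shows "measure (stack_coins w) {c \<in> space coin_stack_space. restrict c {1..i} \<in> A \<and> restrict c {i<..} \<in> B}
    = measure (stack_coins w) {c \<in> space coin_stack_space. restrict c {1..i} \<in> A}
      * measure (stack_coins w) {c \<in> space coin_stack_space. restrict c {i<..} \<in> B}"
proof -
  let ?B = "\<lambda>i. measure_pmf (bernoulli_pmf (w i))"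
  interpret prob_space "stack_coins w" by (rule prob_space_stack_coins)
  have sp: "space coin_stack_space = space (stack_coins w)"
    by (rule sets_eq_imp_space_eq[OF sets_stack_coins[symmetric]])
  have "indep_vars ?B (\<lambda>i c. c i) {1..}"
    unfolding stack_coins_def by (rule indep_coordinates) (auto intro!: measure_pmf.prob_space_axioms)
  then have ind: "indep_var (PiM {1..i} ?B) (\<lambda>c. restrict (\<lambda>j. c j) {1..i}) (PiM {i<..} ?B) (\<lambda>c. restrict (\<lambda>j. c j) {i<..})"
    by (rule indep_var_restrict) auto
  have s: "sets (PiM I ?B) = sets (PiM I (\<lambda>_. count_space UNIV))" for I by (intro sets_PiM_cong) auto
  have "A \<in> sets (PiM {1..i} ?B)" "B \<in> sets (PiM {i<..} ?B)" using A B s by simp_all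
  from indep_varD[OF ind this] show ?thesis
    unfolding sp by (simp add: vimage_def Int_def conj_commute)
qed

lemma measurable_heads_before:
  assumes "{i..} \<subseteq> I"
  shows "(\<lambda>c. heads_before i c k) \<in> measurable (PiM I (\<lambda>_. count_space (UNIV :: bool set))) (count_space UNIV)"
proof -
  let ?N = "PiM I (\<lambda>_. count_space (UNIV :: bool set))"
  have comp: "Measurable.pred ?N (\<lambda>c. c m)" if "i \<le> m" for m
    using measurable_component_singleton[of m I "\<lambda>_. count_space UNIV"] assms that by auto
  have p: "Measurable.pred ?N (\<lambda>c. m \<in> {m. i \<le> m \<and> m < n \<and> \<not> c m})" for m n
    using comp[of m] by (cases "i \<le> m \<and> m < n") auto
  have c: "(\<lambda>c. card {m. i \<le> m \<and> m < n \<and> \<not> c m}) \<in> measurable ?N (count_space UNIV)" for n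
    by (rule measurable_card) (rule p[unfolded pred_def])
  have "Measurable.pred ?N (\<lambda>c. n \<in> {n. i \<le> n \<and> c n \<and> card {m. i \<le> m \<and> m < n \<and> \<not> c m} < k})" for n
  proof (cases "i \<le> n")
    case True
    have "Measurable.pred ?N (\<lambda>c. card {m. i \<le> m \<and> m < n \<and> \<not> c m} < k)"
      by (rule measurable_compose[OF c[of n]]) simp
    with comp[OF True] have "Measurable.pred ?N (\<lambda>c. c n \<and> card {m. i \<le> m \<and> m < n \<and> \<not> c m} < k)"
      by (rule pred_intros_logic)
    then show ?thesis using True by (simp only: mem_Collect_eq simp_thms)
  next
    case False
    then show ?thesis by (simp only: mem_Collect_eq simp_thms) (rule measurable_const, simp)
  qed
  then show ?thesis unfolding heads_before_def by (intro measurable_card) (simp only: pred_def)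
qed

lemma heads_before_0 [simp]: "heads_before i c 0 = 0"
  by (simp add: heads_before_def)

lemma heads_before_unfold:
  assumes "infinite {m. \<not> c m}"
  shows "heads_before i c (Suc k) = (if c i then Suc (heads_before (Suc i) c (Suc k)) else heads_before (Suc i) c k)"
proof (cases "c i")
  case True
  have "{m. i \<le> m \<and> m < n \<and> \<not> c m} = {m. Suc i \<le> m \<and> m < n \<and> \<not> c m}" for n
  proof (intro Collect_cong)
    fix m
    show "i \<le> m \<and> m < n \<and> \<not> c m \<longleftrightarrow> Suc i \<le> m \<and> m < n \<and> \<not> c m"
      using True by (cases "m = i") auto
  qed
  then have e: "card {m. i \<le> m \<and> m < n \<and> \<not> c m} = card {m. Suc i \<le> m \<and> m < n \<and> \<not> c m}" for n
    by simp
  have "{n. i \<le> n \<and> c n \<and> card {m. i \<le> m \<and> m < n \<and> \<not> c m} < Suc k}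
      = insert i {n. Suc i \<le> n \<and> c n \<and> card {m. Suc i \<le> m \<and> m < n \<and> \<not> c m} < Suc k}"
    unfolding e
  proof (rule set_eqI)
    fix n
    have "{m. Suc i \<le> m \<and> m < i \<and> \<not> c m} = {}" by auto
    then have z: "card {m. Suc i \<le> m \<and> m < i \<and> \<not> c m} < Suc k" by (simp only: card.empty)
    then show "n \<in> {n. i \<le> n \<and> c n \<and> card {m. Suc i \<le> m \<and> m < n \<and> \<not> c m} < Suc k}
      \<longleftrightarrow> n \<in> insert i {n. Suc i \<le> n \<and> c n \<and> card {m. Suc i \<le> m \<and> m < n \<and> \<not> c m} < Suc k}"
    proof (cases "n = i")
      case False
      then have "i \<le> n \<longleftrightarrow> Suc i \<le> n" by linarith
      then show ?thesis using False by simp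
    qed (use True z in simp)
  qed
  then show ?thesis unfolding heads_before_def using True finite_heads_before[OF assms, of "Suc i" "Suc k"] by simp
next
  case False
  have e: "card {m. i \<le> m \<and> m < n \<and> \<not> c m} = Suc (card {m. Suc i \<le> m \<and> m < n \<and> \<not> c m})" if "i < n" for n
  proof -
    have "{m. i \<le> m \<and> m < n \<and> \<not> c m} = insert i {m. Suc i \<le> m \<and> m < n \<and> \<not> c m}"
    proof (rule set_eqI)
      fix m
      show "m \<in> {m. i \<le> m \<and> m < n \<and> \<not> c m} \<longleftrightarrow> m \<in> insert i {m. Suc i \<le> m \<and> m < n \<and> \<not> c m}"
      proof (cases "m = i")
        case m: False
        then have "i \<le> m \<longleftrightarrow> Suc i \<le> m" by linarith
        then show ?thesis using m by simp
      qed (use False that in simp)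
    qed
    then show ?thesis by simp
  qed
  have "{n. i \<le> n \<and> c n \<and> card {m. i \<le> m \<and> m < n \<and> \<not> c m} < Suc k}
      = {n. Suc i \<le> n \<and> c n \<and> card {m. Suc i \<le> m \<and> m < n \<and> \<not> c m} < k}"
  proof (rule Collect_cong)
    fix n
    show "i \<le> n \<and> c n \<and> card {m. i \<le> m \<and> m < n \<and> \<not> c m} < Suc k
      \<longleftrightarrow> Suc i \<le> n \<and> c n \<and> card {m. Suc i \<le> m \<and> m < n \<and> \<not> c m} < k"
    proof (cases "i < n")
      case True
      then show ?thesis by (simp add: e)
    next
      case n: False
      then show ?thesis using False by (cases "n = i") simp_all
    qed
  qed
  then show ?thesis unfolding heads_before_def using False by simp
qed

lemma heads_before_cong:
  assumes "\<And>m. i \<le> m \<Longrightarrow> c m = c' m"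
  shows "heads_before i c k = heads_before i c' k"
proof -
  have "{m. i \<le> m \<and> m < n \<and> \<not> c m} = {m. i \<le> m \<and> m < n \<and> \<not> c' m}" for n
    using assms by blast
  then have "{n. i \<le> n \<and> c n \<and> card {m. i \<le> m \<and> m < n \<and> \<not> c m} < k} = {n. i \<le> n \<and> c' n \<and> card {m. i \<le> m \<and> m < n \<and> \<not> c' m} < k}"
    using assms by simp blast
  then show ?thesis by (simp only: heads_before_def)
qed

text \<open>
A run of \<open>l\<close> heads from a fair position on has probability \<open>(1/2) ^ l\<close>.
\<close>

lemma infinite_tails_AE:
  assumes "\<And>i. i > M \<Longrightarrow> w i = 1 / 2"
  shows "AE c in stack_coins w. infinite {m. \<not> c m}"
proof -
  interpret prob_space "stack_coins w" by (rule prob_space_stack_coins)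
  have sp: "space coin_stack_space = space (stack_coins w)"
    by (rule sets_eq_imp_space_eq[OF sets_stack_coins[symmetric]])
  have "AE c in stack_coins w. \<exists>m>n. \<not> c m" for n
  proof -
    define a where "a = max n M"
    define E where "E = (\<lambda>l. {c \<in> space coin_stack_space. \<forall>m\<in>{a<..a+l}. c m = True})"
    have comp: "Measurable.pred coin_stack_space (\<lambda>c. c m)" if "m \<ge> 1" for m
      using measurable_component_singleton[of m "{1..}" "\<lambda>_. count_space UNIV"] that by auto
    have Es: "E l \<in> events" for l
    proof -
      have "Measurable.pred coin_stack_space (\<lambda>c. \<forall>m\<in>{a<..a+l}. c m = True)"
        using comp by (intro pred_intros_finite) auto
      then show ?thesis by (simp add: E_def sets_stack_coins pred_def)
    qed
    have "prob (E l) = (1 / 2) ^ l" for l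
    proof -
      have "prob (E l) = (\<Prod>m\<in>{a<..a+l}. pmf (bernoulli_pmf (w m)) True)"
        unfolding E_def by (rule stack_coins_cylinder) auto
      also have "\<dots> = (\<Prod>m\<in>{a<..a+l}. 1 / 2)"
      proof (rule prod.cong[OF refl])
        fix m assume "m \<in> {a<..a+l}"
        then have "w m = 1 / 2" using assms[of m] by (simp add: a_def)
        then show "pmf (bernoulli_pmf (w m)) True = 1 / 2" by simp
      qed
      finally show ?thesis by simp
    qed
    then have z: "(\<lambda>l. prob (E l)) \<longlonglongrightarrow> 0" by (simp add: LIMSEQ_power_zero)
    have "prob (\<Inter>l. E l) \<le> 0"
      by (rule LIMSEQ_le_const[OF z]) (auto intro!: finite_measure_mono Es)
    then have "prob (\<Inter>l. E l) = 0" by (simp add: measure_le_0_iff)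
    moreover have "(\<Inter>l. E l) \<in> events" using Es by auto
    ultimately have "(\<Inter>l. E l) \<in> null_sets (stack_coins w)"
      by (simp add: null_sets_def emeasure_eq_measure)
    moreover have "{c \<in> space (stack_coins w). \<not> (\<exists>m>n. \<not> c m)} \<subseteq> (\<Inter>l. E l)"
      by (auto simp: E_def sp a_def)
    ultimately show ?thesis by (rule AE_I'[OF _ ])
  qed
  then have "AE c in stack_coins w. \<forall>n. \<exists>m>n. \<not> c m" by (subst AE_all_countable) auto
  then show ?thesis by eventually_elim (simp add: infinite_nat_iff_unbounded)
qed

lemma pmf_map_add: "pmf (map_pmf ((+) a) p) (j :: nat) = (if a \<le> j then pmf p (j - a) else 0)"
proof (cases "a \<le> j")
  case True
  then show ?thesis using pmf_map_inj'[of "(+) a" p "j - a"] by (simp add: inj_on_def)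
qed (auto intro!: pmf_map_outside)

lemma pmf_neg_binomial_half_Suc:
  "pmf (neg_binomial_pmf (Suc k) (1/2)) j =
    pmf (neg_binomial_pmf k (1/2)) j / 2 + (if j = 0 then 0 else pmf (neg_binomial_pmf (Suc k) (1/2)) (j - 1) / 2)"
proof -
  have "pmf (map_pmf Suc p) j = (if j = 0 then 0 else pmf p (j - 1))" for p :: "nat pmf"
  proof -
    have "(+) 1 = Suc" by auto
    then show ?thesis using pmf_map_add[of 1 p j] by (cases j) auto
  qed
  then show ?thesis
    by (subst neg_binomial_pmf_unfold) (auto simp: pmf_bind)
qed

text \<open>
Both sides satisfy the recursion obtained by looking at the next toss; each step reduces \<open>k + j\<close>.
\<close>

lemma heads_before_fair:
  assumes "\<And>m. m \<ge> i \<Longrightarrow> w m = 1 / 2" and "i \<ge> 1"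
  shows "measure (stack_coins w) {c \<in> space coin_stack_space. heads_before i c k = j} = pmf (neg_binomial_pmf k (1/2)) j"
  using assms
proof (induction "k + j" arbitrary: i k j rule: less_induct)
  case less
  interpret prob_space "stack_coins w" by (rule prob_space_stack_coins)
  have sp: "space coin_stack_space = space (stack_coins w)"
    by (rule sets_eq_imp_space_eq[OF sets_stack_coins[symmetric]])
  show ?case
  proof (cases k)
    case 0
    have "{c \<in> space coin_stack_space. heads_before i c 0 = j} = (if j = 0 then space (stack_coins w) else {})"
      by (auto simp: sp)
    then show ?thesis using 0 by (auto simp: prob_space indicator_def)
  next
    case (Suc k')
    define H where "H = (\<lambda>b k j. {c \<in> space coin_stack_space. c i = b \<and> heads_before (Suc i) c k = j})"
    have sets_H: "H b k j \<in> events" for b k j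
    proof -
      have "Measurable.pred coin_stack_space (\<lambda>c. c i = b)"
        using measurable_component_singleton[of i "{1..}" "\<lambda>_. count_space UNIV"] less.prems(2) by auto
      moreover have "Measurable.pred coin_stack_space (\<lambda>c. heads_before (Suc i) c k = j)"
        using measurable_compose[OF measurable_heads_before[of "Suc i" "{1..}" k], of "\<lambda>x. x = j" "count_space UNIV"] by (auto simp: subset_eq)
      ultimately have "Measurable.pred coin_stack_space (\<lambda>c. c i = b \<and> heads_before (Suc i) c k = j)" by simp
      then show ?thesis unfolding H_def sets_stack_coins by (simp add: pred_def)
    qed
    have H: "prob (H b k j) = 1 / 2 * prob {c \<in> space coin_stack_space. heads_before (Suc i) c k = j}" for b k j
    proof -
      define A where "A = {r \<in> space (PiM {1..i} (\<lambda>_. count_space (UNIV :: bool set))). r i = b}"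
      define B where "B = {r \<in> space (PiM {i<..} (\<lambda>_. count_space (UNIV :: bool set))). heads_before (Suc i) r k = j}"
      have A: "A \<in> sets (PiM {1..i} (\<lambda>_. count_space (UNIV :: bool set)))"
        using measurable_component_singleton[of i "{1..i}" "\<lambda>_. count_space (UNIV :: bool set)"] less.prems(2)
        unfolding A_def by (auto simp flip: pred_def)
      have B: "B \<in> sets (PiM {i<..} (\<lambda>_. count_space (UNIV :: bool set)))"
        using measurable_compose[OF measurable_heads_before[of "Suc i" "{i<..}" k], of "\<lambda>x. x = j" "count_space UNIV"]
        unfolding B_def by (auto simp flip: pred_def simp: subset_eq)
      have Ai: "restrict c {1..i} \<in> A \<longleftrightarrow> c i = b" for c using less.prems(2) by (auto simp: A_def space_PiM)
      have Bi: "restrict c {i<..} \<in> B \<longleftrightarrow> heads_before (Suc i) c k = j" for c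
        using heads_before_cong[of "Suc i" "restrict c {i<..}" c k] by (auto simp: B_def space_PiM)
      have "prob {c \<in> space coin_stack_space. c i = b} = 1 / 2"
        using stack_coins_cylinder[of "{i}" w "\<lambda>_. b"] less.prems by (cases b) auto
      then show ?thesis using stack_coins_split[OF A B, of w] unfolding Ai Bi H_def by simp
    qed
    have disj: "H False a b \<inter> H True a' b' = {}" for a b a' b' by (auto simp: H_def)
    have ae: "AE c in stack_coins w. infinite {m. \<not> c m}"
      by (rule infinite_tails_AE[of i]) (use less.prems in auto)
    have "prob {c \<in> space coin_stack_space. heads_before i c (Suc k') = j}
        = prob (H False k' j \<union> (if j = 0 then {} else H True (Suc k') (j - 1)))"
    proof (rule finite_measure_eq_AE)
      show "AE c in stack_coins w. c \<in> {c \<in> space coin_stack_space. heads_before i c (Suc k') = j}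
          \<longleftrightarrow> c \<in> H False k' j \<union> (if j = 0 then {} else H True (Suc k') (j - 1))"
        using ae AE_space
      proof eventually_elim
        case (elim c)
        then show ?case using heads_before_unfold[OF elim(1), of i k'] by (auto simp: H_def sp)
      qed
      show "{c \<in> space coin_stack_space. heads_before i c (Suc k') = j} \<in> events"
        using measurable_compose[OF measurable_heads_before[of i "{1..}" "Suc k'"], of "\<lambda>x. x = j" "count_space UNIV"] less.prems(2)
        unfolding sets_stack_coins by (auto simp flip: pred_def simp: subset_eq)
    qed (use sets_H in auto)
    also have "\<dots> = prob (H False k' j) + prob (if j = 0 then {} else H True (Suc k') (j - 1))"
      by (rule finite_measure_Union) (use sets_H disj in auto)
    also have "\<dots> = pmf (neg_binomial_pmf (Suc k') (1/2)) j"
      using less.hyps[of k' j "Suc i"] less.hyps[of "Suc k'" "j - 1" "Suc i"] less.prems Suc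
        pmf_neg_binomial_half_Suc[of k' j]
      by (cases "j = 0") (auto simp: H)
    finally show ?thesis using Suc by simp
  qed
qed

text \<open>
Heads obtained from the known tosses, and tails still to be awaited afterwards.
\<close>

fun consume :: "bool list \<Rightarrow> nat \<Rightarrow> nat \<times> nat" where
  "consume [] k = (0, k)"
| "consume (b # bs) 0 = (0, 0)"
| "consume (True # bs) (Suc k) = map_prod Suc id (consume bs (Suc k))"
| "consume (False # bs) (Suc k) = consume bs k"

lemma next_crossings_consume:
  "next_crossings bs k = map_pmf ((+) (fst (consume bs k))) (neg_binomial_pmf (snd (consume bs k)) (1/2))"
proof (induction bs k rule: consume.induct)
  case (1 k)
  have "(+) (0::nat) = id" by auto
  then show ?case by simp
next
  case (3 bs k)
  then show ?case by (simp add: pmf.map_comp comp_def)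
qed auto

lemma heads_before_consume:
  assumes "infinite {m. \<not> c m}"
  shows "heads_before i c k = fst (consume (map c [i..<i + l]) k) + heads_before (i + l) c (snd (consume (map c [i..<i + l]) k))"
proof (induction l arbitrary: i k)
  case (Suc l)
  have e: "map c [i..<i + Suc l] = c i # map c [Suc i..<Suc i + l]" by (simp add: upt_conv_Cons del: upt_Suc)
  show ?case
  proof (cases k)
    case 0
    then show ?thesis unfolding e by simp
  next
    case (Suc k')
    show ?thesis unfolding e Suc
      by (subst heads_before_unfold[OF assms]) (use
 Suc.IH[of "Suc i" "Suc k'"] Suc.IH[of "Suc i" k'] in \<open>cases "c i"; simp del: upt_Suc upt.simps\<close>)
  qed
qed simp

section \<open>From cookies to the chain of crossing numbers\<close>

definition first_coins :: "nat \<Rightarrow> (nat \<Rightarrow> bool) \<Rightarrow> bool list" where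
  "first_coins M c = map c [1..<Suc M]"

lemma length_first_coins [simp]: "length (first_coins M c) = M"
  by (simp add: first_coins_def)

lemma first_coins_eq_iff: 
  assumes "length bs = M"
  shows "first_coins M c = bs \<longleftrightarrow> (\<forall>i\<in>{1..M}. c i = bs ! (i - 1))"
proof -
  have "first_coins M c = bs \<longleftrightarrow> (\<forall>n<M. c (Suc n) = bs ! n)"
    using assms unfolding list_eq_iff_nth_eq by (simp add: first_coins_def del: upt_Suc flip: Suc_eq_plus1_left)
  also have "\<dots> \<longleftrightarrow> (\<forall>i\<in>{1..M}. c i = bs ! (i - 1))"
  proof
    assume *: "\<forall>n<M. c (Suc n) = bs ! n"
    show "\<forall>i\<in>{1..M}. c i = bs ! (i - 1)"
    proof
      fix i assume "i \<in> {1..M}"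
      then have "Suc (i - 1) = i" "i - 1 < M" by auto
      then show "c i = bs ! (i - 1)" using * by metis
    qed
  next
    assume *: "\<forall>i\<in>{1..M}. c i = bs ! (i - 1)"
    show "\<forall>n<M. c (Suc n) = bs ! n"
      using *[rule_format, of "Suc _"] by auto
  qed
  finally show ?thesis .
qed

lemma measurable_first_coins:
  assumes "{1..M} \<subseteq> I"
  shows "first_coins M \<in> measurable (PiM I (\<lambda>_. count_space UNIV)) (count_space UNIV)"
  unfolding measurable_count_space_eq2_countable
proof (intro conjI ballI)
  let ?N = "PiM I (\<lambda>_. count_space (UNIV :: bool set))"
  fix bs :: "bool list"
  show "first_coins M -` {bs} \<inter> space ?N \<in> sets ?N"
  proof (cases "length bs = M")
    case True
    have comp: "Measurable.pred ?N (\<lambda>c. c m = b)" if "m \<in> {1..M}" for m b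
    proof (rule measurable_compose[where f = "\<lambda>c. c m" and g = "\<lambda>x. x = b" and N = "count_space UNIV"])
      show "(\<lambda>c. c m) \<in> measurable ?N (count_space UNIV)"
        by (rule measurable_component_singleton) (use assms that in blast)
    qed simp
    have "Measurable.pred ?N (\<lambda>c. \<forall>i\<in>{1..M}. c i = bs ! (i - 1))"
      by (rule pred_intros_finite(3)[OF finite_atLeastAtMost comp])
    then have sets: "{c \<in> space ?N. \<forall>i\<in>{1..M}. c i = bs ! (i - 1)} \<in> sets ?N" by (simp only: pred_def)
    have eq: "{c \<in> space ?N. \<forall>i\<in>{1..M}. c i = bs ! (i - 1)} = first_coins M -` {bs} \<inter> space ?N"
    proof (rule set_eqI)
      fix c
      show "c \<in> {c \<in> space ?N. \<forall>i\<in>{1..M}. c i = bs ! (i - 1)} \<longleftrightarrow> c \<in> first_coins M -` {bs} \<inter> space ?N"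
        unfolding Int_iff vimage_singleton_eq mem_Collect_eq first_coins_eq_iff[OF True] by (rule conj_commute)
    qed
    show ?thesis using sets unfolding eq .
  next
    case False
    have "first_coins M c \<noteq> bs" for c
    proof
      assume "first_coins M c = bs"
      then have "length bs = M" using length_first_coins[of M c] by (simp only:)
      with False show "False" by (rule notE)
    qed
    then have "first_coins M -` {bs} = {}" by (simp add: vimage_def)
    then show ?thesis by (simp only: Int_empty_left sets.empty_sets)
  qed
qed simp

lemma stack_coins_first_coins:
  assumes "length bs = M"
  shows "measure (stack_coins w) {c \<in> space coin_stack_space. first_coins M c = bs}
    = (\<Prod>i\<in>{1..M}. pmf (bernoulli_pmf (w i)) (bs ! (i - 1)))"
  unfolding first_coins_eq_iff[OF assms] by (rule stack_coins_cylinder) auto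

lemma sets_coin_stackI:
  assumes "f \<in> measurable coin_stack_space (count_space UNIV)"
  shows "{c \<in> space coin_stack_space. f c \<in> A} \<in> sets coin_stack_space"
proof -
  have "{c \<in> space coin_stack_space. f c \<in> A} = f -` A \<inter> space coin_stack_space" by blast
  then show ?thesis using measurable_sets[OF assms, of A] by simp
qed

text \<open>
The first \<open>M\<close> tosses are independent of the later ones, which are fair; given the former, the remaining count is negative
binomial.
\<close>

lemma stack_coins_crossings:
  assumes fair: "\<And>i. i > M \<Longrightarrow> w i = 1 / 2" and l: "length bs = M"
  shows "measure (stack_coins w) {c \<in> space coin_stack_space. first_coins M c = bs \<and> heads_before 1 c k = j}
    = measure (stack_coins w) {c \<in> space coin_stack_space. first_coins M c = bs} * pmf (next_crossings bs k) j"
proof -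
  interpret prob_space "stack_coins w" by (rule prob_space_stack_coins)
  have sp: "space coin_stack_space = space (stack_coins w)"
    by (rule sets_eq_imp_space_eq[OF sets_stack_coins[symmetric]])
  define a where "a = fst (consume bs k)"
  define r where "r = snd (consume bs k)"
  have hs: "{c \<in> space coin_stack_space. first_coins M c = bs' \<and> heads_before i c k' = j'} \<in> events"
    if "i \<ge> 1" for i bs' k' j'
  proof -
    have "Measurable.pred coin_stack_space (\<lambda>c. first_coins M c = bs')"
      by (rule measurable_compose[where f = "first_coins M" and N = "count_space UNIV", OF measurable_first_coins, where g = "\<lambda>x. x = bs'"]) auto
    moreover have "Measurable.pred coin_stack_space (\<lambda>c. heads_before i c k' = j')"
      by (rule measurable_compose[where f = "\<lambda>c. heads_before i c k'" and N = "count_space UNIV", OF measurable_heads_before, where g = "\<lambda>x. x = j'"]) (use that in auto)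
    ultimately have "Measurable.pred coin_stack_space (\<lambda>c. first_coins M c = bs' \<and> heads_before i c k' = j')"
      by (rule pred_intros_logic)
    then show ?thesis unfolding sets_stack_coins by (simp only: pred_def)
  qed
  have ae: "AE c in stack_coins w. infinite {m. \<not> c m}" by (rule infinite_tails_AE[OF fair])
  have "prob {c \<in> space coin_stack_space. first_coins M c = bs \<and> heads_before 1 c k = j}
      = prob (if a \<le> j then {c \<in> space coin_stack_space. first_coins M c = bs \<and> heads_before (Suc M) c r = j - a} else {})"
  proof (rule finite_measure_eq_AE)
    show "AE c in stack_coins w. c \<in> {c \<in> space coin_stack_space. first_coins M c = bs \<and> heads_before 1 c k = j} \<longleftrightarrow>
       c \<in> (if a \<le> j then {c \<in> space coin_stack_space. first_coins M c = bs \<and> heads_before (Suc M) c r = j - a} else {})"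
      using ae
    proof eventually_elim
      case (elim c)
      have "heads_before 1 c k = a + heads_before (Suc M) c r" if "first_coins M c = bs"
      proof -
        have "map c [1..<1 + M] = bs" using that by (simp add: first_coins_def del: upt_Suc flip: Suc_eq_plus1_left)
        then show ?thesis
          using heads_before_consume[OF elim, of 1 k M] by (simp add: a_def r_def flip: Suc_eq_plus1_left)
      qed
      then show ?case by auto
    qed
  qed (use hs in auto)
  also have "\<dots> = (if a \<le> j then prob {c \<in> space coin_stack_space. first_coins M c = bs} * pmf (neg_binomial_pmf r (1/2)) (j - a) else 0)"
  proof (cases "a \<le> j")
    case True
    define A where "A = {c \<in> space (PiM {1..M} (\<lambda>_. count_space (UNIV :: bool set))). first_coins M c = bs}"
    define B where "B = {c \<in> space (PiM {M<..} (\<lambda>_. count_space (UNIV :: bool set))). heads_before (Suc M) c r = j - a}"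
    have A: "A \<in> sets (PiM {1..M} (\<lambda>_. count_space (UNIV :: bool set)))"
    proof -
      have "Measurable.pred (PiM {1..M} (\<lambda>_. count_space (UNIV :: bool set))) (\<lambda>c. first_coins M c = bs)"
        by (rule measurable_compose[where f = "first_coins M" and N = "count_space UNIV", OF measurable_first_coins, where g = "\<lambda>x. x = bs"]) auto
      then show ?thesis unfolding A_def by (simp only: pred_def)
    qed
    have B: "B \<in> sets (PiM {M<..} (\<lambda>_. count_space (UNIV :: bool set)))"
    proof -
      have "Measurable.pred (PiM {M<..} (\<lambda>_. count_space (UNIV :: bool set))) (\<lambda>c. heads_before (Suc M) c r = j - a)"
        by (rule measurable_compose[where f = "\<lambda>c. heads_before (Suc M) c r" and N = "count_space UNIV", OF measurable_heads_before, where g = "\<lambda>x. x = j - a"]) auto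
      then show ?thesis unfolding B_def by (simp only: pred_def)
    qed
    have Ai: "restrict c {1..M} \<in> A \<longleftrightarrow> first_coins M c = bs" for c
      unfolding A_def using first_coins_eq_iff[OF l, of c] first_coins_eq_iff[OF l, of "restrict c {1..M}"]
      by (auto simp: space_PiM)
    have Bi: "restrict c {M<..} \<in> B \<longleftrightarrow> heads_before (Suc M) c r = j - a" for c
      using heads_before_cong[of "Suc M" "restrict c {M<..}" c r] by (auto simp: B_def space_PiM)
    show ?thesis
      using stack_coins_split[OF A B, of w] heads_before_fair[of "Suc M" w r "j - a"] fair True
      unfolding Ai Bi by simp
  qed simp
  also have "\<dots> = prob {c \<in> space coin_stack_space. first_coins M c = bs} * pmf (next_crossings bs k) j"
    unfolding next_crossings_consume pmf_map_add a_def r_def by simp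
  finally show ?thesis .
qed

lemma ex_pmf_eq_measure:
  fixes D :: "'a :: countable measure"
  assumes "prob_space D" "sets D = UNIV"
  shows "\<exists>p. measure_pmf p = D"
proof -
  interpret prob_space D by fact
  have "sets D = sets (count_space UNIV)" using assms(2) by (simp only: sets_count_space Pow_UNIV)
  then have sp: "space D = UNIV" using sets_eq_imp_space_eq[of D "count_space UNIV"] by (simp only: space_count_space)
  have "(\<integral>\<^sup>+x. ennreal (prob {x}) \<partial>count_space UNIV) = emeasure D UNIV"
    unfolding emeasure_eq_measure[symmetric] by (rule emeasure_countable_singleton[symmetric]) (auto simp: assms(2))
  also have "\<dots> = 1" using emeasure_space_1 sp by simp
  finally have 1: "(\<integral>\<^sup>+x. ennreal (prob {x}) \<partial>count_space UNIV) = 1" .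
  have "measure_pmf (embed_pmf (\<lambda>x. prob {x})) = D"
  proof (rule measure_eqI_countable)
    show "sets (measure_pmf (embed_pmf (\<lambda>x. prob {x}))) = Pow UNIV" "sets D = Pow UNIV" using assms(2) by auto
    show "countable (UNIV :: 'a set)" by simp
    show "emeasure (measure_pmf (embed_pmf (\<lambda>x. prob {x}))) {a} = emeasure D {a}" for a
      by (simp add: emeasure_pmf_single pmf_embed_pmf[OF _ 1] emeasure_eq_measure)
  qed
  then show ?thesis by blast
qed

lemma measurable_branching:
  assumes "\<And>y. 1 \<le> y \<Longrightarrow> y \<le> int x \<Longrightarrow> (\<lambda>s. coin_stack y (g s)) \<in> measurable N coin_stack_space"
  shows "(\<lambda>s. branching (g s) x) \<in> measurable N (count_space UNIV)"
  using assms
proof (induction x)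
  case 0
  show ?case by simp
next
  case (Suc x)
  have "(\<lambda>s. heads_before 1 (coin_stack (int (Suc x)) (g s)) k) \<in> measurable N (count_space UNIV)" for k
    by (rule measurable_compose[OF _ measurable_heads_before[of 1 "{1..}"]]) (auto intro!: Suc.prems)
  then have "(\<lambda>s. heads_before 1 (coin_stack (int (Suc x)) (g s)) (branching (g s) x)) \<in> measurable N (count_space UNIV)"
    by (rule measurable_compose_countable) (use Suc in auto)
  moreover have "heads_before 1 (coin_stack y \<eta>) k = heads_before 1 (\<lambda>m. \<eta> (y, m)) k" for y \<eta> k
    by (rule heads_before_cong) (auto simp: coin_stack_def)
  ultimately show ?case by simp
qed

locale cookie_environment = iid_environment +
  fixes M :: nat
  assumes elliptic: "weakly_elliptic P" and bounded: "bounded_cookies P M"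
begin

text \<open>
An event of probability \<open>1\<close> is measurable here, since non-measurable sets have measure \<open>0\<close>.
\<close>

lemma fair_AE: "AE \<omega> in P. \<forall>x. \<forall>i>M. stack x \<omega> i = 1 / 2"
proof -
  define E where "E = {\<omega> \<in> space P. \<forall>x. \<forall>i>M. \<omega> (x, i) = 1 / 2}"
  have p: "prob E = 1" using bounded by (simp add: bounded_cookies_def E_def)
  then have "E \<in> events" using measure_notin_sets by fastforce
  then have "AE \<omega> in P. \<omega> \<in> E" using p by (simp add: AE_in_set_eq_1)
  then show ?thesis by eventually_elim (auto simp: E_def stack_def)
qed

definition coin_pmf :: "bool list pmf" where
  "coin_pmf = (SOME p. measure_pmf p = distr (stack_coin_law P) (count_space UNIV) (first_coins M))"

lemma sets_stack_coin_law: "sets (stack_coin_law P) = sets coin_stack_space"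
  by (simp add: stack_coin_law_def)

lemma space_stack_coin_law: "space (stack_coin_law P) = space coin_stack_space"
  by (simp add: stack_coin_law_def)

lemma prob_space_stack_coin_law: "prob_space (stack_coin_law P)"
  unfolding stack_coin_law_def
  by (rule prob_space.prob_space_distr[OF prob_space_coin_law])
    (simp add: measurable_cong_sets[OF sets_coin_law refl] measurable_coin_stack)

lemma measurable_first_coins_law: "first_coins M \<in> measurable (stack_coin_law P) (count_space UNIV)"
  using measurable_first_coins[of M "{1..}"] by (simp add: measurable_cong_sets[OF sets_stack_coin_law refl])

lemma measure_coin_pmf: "measure_pmf coin_pmf = distr (stack_coin_law P) (count_space UNIV) (first_coins M)"
proof -
  have "prob_space (distr (stack_coin_law P) (count_space UNIV) (first_coins M))"
    by (rule prob_space.prob_space_distr[OF prob_space_stack_coin_law measurable_first_coins_law])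
  then have "\<exists>p. measure_pmf p = distr (stack_coin_law P) (count_space UNIV) (first_coins M)"
    by (rule ex_pmf_eq_measure) simp
  then show ?thesis unfolding coin_pmf_def by (rule someI_ex)
qed

lemma measure_stack_coin_law:
  "B \<in> sets coin_stack_space \<Longrightarrow> measure (stack_coin_law P) B = (\<integral>\<omega>. measure (stack_coins (stack 0 \<omega>)) B \<partial>P)"
  using measure_coin_stack_law[of B 0] measure_coin_stack[of B 0] by simp

lemma integrable_measure_stack_coins:
  "B \<in> sets coin_stack_space \<Longrightarrow> integrable P (\<lambda>\<omega>. measure (stack_coins (stack x \<omega>)) B)"
  by (rule integrable_const_bound[where B = 1])
    (auto intro!: measurable_compose[OF measurable_stack_P measurable_stack_coins_measure]
      prob_space.prob_le_1[OF prob_space_stack_coins])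

lemma first_coins_sets: "{c \<in> space coin_stack_space. first_coins M c = bs} \<in> sets coin_stack_space"
  using sets_coin_stackI[OF measurable_first_coins, of M "{bs}"] by auto

lemma pmf_coin_pmf:
  "pmf coin_pmf bs = (\<integral>\<omega>. measure (stack_coins (stack 0 \<omega>)) {c \<in> space coin_stack_space. first_coins M c = bs} \<partial>P)"
proof -
  have "pmf coin_pmf bs = measure (distr (stack_coin_law P) (count_space UNIV) (first_coins M)) {bs}"
    unfolding measure_coin_pmf[symmetric] by (simp add: measure_pmf_single)
  also have "\<dots> = measure (stack_coin_law P) (first_coins M -` {bs} \<inter> space (stack_coin_law P))"
    by (rule measure_distr[OF measurable_first_coins_law]) simp
  also have "first_coins M -` {bs} \<inter> space (stack_coin_law P) = {c \<in> space coin_stack_space. first_coins M c = bs}"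
    by (auto simp: space_stack_coin_law)
  finally show ?thesis using measure_stack_coin_law[OF first_coins_sets] by simp
qed

lemma unit_interval: "\<omega> \<in> space P \<Longrightarrow> i \<ge> 1 \<Longrightarrow> 0 \<le> \<omega> (x, i) \<and> \<omega> (x, i) \<le> 1"
  by (auto simp: space_P space_env_space PiE_iff)

text \<open>
A product of probabilities that is positive on an event of positive probability has positive mean.
\<close>

lemma positive_coin_pmf:
  assumes l: "length bs = M"
    and pos: "prob {\<omega> \<in> space P. \<forall>i\<in>{1..M}. pmf (bernoulli_pmf (\<omega> (0, i))) (bs ! (i - 1)) > 0} > 0"
  shows "bs \<in> set_pmf coin_pmf"
proof -
  define E where "E = {\<omega> \<in> space P. \<forall>i\<in>{1..M}. pmf (bernoulli_pmf (\<omega> (0, i))) (bs ! (i - 1)) > 0}"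
  have E: "E \<in> events" using pos measure_notin_sets unfolding E_def by fastforce
  define f where "f = (\<lambda>\<omega>. measure (stack_coins (stack 0 \<omega>)) {c \<in> space coin_stack_space. first_coins M c = bs})"
  have f: "f \<omega> = (\<Prod>i\<in>{1..M}. pmf (bernoulli_pmf (\<omega> (0, i))) (bs ! (i - 1)))" for \<omega>
    unfolding f_def stack_coins_first_coins[OF l] by (intro prod.cong) (auto simp: stack_def)
  have "expectation f \<noteq> 0"
  proof
    assume "expectation f = 0"
    then have "AE \<omega> in P. f \<omega> = 0"
      using integral_nonneg_eq_0_iff_AE[of P f] integrable_measure_stack_coins[OF first_coins_sets]
      by (simp add: f_def)
    then have "AE \<omega> in P. \<omega> \<notin> E"
    proof eventually_elim
      case (elim \<omega>)
      show ?case
      proof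
        assume "\<omega> \<in> E"
        then have "f \<omega> > 0" unfolding f E_def by (intro prod_pos) auto
        with elim show False by simp
      qed
    qed
    then have "prob E = 0" using E by (simp add: prob_eq_0)
    with pos show False by (simp add: E_def)
  qed
  then show ?thesis by (simp add: set_pmf_iff pmf_coin_pmf f_def)
qed

lemma length_coin_pmf: "bs \<in> set_pmf coin_pmf \<Longrightarrow> length bs = M"
proof (rule ccontr)
  assume "bs \<in> set_pmf coin_pmf" "length bs \<noteq> M"
  then have "{c \<in> space coin_stack_space. first_coins M c = bs} = {}" by auto
  then have "pmf coin_pmf bs = 0" unfolding pmf_coin_pmf by (simp only: measure_empty Bochner_Integration.integral_zero)
  with \<open>bs \<in> set_pmf coin_pmf\<close> show False by (simp add: set_pmf_iff)
qed

sublocale cookie_chain coin_pmf M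
proof
  have *: "prob {\<omega> \<in> space P. \<forall>i\<in>{1..M}. pmf (bernoulli_pmf (\<omega> (0, i))) (replicate M b ! (i - 1)) > 0} > 0" for b
  proof -
    define F where "F = {\<omega> \<in> space P. \<forall>i\<ge>1. if b then \<omega> (0, i) > 0 else \<omega> (0, i) < 1}"
    define E where "E = {\<omega> \<in> space P. \<forall>i\<in>{1..M}. pmf (bernoulli_pmf (\<omega> (0, i))) (replicate M b ! (i - 1)) > 0}"
    have "0 < prob F"
      using elliptic unfolding weakly_elliptic_def F_def by (cases b) auto
    moreover have "F \<subseteq> E"
    proof
      fix \<omega> assume w: "\<omega> \<in> F"
      have "pmf (bernoulli_pmf (\<omega> (0, i))) (replicate M b ! (i - 1)) > 0" if i: "i \<in> {1..M}" for i
      proof -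
        have "0 \<le> \<omega> (0, i) \<and> \<omega> (0, i) \<le> 1" using w i by (intro unit_interval) (auto simp: F_def)
        moreover have "if b then \<omega> (0, i) > 0 else \<omega> (0, i) < 1" using w i by (auto simp: F_def)
        ultimately show ?thesis using i by (cases b) auto
      qed
      then show "\<omega> \<in> E" using w by (auto simp: E_def F_def)
    qed
    moreover have "E \<in> events"
    proof -
      have "{c \<in> space coin_stack_space. first_coins M c = replicate M b} \<in> sets coin_stack_space" by (rule first_coins_sets)
      then have "(\<lambda>\<omega>. measure (stack_coins (stack 0 \<omega>)) {c \<in> space coin_stack_space. first_coins M c = replicate M b}) \<in> borel_measurable P"
        using integrable_measure_stack_coins by blast
      then have sets: "{\<omega> \<in> space P. measure (stack_coins (stack 0 \<omega>)) {c \<in> space coin_stack_space. first_coins M c = replicate M b} > 0} \<in> events"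
        by (simp add: borel_measurable_less)
      have eq: "{\<omega> \<in> space P. measure (stack_coins (stack 0 \<omega>)) {c \<in> space coin_stack_space. first_coins M c = replicate M b} > 0} = E"
      proof -
        have "measure (stack_coins (stack 0 \<omega>)) {c \<in> space coin_stack_space. first_coins M c = replicate M b} > 0
            \<longleftrightarrow> (\<forall>i\<in>{1..M}. pmf (bernoulli_pmf (\<omega> (0, i))) (replicate M b ! (i - 1)) > 0)" for \<omega>
        proof -
          have "measure (stack_coins (stack 0 \<omega>)) {c \<in> space coin_stack_space. first_coins M c = replicate M b}
              = (\<Prod>i\<in>{1..M}. pmf (bernoulli_pmf (\<omega> (0, i))) (replicate M b ! (i - 1)))"
            by (subst stack_coins_first_coins) (auto simp: stack_def intro!: prod.cong)
          moreover have "0 \<le> (\<Prod>i\<in>{1..M}. pmf (bernoulli_pmf (\<omega> (0, i))) (replicate M b ! (i - 1)))"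
            by (intro prod_nonneg) simp
          ultimately show ?thesis by (auto simp: less_le)
        qed
        then show ?thesis by (simp add: E_def)
      qed
      show ?thesis using sets unfolding eq .
    qed
    ultimately have "0 < prob E" using finite_measure_mono[of F E] by linarith
    then show ?thesis by (simp add: E_def)
  qed
  show "replicate M True \<in> set_pmf coin_pmf" "replicate M False \<in> set_pmf coin_pmf"
    using * by (auto intro!: positive_coin_pmf)
qed (rule length_coin_pmf)

lemma measurable_cookie:
  assumes "i \<ge> 1"
  shows "(\<lambda>\<omega>. \<omega> (x, i)) \<in> borel_measurable P"
proof -
  have "(\<lambda>\<omega>. \<omega> (x, i)) \<in> measurable env_space unit_interval"
    unfolding env_space_def using assms by (intro measurable_component_singleton) auto
  then have "(\<lambda>\<omega>. \<omega> (x, i)) \<in> borel_measurable env_space"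
    by (simp add: measurable_restrict_space2_iff)
  then show ?thesis by (simp add: measurable_cong_sets[OF sets_P refl])
qed

lemma integrable_cookie: "i \<ge> 1 \<Longrightarrow> integrable P (\<lambda>\<omega>. \<omega> (x, i))"
  by (rule integrable_const_bound[where B = 1]) (use unit_interval measurable_cookie in \<open>auto simp: abs_le_iff\<close>)

lemma prob_coin:
  assumes i: "i \<ge> 1"
  shows "measure (stack_coin_law P) {c \<in> space coin_stack_space. c i} = (\<integral>\<omega>. \<omega> (0, i) \<partial>P)"
proof -
  have s: "{c \<in> space coin_stack_space. c i} \<in> sets coin_stack_space"
    using sets_coin_stackI[OF measurable_component_singleton[of i "{1..}" "\<lambda>_. count_space UNIV"], of "{True}"] i by simp
  have "measure (stack_coin_law P) {c \<in> space coin_stack_space. c i} = (\<integral>\<omega>. measure (stack_coins (stack 0 \<omega>)) {c \<in> space coin_stack_space. c i} \<partial>P)"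
    by (rule measure_stack_coin_law[OF s])
  also have "\<dots> = (\<integral>\<omega>. \<omega> (0, i) \<partial>P)"
  proof (rule Bochner_Integration.integral_cong[OF refl])
    fix \<omega> assume "\<omega> \<in> space P"
    with unit_interval[OF this i, of 0] stack_coins_cylinder[of "{i}" "stack 0 \<omega>" "\<lambda>_. True"] i
    show "measure (stack_coins (stack 0 \<omega>)) {c \<in> space coin_stack_space. c i} = \<omega> (0, i)"
      by (simp add: stack_def)
  qed
  finally show ?thesis .
qed

lemma mean_drift_eq: "mean_drift = drift P M"
proof -
  interpret R: prob_space "stack_coin_law P" by (rule prob_space_stack_coin_law)
  have m: "(\<lambda>c. c i) \<in> measurable (stack_coin_law P) (count_space UNIV)" if "i \<ge> 1" for i
    using measurable_component_singleton[of i "{1..}" "\<lambda>_. count_space UNIV"] that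
    by (simp add: measurable_cong_sets[OF sets_stack_coin_law refl])
  have s: "{c \<in> space coin_stack_space. c i} \<in> R.events" if "i \<ge> 1" for i
    using measurable_sets[OF m[OF that], of "{True}"] by (simp add: vimage_def Int_def conj_commute space_stack_coin_law)
  have "mean_drift = (\<integral>c. coin_drift (first_coins M c) \<partial>stack_coin_law P)"
    unfolding mean_drift_def measure_coin_pmf by (rule integral_distr[OF measurable_first_coins_law]) simp
  also have "\<dots> = (\<integral>c. (\<Sum>i=1..M. 2 * indicator {c \<in> space coin_stack_space. c i} c - 1) \<partial>stack_coin_law P)"
  proof (rule Bochner_Integration.integral_cong[OF refl])
    fix c assume "c \<in> space (stack_coin_law P)"
    then have c: "c \<in> space coin_stack_space" by (simp add: space_stack_coin_law)
    have "coin_drift (first_coins M c) = (\<Sum>i\<leftarrow>[1..<Suc M]. if c i then 1 else - 1)"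
      by (simp add: coin_drift_def first_coins_def comp_def del: upt_Suc)
    also have "\<dots> = (\<Sum>i\<in>set [1..<Suc M]. if c i then 1 else - 1)" by (rule interv_sum_list_conv_sum_set_nat)
    also have "set [1..<Suc M] = {1..M}" by auto
    also have "(\<Sum>i\<in>{1..M}. if c i then 1 else - 1) = (\<Sum>i=1..M. 2 * indicator {c \<in> space coin_stack_space. c i} c - (1::real))"
      using c by (intro sum.cong) auto
    finally show "coin_drift (first_coins M c) = (\<Sum>i=1..M. 2 * indicator {c \<in> space coin_stack_space. c i} c - 1)" .
  qed
  also have "\<dots> = (\<Sum>i=1..M. \<integral>c. 2 * indicator {c \<in> space coin_stack_space. c i} c - 1 \<partial>stack_coin_law P)"
    using s by (intro Bochner_Integration.integral_sum) (auto simp: R.emeasure_eq_measure)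
  also have "\<dots> = (\<Sum>i=1..M. 2 * (\<integral>\<omega>. \<omega> (0, i) \<partial>P) - 1)"
  proof (rule sum.cong[OF refl])
    fix i assume i: "i \<in> {1..M}"
    then have "i \<ge> 1" by simp
    have "integrable (stack_coin_law P) (indicator {c \<in> space coin_stack_space. c i} :: _ \<Rightarrow> real)"
      using s[OF \<open>i \<ge> 1\<close>] by (simp add: R.emeasure_eq_measure)
    then have "(\<integral>c. 2 * indicator {c \<in> space coin_stack_space. c i} c - 1 \<partial>stack_coin_law P)
      = 2 * R.prob {c \<in> space coin_stack_space. c i} - 1"
      using s[OF \<open>i \<ge> 1\<close>] R.prob_space by simp
    then show "(\<integral>c. 2 * indicator {c \<in> space coin_stack_space. c i} c - 1 \<partial>stack_coin_law P) = 2 * (\<integral>\<omega>. \<omega> (0, i) \<partial>P) - 1"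
      using prob_coin[OF \<open>i \<ge> 1\<close>] by simp
  qed
  also have "\<dots> = drift P M"
    unfolding drift_def using integrable_cookie
    by (subst Bochner_Integration.integral_sum) (auto simp: prob_space)
  finally show ?thesis .
qed

text \<open>
Averaging \<open>stack_coins_crossings\<close> over the environment affects only the probabilities of the first \<open>M\<close> tosses.
\<close>

lemma stack_coin_law_crossings:
  "measure (stack_coin_law P) {c \<in> space coin_stack_space. heads_before 1 c k = j} = pmf (kernel k) j"
proof -
  define L where "L = {bs :: bool list. length bs = M}"
  have fin: "finite L" unfolding L_def using finite_lists_length_eq[of "UNIV :: bool set" M] by simp
  define q where "q = (\<lambda>\<omega> bs. measure (stack_coins (stack 0 \<omega>)) {c \<in> space coin_stack_space. first_coins M c = bs})"
  have hs: "{c \<in> space coin_stack_space. heads_before 1 c k = j} \<in> sets coin_stack_space"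
    using sets_coin_stackI[OF measurable_heads_before[of 1 "{1..}" k], of "{j}"] by simp
  have int: "integrable P (\<lambda>\<omega>. q \<omega> bs)" for bs
    unfolding q_def by (rule integrable_measure_stack_coins[OF first_coins_sets])
  have "measure (stack_coin_law P) {c \<in> space coin_stack_space. heads_before 1 c k = j}
      = (\<integral>\<omega>. measure (stack_coins (stack 0 \<omega>)) {c \<in> space coin_stack_space. heads_before 1 c k = j} \<partial>P)"
    by (rule measure_stack_coin_law[OF hs])
  also have "\<dots> = (\<integral>\<omega>. (\<Sum>bs\<in>L. q \<omega> bs * pmf (next_crossings bs k) j) \<partial>P)"
  proof (rule integral_cong_AE)
    show "AE \<omega> in P. measure (stack_coins (stack 0 \<omega>)) {c \<in> space coin_stack_space. heads_before 1 c k = j} =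
       (\<Sum>bs\<in>L. q \<omega> bs * pmf (next_crossings bs k) j)"
      using fair_AE
    proof eventually_elim
      case (elim \<omega>)
      interpret S: prob_space "stack_coins (stack 0 \<omega>)" by (rule prob_space_stack_coins)
      have "{c \<in> space coin_stack_space. heads_before 1 c k = j} =
          (\<Union>bs\<in>L. {c \<in> space coin_stack_space. first_coins M c = bs \<and> heads_before 1 c k = j})"
        by (auto simp: L_def)
      then have "S.prob {c \<in> space coin_stack_space. heads_before 1 c k = j} =
          (\<Sum>bs\<in>L. S.prob {c \<in> space coin_stack_space. first_coins M c = bs \<and> heads_before 1 c k = j})"
      proof (simp only:, intro S.finite_measure_finite_Union fin)
        have "{c \<in> space coin_stack_space. first_coins M c = bs \<and> heads_before 1 c k = j} \<in> S.events" for bs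
        proof -
          have "{c \<in> space coin_stack_space. first_coins M c = bs \<and> heads_before 1 c k = j}
            = {c \<in> space coin_stack_space. first_coins M c = bs} \<inter> {c \<in> space coin_stack_space. heads_before 1 c k = j}"
            by auto
          then show ?thesis using first_coins_sets hs by (simp add: sets_stack_coins sets.Int)
        qed
        then show "(\<lambda>bs. {c \<in> space coin_stack_space. first_coins M c = bs \<and> heads_before 1 c k = j}) ` L \<subseteq> S.events"
          by auto
      qed (auto simp: disjoint_family_on_def)
      also have "\<dots> = (\<Sum>bs\<in>L. q \<omega> bs * pmf (next_crossings bs k) j)"
        unfolding q_def using elim by (intro sum.cong refl stack_coins_crossings) (auto simp: L_def)
      finally show ?case .
    qed
    show "(\<lambda>\<omega>. \<Sum>bs\<in>L. q \<omega> bs * pmf (next_crossings bs k) j) \<in> borel_measurable P"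
      by (intro borel_measurable_sum borel_measurable_times borel_measurable_const borel_measurable_integrable[OF int])
  qed (rule borel_measurable_integrable[OF integrable_measure_stack_coins[OF hs]])
  also have "\<dots> = (\<Sum>bs\<in>L. pmf coin_pmf bs * pmf (next_crossings bs k) j)"
  proof -
    have "pmf coin_pmf bs = (\<integral>\<omega>. q \<omega> bs \<partial>P)" for bs by (simp only: pmf_coin_pmf q_def)
    then show ?thesis using int by simp
  qed
  also have "\<dots> = pmf (kernel k) j"
    unfolding kernel_def pmf_bind
    using length_coin_pmf by (subst integral_measure_pmf_real[OF fin]) (auto simp: L_def mult.commute)
  finally show ?thesis .
qed

end

section \<open>Path identities and the law of the crossing numbers\<close>

lemma hitting_time_greater_iff: "hitting_time k X > enat n \<longleftrightarrow> (\<forall>m\<le>n. X m \<noteq> k)"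
proof
  assume less: "hitting_time k X > enat n"
  show "\<forall>m\<le>n. X m \<noteq> k"
  proof (intro allI impI notI)
    fix m assume m: "m \<le> n" "X m = k"
    then have "hitting_time k X \<le> enat m" unfolding hitting_time_def by (intro Inf_lower) auto
    also have "\<dots> \<le> enat n" using m by simp
    finally show False using less by simp
  qed
next
  assume avoid: "\<forall>m\<le>n. X m \<noteq> k"
  have "enat (Suc n) \<le> hitting_time k X" unfolding hitting_time_def
  proof (rule Inf_greatest, safe)
    fix m assume "k = X m"
    then have "\<not> m \<le> n" using avoid by auto
    then show "enat (Suc n) \<le> enat m" by simp
  qed
  then show "hitting_time k X > enat n" by (rule less_le_trans[rotated]) simp
qed

lemma return_time_greater_iff: "return_time X > enat n \<longleftrightarrow> (\<forall>m\<in>{1..n}. X m \<noteq> 0)"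
proof
  assume less: "return_time X > enat n"
  show "\<forall>m\<in>{1..n}. X m \<noteq> 0"
  proof (intro ballI notI)
    fix m assume m: "m \<in> {1..n}" "X m = 0"
    then have "return_time X \<le> enat m" unfolding return_time_def by (intro Inf_lower) auto
    also have "\<dots> \<le> enat n" using m by simp
    finally show False using less by simp
  qed
next
  assume avoid: "\<forall>m\<in>{1..n}. X m \<noteq> 0"
  have "enat (Suc n) \<le> return_time X" unfolding return_time_def
  proof (rule Inf_greatest, safe)
    fix m assume "1 \<le> m" "X m = 0"
    then have "\<not> m \<le> n" using avoid by auto
    then show "enat (Suc n) \<le> enat m" by simp
  qed
  then show "return_time X > enat n" by (rule less_le_trans[rotated]) simp
qed

text \<open>
Until it hits \<open>0\<close> the walk started at \<open>1\<close> looks only at coins of positive sites.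
\<close>

lemma erw_cong_while_positive:
  assumes agree: "\<And>x i. x \<ge> 1 \<Longrightarrow> i \<ge> 1 \<Longrightarrow> \<eta> (x, i) = \<eta>' (x, i)"
    and avoid: "\<And>k. k < n \<Longrightarrow> erw 1 \<eta> k \<noteq> 0"
  shows "m \<le> n \<Longrightarrow> erw 1 \<eta> m = erw 1 \<eta>' m"
proof (induction m rule: less_induct)
  case (less m)
  show ?case
  proof (cases m)
    case (Suc k)
    have eq: "erw 1 \<eta> j = erw 1 \<eta>' j" if "j \<le> k" for j using less Suc that by simp
    then have c: "{j. j \<le> k \<and> erw 1 \<eta> j = erw 1 \<eta> k} = {j. j \<le> k \<and> erw 1 \<eta>' j = erw 1 \<eta>' k}"
      by auto
    have "erw 1 \<eta> k > 0" by (rule erw_positive) (use avoid less.prems Suc in simp)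
    moreover have "card {j. j \<le> k \<and> erw 1 \<eta> j = erw 1 \<eta> k} > 0"
      by (subst card_gt_0_iff) auto
    ultimately have "\<eta> (erw 1 \<eta> k, card {j. j \<le> k \<and> erw 1 \<eta> j = erw 1 \<eta> k})
        = \<eta>' (erw 1 \<eta> k, card {j. j \<le> k \<and> erw 1 \<eta> j = erw 1 \<eta> k})"
      by (intro agree) auto
    then show ?thesis unfolding Suc erw.simps c[symmetric] eq[OF order_refl] by simp
  qed simp
qed

lemma erw_avoid_cong:
  assumes agree: "\<And>x i. x \<ge> 1 \<Longrightarrow> i \<ge> 1 \<Longrightarrow> \<eta> (x, i) = \<eta>' (x, i)"
  shows "(\<forall>m\<le>n. erw 1 \<eta> m \<noteq> 0) \<longleftrightarrow> (\<forall>m\<le>n. erw 1 \<eta>' m \<noteq> 0)"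
proof -
  have *: "erw 1 \<zeta>' m \<noteq> 0"
    if ag: "\<And>x i. x \<ge> 1 \<Longrightarrow> i \<ge> 1 \<Longrightarrow> \<zeta> (x, i) = \<zeta>' (x, i)" and av: "\<forall>m\<le>n. erw 1 \<zeta> m \<noteq> 0" and m: "m \<le> n"
    for \<zeta> \<zeta>' m
  proof -
    have "erw 1 \<zeta> k \<noteq> 0" if "k < n" for k using av that by (simp del: erw.simps)
    from erw_cong_while_positive[of \<zeta> \<zeta>' n m, OF ag this m] show ?thesis using av m by metis
  qed
  show ?thesis
  proof
    assume "\<forall>m\<le>n. erw 1 \<eta> m \<noteq> 0"
    then show "\<forall>m\<le>n. erw 1 \<eta>' m \<noteq> 0" using *[of \<eta> \<eta>', OF agree] by blast
  next
    assume "\<forall>m\<le>n. erw 1 \<eta>' m \<noteq> 0"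
    then show "\<forall>m\<le>n. erw 1 \<eta> m \<noteq> 0" using *[of \<eta>' \<eta>, OF agree[symmetric]] by blast
  qed
qed

text \<open>
After a first step to the right no positive site has been used before, so up to its return to \<open>0\<close> the walk is the one started at
\<open>1\<close>, one time unit later.
\<close>

lemma erw_after_first_step:
  assumes first: "\<eta> (0, 1)" and avoid: "\<And>k. k < n \<Longrightarrow> erw 1 \<eta> k \<noteq> 0"
  shows "m \<le> n \<Longrightarrow> erw 0 \<eta> (Suc m) = erw 1 \<eta> m"
proof (induction m rule: less_induct)
  case (less m)
  show ?case
  proof (cases m)
    case 0
    have "{k. k \<le> 0 \<and> erw 0 \<eta> k = erw 0 \<eta> 0} = {0}" by auto
    then have "card {k. k \<le> 0 \<and> erw 0 \<eta> k = erw 0 \<eta> 0} = 1" by simp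
    then show ?thesis unfolding 0 erw.simps(2)[of 0 \<eta> 0] using first by simp
  next
    case (Suc k)
    have eq: "erw 0 \<eta> (Suc j) = erw 1 \<eta> j" if "j \<le> k" for j using less Suc that by simp
    have pos: "erw 1 \<eta> k > 0" by (rule erw_positive) (use avoid less.prems Suc in simp)
    have "{j. j \<le> Suc k \<and> erw 0 \<eta> j = erw 0 \<eta> (Suc k)} = Suc ` {j. j \<le> k \<and> erw 1 \<eta> j = erw 1 \<eta> k}"
    proof (rule set_eqI)
      fix j
      show "j \<in> {j. j \<le> Suc k \<and> erw 0 \<eta> j = erw 0 \<eta> (Suc k)} \<longleftrightarrow> j \<in> Suc ` {j. j \<le> k \<and> erw 1 \<eta> j = erw 1 \<eta> k}"
      proof (cases j)
        case 0
        then show ?thesis using eq[of k] pos by (auto simp del: erw.simps(2))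
      next
        case (Suc i)
        then show ?thesis using eq[of k] eq[of i] by (auto simp del: erw.simps(2))
      qed
    qed
    then have c: "card {j. j \<le> Suc k \<and> erw 0 \<eta> j = erw 0 \<eta> (Suc k)} = card {j. j \<le> k \<and> erw 1 \<eta> j = erw 1 \<eta> k}"
      by (simp add: card_image)
    show ?thesis
      unfolding Suc erw.simps(2)[of 1] erw.simps(2)[of 0 \<eta> "Suc k"] c unfolding eq[OF order_refl] by simp
  qed
qed

lemma return_avoid_iff:
  assumes "\<eta> (0, 1)"
  shows "(\<forall>m\<in>{1..Suc n}. erw 0 \<eta> m \<noteq> 0) \<longleftrightarrow> (\<forall>m\<le>n. erw 1 \<eta> m \<noteq> 0)"
proof
  assume "\<forall>m\<le>n. erw 1 \<eta> m \<noteq> 0"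
  then have eq: "erw 0 \<eta> (Suc m) = erw 1 \<eta> m" if "m \<le> n" for m
    using erw_after_first_step[of \<eta> n m, OF assms] that by simp
  show "\<forall>m\<in>{1..Suc n}. erw 0 \<eta> m \<noteq> 0"
  proof
    fix m assume m: "m \<in> {1..Suc n}"
    then have "erw 0 \<eta> (Suc (m - 1)) = erw 1 \<eta> (m - 1)" by (intro eq) auto
    moreover have "Suc (m - 1) = m" "m - 1 \<le> n" using m by auto
    ultimately show "erw 0 \<eta> m \<noteq> 0" using \<open>\<forall>m\<le>n. erw 1 \<eta> m \<noteq> 0\<close> by metis
  qed
next
  assume *: "\<forall>m\<in>{1..Suc n}. erw 0 \<eta> m \<noteq> 0"
  have "m \<le> n \<Longrightarrow> erw 1 \<eta> m \<noteq> 0" for m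
  proof (induction m rule: less_induct)
    case (less m)
    then have "erw 0 \<eta> (Suc m) = erw 1 \<eta> m"
      using erw_after_first_step[of \<eta> m m, OF assms] by simp
    moreover have "erw 0 \<eta> (Suc m) \<noteq> 0" using * less.prems by (auto simp del: erw.simps)
    ultimately show ?case by simp
  qed
  then show "\<forall>m\<le>n. erw 1 \<eta> m \<noteq> 0" by blast
qed

definition mirror :: "(int \<times> nat \<Rightarrow> bool) \<Rightarrow> int \<times> nat \<Rightarrow> bool" where
  "mirror \<eta> = (\<lambda>k\<in>cookies. \<not> \<eta> (- fst k, snd k))"

lemma erw_mirror: "erw 0 (mirror \<eta>) n = - erw 0 \<eta> n"
proof (induction n rule: less_induct)
  case (less n)
  show ?case
  proof (cases n)
    case (Suc k)
    have eq: "erw 0 (mirror \<eta>) j = - erw 0 \<eta> j" if "j \<le> k" for j using less Suc that by simp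
    then have c: "{j. j \<le> k \<and> erw 0 (mirror \<eta>) j = erw 0 (mirror \<eta>) k} = {j. j \<le> k \<and> erw 0 \<eta> j = erw 0 \<eta> k}"
      by auto
    have "card {j. j \<le> k \<and> erw 0 \<eta> j = erw 0 \<eta> k} > 0"
      by (subst card_gt_0_iff) auto
    then have "mirror \<eta> (- erw 0 \<eta> k, card {j. j \<le> k \<and> erw 0 \<eta> j = erw 0 \<eta> k})
        = (\<not> \<eta> (erw 0 \<eta> k, card {j. j \<le> k \<and> erw 0 \<eta> j = erw 0 \<eta> k}))"
      by (auto simp: mirror_def)
    then show ?thesis unfolding Suc erw.simps c unfolding eq[OF order_refl] by (simp add: of_bool_def)
  qed simp
qed

context cookie_environment
begin

sublocale Q: prob_space "coin_law P" by (rule prob_space_coin_law)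

lemma measurable_coin_law: "f \<in> measurable coin_space N \<Longrightarrow> f \<in> measurable (coin_law P) N"
  by (simp add: measurable_cong_sets[OF sets_coin_law refl])

lemma infinite_tails_law: "AE \<eta> in coin_law P. \<forall>x. infinite {m. \<not> \<eta> (x, m)}"
proof -
  have "AE \<eta> in coin_law P. infinite {m. \<not> \<eta> (x, m)}" for x
  proof -
    define B where "B = {c \<in> space coin_stack_space. \<forall>n. \<exists>m. \<not> c (Suc (n + m))}"
    have comp: "Measurable.pred coin_stack_space (\<lambda>c. c (Suc m))" for m
      using measurable_component_singleton[of "Suc m" "{1..}" "\<lambda>_. count_space UNIV"] by simp
    have "Measurable.pred coin_stack_space (\<lambda>c. \<forall>n. \<exists>m. \<not> c (Suc (n + m)))"
      by (intro pred_intros_countable pred_intros_logic comp)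
    then have B: "B \<in> sets coin_stack_space" unfolding B_def by (simp only: pred_def)
    have inf: "infinite {m. \<not> c m} \<longleftrightarrow> (\<forall>n. \<exists>m. \<not> c (Suc (n + m)))" for c :: "nat \<Rightarrow> bool"
      unfolding infinite_nat_iff_unbounded mem_Collect_eq
      by (intro iff_allI) (metis less_iff_Suc_add)
    have "Q.prob (coin_stack x -` B \<inter> space coin_space) = (\<integral>\<omega>. measure (stack_coins (stack x \<omega>)) B \<partial>P)"
      by (rule measure_coin_stack[OF B])
    also have "\<dots> = (\<integral>\<omega>. 1 \<partial>P)"
    proof (rule integral_cong_AE)
      show "AE \<omega> in P. measure (stack_coins (stack x \<omega>)) B = 1"
        using fair_AE
      proof eventually_elim
        case (elim \<omega>)
        interpret S: prob_space "stack_coins (stack x \<omega>)" by (rule prob_space_stack_coins)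
        have "AE c in stack_coins (stack x \<omega>). infinite {m. \<not> c m}"
          by (rule infinite_tails_AE[of M]) (use elim in auto)
        then have "AE c in stack_coins (stack x \<omega>). c \<in> B"
          using AE_space
        proof eventually_elim
          case (elim c)
          then show ?case using sets_eq_imp_space_eq[OF sets_stack_coins[of "stack x \<omega>"]] by (simp add: B_def inf)
        qed
        then show "S.prob B = 1" using B by (subst S.prob_eq_1) (simp_all add: sets_stack_coins)
      qed
    qed (use borel_measurable_integrable[OF integrable_measure_stack_coins[OF B]] in auto)
    also have "\<dots> = 1" by (simp add: prob_space)
    finally have p1: "Q.prob (coin_stack x -` B \<inter> space coin_space) = 1" .
    have "coin_stack x -` B \<inter> space coin_space \<in> Q.events"
      using measurable_sets[OF measurable_coin_stack B] by (simp add: sets_coin_law)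
    then have "AE \<eta> in coin_law P. \<eta> \<in> coin_stack x -` B \<inter> space coin_space"
      using p1 by (simp only: Q.prob_eq_1)
    then show ?thesis
    proof eventually_elim
      case (elim \<eta>)
      then have "\<forall>n. \<exists>m. \<not> coin_stack x \<eta> (Suc (n + m))" by (simp add: B_def)
      then show ?case unfolding inf by (simp add: coin_stack_def)
    qed
  qed
  then show ?thesis by (subst AE_all_countable) blast
qed

lemma measurable_branching_coin: "(\<lambda>\<eta>. branching \<eta> x) \<in> measurable (coin_law P) (count_space UNIV)"
  by (rule measurable_branching) (rule measurable_coin_law[OF measurable_coin_stack])

lemma indep_stacks_prob:
  assumes "A \<inter> B = {}" and E: "E \<in> sets (PiM A (\<lambda>_. coin_stack_space))" and F: "F \<in> sets (PiM B (\<lambda>_. coin_stack_space))"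
  shows "Q.prob {\<eta> \<in> space coin_space. restrict (\<lambda>x. coin_stack x \<eta>) A \<in> E \<and> restrict (\<lambda>x. coin_stack x \<eta>) B \<in> F}
    = Q.prob {\<eta> \<in> space coin_space. restrict (\<lambda>x. coin_stack x \<eta>) A \<in> E} * Q.prob {\<eta> \<in> space coin_space. restrict (\<lambda>x. coin_stack x \<eta>) B \<in> F}"
proof -
  have ind: "Q.indep_var (PiM A (\<lambda>_. coin_stack_space)) (\<lambda>\<eta>. restrict (\<lambda>x. coin_stack x \<eta>) A)
     (PiM B (\<lambda>_. coin_stack_space)) (\<lambda>\<eta>. restrict (\<lambda>x. coin_stack x \<eta>) B)"
    by (rule Q.indep_var_restrict[OF indep_coin_stacks]) (use assms in auto)
  have e1: "(\<lambda>\<eta>. (restrict (\<lambda>x. coin_stack x \<eta>) A, restrict (\<lambda>x. coin_stack x \<eta>) B)) -` (E \<times> F) \<inter> space (coin_law P)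
     = {\<eta> \<in> space coin_space. restrict (\<lambda>x. coin_stack x \<eta>) A \<in> E \<and> restrict (\<lambda>x. coin_stack x \<eta>) B \<in> F}"
    unfolding space_coin_law by (rule set_eqI) (simp only: Int_iff vimage_eq mem_Times_iff fst_conv snd_conv mem_Collect_eq conj_commute)
  have e2: "(\<lambda>\<eta>. restrict (\<lambda>x. coin_stack x \<eta>) A) -` E \<inter> space (coin_law P) = {\<eta> \<in> space coin_space. restrict (\<lambda>x. coin_stack x \<eta>) A \<in> E}" for A E
    unfolding space_coin_law by (rule set_eqI) (simp only: Int_iff vimage_eq mem_Collect_eq conj_commute)
  show ?thesis using Q.indep_varD[OF ind E F] unfolding e1 e2 .
qed

text \<open>
The number of crossings from \<open>x\<close> depends on the coins at \<open>1, \<dots>, x\<close> only, and the next number is a function of it and of the coins at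
\<open>x + 1\<close>.
\<close>

lemma branching_law: "Q.prob {\<eta> \<in> space coin_space. branching \<eta> x = j} = pmf (crossings x) j"
proof (induction x arbitrary: j)
  case 0
  show ?case using Q.prob_space by (cases "j = 1") (auto simp: space_coin_law)
next
  case (Suc x)
  let ?y = "int (Suc x)"
  define F where "F = (\<lambda>k. {\<eta> \<in> space coin_space. branching \<eta> x = k \<and> heads_before 1 (coin_stack ?y \<eta>) k = j})"
  have hb: "heads_before 1 (coin_stack y \<eta>) k = heads_before 1 (\<lambda>m. \<eta> (y, m)) k" for y \<eta> k
    by (rule heads_before_cong) (auto simp: coin_stack_def)
  have F: "Q.prob (F k) = pmf (crossings x) k * pmf (kernel k) j" for k
  proof -
    define ext :: "(int \<Rightarrow> nat \<Rightarrow> bool) \<Rightarrow> int \<times> nat \<Rightarrow> bool" where "ext = (\<lambda>s p. s (fst p) (snd p))"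
    let ?NA = "PiM {1..int x} (\<lambda>_. coin_stack_space)" and ?NB = "PiM {?y} (\<lambda>_. coin_stack_space)"
    define E where "E = {s \<in> space ?NA. branching (ext s) x = k}"
    define G where "G = {s \<in> space ?NB. heads_before 1 (s ?y) k = j}"
    have bm: "(\<lambda>s. branching (ext s) x) \<in> measurable ?NA (count_space UNIV)"
    proof (rule measurable_branching)
      fix y assume y: "1 \<le> y" "y \<le> int x"
      have "(\<lambda>s. s y) \<in> measurable ?NA coin_stack_space"
        using y by (intro measurable_component_singleton) auto
      note sy = this
      have "(\<lambda>s. \<lambda>i\<in>{1..}. s y i) \<in> measurable ?NA coin_stack_space"
      proof (rule measurable_restrict)
        fix i :: nat assume "i \<in> {1..}"
        then show "(\<lambda>s. s y i) \<in> measurable ?NA (count_space UNIV)"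
          by (rule measurable_compose[where f = "\<lambda>s. s y" and g = "\<lambda>c. c i" and N = coin_stack_space, OF sy measurable_component_singleton])
      qed
      then show "(\<lambda>s. coin_stack y (ext s)) \<in> measurable ?NA coin_stack_space"
        by (simp add: coin_stack_def ext_def)
    qed
    have E: "E \<in> sets ?NA"
    proof -
      have "E = (\<lambda>s. branching (ext s) x) -` {k} \<inter> space ?NA" by (auto simp: E_def)
      then show ?thesis using measurable_sets[OF bm, of "{k}"] by simp
    qed
    have G: "G \<in> sets ?NB"
    proof -
      have "(\<lambda>s. heads_before 1 (s ?y) k) \<in> measurable ?NB (count_space UNIV)"
        by (rule measurable_compose[where f = "\<lambda>s. s ?y" and N = coin_stack_space and g = "\<lambda>c. heads_before 1 c k"])
          (auto intro!: measurable_component_singleton measurable_heads_before)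
      from measurable_sets[OF this, of "{j}"]
      have "(\<lambda>s. heads_before 1 (s ?y) k) -` {j} \<inter> space ?NB \<in> sets ?NB" by simp
      moreover have "G = (\<lambda>s. heads_before 1 (s ?y) k) -` {j} \<inter> space ?NB" by (auto simp: G_def)
      ultimately show ?thesis by simp
    qed
    have br: "branching (ext (restrict (\<lambda>y. coin_stack y \<eta>) {1..int x})) x' = branching \<eta> x'" if "x' \<le> x" for x' \<eta>
      using that
    proof (induction x')
      case (Suc x')
      have h: "heads_before 1 (\<lambda>m. ext (restrict (\<lambda>y. coin_stack y \<eta>) {1..int x}) (int (Suc x'), m)) k
          = heads_before 1 (\<lambda>m. \<eta> (int (Suc x'), m)) k" for k
        by (rule heads_before_cong) (use Suc.prems in \<open>auto simp: ext_def coin_stack_def\<close>)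
      have IH: "branching (ext (restrict (\<lambda>y. coin_stack y \<eta>) {1..int x})) x' = branching \<eta> x'"
        by (rule Suc.IH) (use Suc.prems in simp)
      show ?case unfolding branching.simps h IH ..
    qed simp
    have sp: "restrict (\<lambda>y. coin_stack y \<eta>) A \<in> space (PiM A (\<lambda>_. coin_stack_space))" for \<eta> A
      by (auto simp: space_PiM coin_stack_def)
    have Ei: "restrict (\<lambda>y. coin_stack y \<eta>) {1..int x} \<in> E \<longleftrightarrow> branching \<eta> x = k" for \<eta>
      using sp[of \<eta> "{1..int x}"] br[of x \<eta>] by (simp add: E_def)
    have Gi: "restrict (\<lambda>y. coin_stack y \<eta>) {?y} \<in> G \<longleftrightarrow> heads_before 1 (coin_stack ?y \<eta>) k = j" for \<eta>
      using sp[of \<eta> "{?y}"] by (simp add: G_def)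
    have "{1..int x} \<inter> {?y} = {}" by auto
    from indep_stacks_prob[OF this E G]
    have "Q.prob (F k) = Q.prob {\<eta> \<in> space coin_space. branching \<eta> x = k} * Q.prob {\<eta> \<in> space coin_space. heads_before 1 (coin_stack ?y \<eta>) k = j}"
      unfolding Ei Gi F_def .
    also have "Q.prob {\<eta> \<in> space coin_space. heads_before 1 (coin_stack ?y \<eta>) k = j} = pmf (kernel k) j"
    proof -
      have s: "{c \<in> space coin_stack_space. heads_before 1 c k = j} \<in> sets coin_stack_space"
        using sets_coin_stackI[OF measurable_heads_before[of 1 "{1..}" k], of "{j}"] by simp
      have "coin_stack ?y -` {c \<in> space coin_stack_space. heads_before 1 c k = j} \<inter> space coin_space
          = {\<eta> \<in> space coin_space. heads_before 1 (coin_stack ?y \<eta>) k = j}"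
        using measurable_space[OF measurable_coin_stack[of ?y]] by blast
      then show ?thesis
        using measure_coin_stack_law[OF s, of ?y] stack_coin_law_crossings[of k j] by simp
    qed
    finally show ?thesis using Suc.IH by simp
  qed
  have Fs: "F k \<in> Q.events" for k
  proof -
    have "(\<lambda>\<eta>. heads_before 1 (coin_stack ?y \<eta>) k) \<in> measurable (coin_law P) (count_space UNIV)"
      by (rule measurable_compose[OF measurable_coin_law[OF measurable_coin_stack] measurable_heads_before]) simp
    note hm = this
    have "((\<lambda>\<eta>. branching \<eta> x) -` {k} \<inter> space (coin_law P)) \<inter> ((\<lambda>\<eta>. heads_before 1 (coin_stack ?y \<eta>) k) -` {j} \<inter> space (coin_law P)) \<in> Q.events"
      by (rule sets.Int[OF measurable_sets[OF measurable_branching_coin] measurable_sets[OF hm]]) simp_all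
    moreover have "F k = ((\<lambda>\<eta>. branching \<eta> x) -` {k} \<inter> space (coin_law P)) \<inter> ((\<lambda>\<eta>. heads_before 1 (coin_stack ?y \<eta>) k) -` {j} \<inter> space (coin_law P))"
      by (auto simp: F_def space_coin_law)
    ultimately show ?thesis by simp
  qed
  have "{\<eta> \<in> space coin_space. branching \<eta> (Suc x) = j} = (\<Union>k. F k)"
    by (auto simp: F_def hb)
  then have "emeasure (coin_law P) {\<eta> \<in> space coin_space. branching \<eta> (Suc x) = j} = (\<Sum>k. emeasure (coin_law P) (F k))"
    using Fs by (simp only:, intro suminf_emeasure[symmetric]) (auto simp: disjoint_family_on_def F_def)
  also have "\<dots> = (\<Sum>k. ennreal (pmf (crossings x) k) * ennreal (pmf (kernel k) j))"
    by (simp add: Q.emeasure_eq_measure F ennreal_mult)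
  also have "\<dots> = (\<integral>\<^sup>+k. ennreal (pmf (kernel k) j) \<partial>measure_pmf (crossings x))"
    by (simp add: nn_integral_measure_pmf nn_integral_count_space_nat)
  also have "\<dots> = ennreal (pmf (crossings (Suc x)) j)"
    unfolding crossings.simps by (rule ennreal_pmf_bind[symmetric])
  finally show ?case by (simp add: Q.emeasure_eq_measure)
qed

lemma distr_branching: "distr (coin_law P) (count_space UNIV) (\<lambda>\<eta>. branching \<eta> x) = measure_pmf (crossings x)"
proof (rule measure_eqI_countable)
  fix j :: nat
  have "(\<lambda>\<eta>. branching \<eta> x) -` {j} \<inter> space (coin_law P) = {\<eta> \<in> space coin_space. branching \<eta> x = j}"
    by (auto simp: space_coin_law)
  then show "emeasure (distr (coin_law P) (count_space UNIV) (\<lambda>\<eta>. branching \<eta> x)) {j} = emeasure (measure_pmf (crossings x)) {j}"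
    using branching_law[of x j]
    by (simp add: emeasure_distr[OF measurable_branching_coin] Q.emeasure_eq_measure emeasure_pmf_single)
qed auto

lemma prob_branching: "Q.prob {\<eta> \<in> space coin_space. branching \<eta> x \<in> A} = measure_pmf.prob (crossings x) A"
proof -
  have "(\<lambda>\<eta>. branching \<eta> x) -` A \<inter> space (coin_law P) = {\<eta> \<in> space coin_space. branching \<eta> x \<in> A}"
    by (auto simp: space_coin_law)
  then show ?thesis unfolding distr_branching[symmetric]
    by (subst measure_distr[OF measurable_branching_coin]) auto
qed

lemma branching_expectation:
  "integrable (coin_law P) (\<lambda>\<eta>. real (branching \<eta> x))"
  "Q.expectation (\<lambda>\<eta>. real (branching \<eta> x)) \<le> 1 + real M * real x"
proof -
  show "integrable (coin_law P) (\<lambda>\<eta>. real (branching \<eta> x))"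
    using crossings_mean(1)[of x] unfolding distr_branching[symmetric]
    by (subst (asm) integrable_distr_eq[OF measurable_branching_coin]) auto
  have "Q.expectation (\<lambda>\<eta>. real (branching \<eta> x)) = mean (crossings x) real"
    unfolding distr_branching[symmetric] by (subst integral_distr[OF measurable_branching_coin]) auto
  then show "Q.expectation (\<lambda>\<eta>. real (branching \<eta> x)) \<le> 1 + real M * real x"
    using crossings_mean(2)[of x] by simp
qed

end

section \<open>Height and duration of a right excursion\<close>

lemma pred_hitting_time_less: "Measurable.pred path_space (\<lambda>X. hitting_time a X < hitting_time b X)"
proof -
  have "(\<lambda>X. (hitting_time a X, hitting_time b X)) \<in> measurable path_space (count_space UNIV \<Otimes>\<^sub>M count_space UNIV)"
    by (intro measurable_Pair measurable_hitting_time)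
  from measurable_compose[OF this, of "\<lambda>(a, b). a < b" "count_space UNIV"]
  show ?thesis by (simp add: pair_measure_countable)
qed

lemma pred_hitting_time_greater: "Measurable.pred path_space (\<lambda>X. hitting_time a X > t)"
  by (rule measurable_compose[OF measurable_hitting_time, where g = "\<lambda>x. x > t"]) simp

lemma pred_return_time_greater: "Measurable.pred path_space (\<lambda>X. return_time X > t)"
  by (rule measurable_compose[OF measurable_return_time, where g = "\<lambda>x. x > t"]) simp

lemma sets_erw_event:
  assumes "Measurable.pred path_space A"
  shows "{\<eta> \<in> space coin_space. A (erw x \<eta>)} \<in> sets coin_space"
proof -
  have "Measurable.pred coin_space (\<lambda>\<eta>. A (erw x \<eta>))"
    by (rule measurable_compose[OF measurable_erw assms])
  then show ?thesis by (simp only: pred_def)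
qed

context cookie_environment
begin

lemma excursion_AE: "AE \<eta> in coin_law P. excursion \<eta>"
  using infinite_tails_law by eventually_elim (auto simp: excursion_def)

lemma sets_branching: "{\<eta> \<in> space coin_space. branching \<eta> x \<in> A} \<in> Q.events"
proof -
  have "{\<eta> \<in> space coin_space. branching \<eta> x \<in> A} = (\<lambda>\<eta>. branching \<eta> x) -` A \<inter> space (coin_law P)"
    by (auto simp: space_coin_law)
  then show ?thesis using measurable_sets[OF measurable_branching_coin, of A x] by simp
qed

theorem prob_reach:
  assumes "n \<ge> 1"
  shows "averaged_prob P 1 (\<lambda>X. hitting_time (int n) X < hitting_time 0 X) = survival (n - 1)"
proof -
  have "Q.prob {\<eta> \<in> space coin_space. hitting_time (int n) (erw 1 \<eta>) < hitting_time 0 (erw 1 \<eta>)}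
      = Q.prob {\<eta> \<in> space coin_space. branching \<eta> (n - 1) \<in> {1..}}"
  proof (rule Q.finite_measure_eq_AE)
    show "AE \<eta> in coin_law P. \<eta> \<in> {\<eta> \<in> space coin_space. hitting_time (int n) (erw 1 \<eta>) < hitting_time 0 (erw 1 \<eta>)}
        \<longleftrightarrow> \<eta> \<in> {\<eta> \<in> space coin_space. branching \<eta> (n - 1) \<in> {1..}}"
      using excursion_AE
    proof eventually_elim
      case (elim \<eta>)
      show ?case using excursion.reaches_iff_branching_survives[OF elim assms] by auto
    qed
    show "{\<eta> \<in> space coin_space. hitting_time (int n) (erw 1 \<eta>) < hitting_time 0 (erw 1 \<eta>)} \<in> Q.events"
      unfolding sets_coin_law by (rule sets_erw_event[OF pred_hitting_time_less])
  qed (rule sets_branching)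
  then show ?thesis
    unfolding averaged_prob_eq[OF pred_hitting_time_less] prob_branching survival_def .
qed

definition lifetime :: "nat \<Rightarrow> real" where
  "lifetime n = averaged_prob P 1 (\<lambda>X. hitting_time 0 X > enat n)"

lemma lifetime_eq: "lifetime n = Q.prob {\<eta> \<in> space coin_space. hitting_time 0 (erw 1 \<eta>) > enat n}"
  unfolding lifetime_def by (rule averaged_prob_eq[OF pred_hitting_time_greater])

lemma sets_lifetime: "{\<eta> \<in> space coin_space. hitting_time 0 (erw 1 \<eta>) > enat n} \<in> Q.events"
  unfolding sets_coin_law by (rule sets_erw_event[OF pred_hitting_time_greater])

text \<open>
An excursion that does not reach above \<open>N\<close> lasts at most \<open>1 + 2 (Z 1 + \<dots> + Z N)\<close> steps, and Markov's inequality bounds the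
probability that this exceeds \<open>n\<close>.
\<close>

lemma lifetime_upper:
  assumes n: "n \<ge> 1"
  shows "lifetime n \<le> survival N + (1 + 2 * real N * (1 + real M * real N)) / real n"
proof -
  define U where "U = (\<lambda>\<eta>. 1 + 2 * (\<Sum>x=1..N. real (branching \<eta> x)))"
  have Ui: "integrable (coin_law P) U" unfolding U_def using branching_expectation(1) by simp
  have EU: "Q.expectation U \<le> 1 + 2 * real N * (1 + real M * real N)"
  proof -
    have "Q.expectation U = 1 + 2 * (\<Sum>x=1..N. Q.expectation (\<lambda>\<eta>. real (branching \<eta> x)))"
      unfolding U_def using branching_expectation(1) Q.prob_space by simp
    also have "(\<Sum>x=1..N. Q.expectation (\<lambda>\<eta>. real (branching \<eta> x))) \<le> (\<Sum>x=1..N. 1 + real M * real N)"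
      using branching_expectation(2) by (intro sum_mono) (smt (verit) atLeastAtMost_iff mult_left_mono of_nat_0_le_iff of_nat_le_iff)
    finally show ?thesis by (simp add: algebra_simps)
  qed
  have Us: "{\<eta> \<in> space (coin_law P). U \<eta> \<ge> real n} \<in> Q.events"
    using borel_measurable_integrable[OF Ui] by simp
  have "Q.prob {\<eta> \<in> space coin_space. hitting_time 0 (erw 1 \<eta>) > enat n}
      \<le> Q.prob ({\<eta> \<in> space coin_space. branching \<eta> N \<in> {1..}} \<union> {\<eta> \<in> space (coin_law P). U \<eta> \<ge> real n})"
  proof (rule Q.finite_measure_mono_AE)
    show "AE \<eta> in coin_law P. \<eta> \<in> {\<eta> \<in> space coin_space. hitting_time 0 (erw 1 \<eta>) > enat n}
        \<longrightarrow> \<eta> \<in> {\<eta> \<in> space coin_space. branching \<eta> N \<in> {1..}} \<union> {\<eta> \<in> space (coin_law P). U \<eta> \<ge> real n}"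
      using excursion_AE
    proof eventually_elim
      case (elim \<eta>)
      show ?case
      proof (intro impI, elim CollectE conjE)
        assume s: "\<eta> \<in> space coin_space" and h: "hitting_time 0 (erw 1 \<eta>) > enat n"
        show "\<eta> \<in> {\<eta> \<in> space coin_space. branching \<eta> N \<in> {1..}} \<union> {\<eta> \<in> space (coin_law P). U \<eta> \<ge> real n}"
        proof (cases "branching \<eta> N = 0")
          case True
          have "enat n < enat (1 + 2 * (\<Sum>x=1..N. branching \<eta> x))"
            using h excursion.hitting_time_0_le[OF elim True] by (rule less_le_trans)
          then have "real n \<le> real (1 + 2 * (\<Sum>x=1..N. branching \<eta> x))" by (simp only: enat_ord_simps of_nat_le_iff less_imp_le)
          then have "real n \<le> U \<eta>" by (simp add: U_def)
          then show ?thesis using s by (simp add: space_coin_law)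
        qed (use s in auto)
      qed
    qed
  qed (intro sets.Un sets_branching Us)
  also have "\<dots> \<le> Q.prob {\<eta> \<in> space coin_space. branching \<eta> N \<in> {1..}} + Q.prob {\<eta> \<in> space (coin_law P). U \<eta> \<ge> real n}"
    by (intro measure_Un_le sets_branching Us)
  also have "Q.prob {\<eta> \<in> space (coin_law P). U \<eta> \<ge> real n} \<le> Q.expectation U / real n"
    by (rule integral_Markov_inequality_measure[OF Ui, of "{}"]) (use n in \<open>auto simp: U_def intro!: AE_I2 add_nonneg_nonneg sum_nonneg\<close>)
  also have "\<dots> \<le> (1 + 2 * real N * (1 + real M * real N)) / real n"
    using EU by (intro divide_right_mono) auto
  finally show ?thesis unfolding lifetime_eq prob_branching survival_def by simp
qed

lemma branching_positive_before:
  assumes "branching \<eta> n > 0" "m \<le> n"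
  shows "branching \<eta> m > 0"
  using assms(2,1)
proof (induction rule: dec_induct)
  case (step n)
  show ?case
  proof (rule ccontr)
    assume "\<not> 0 < branching \<eta> m"
    then have "branching \<eta> n = 0" using step by auto
    then show False using step.prems by simp
  qed
qed

text \<open>
If \<open>Z\<close> survives up to \<open>2 N\<close> and exceeds \<open>a\<close> at more than half of the sites in \<open>{N..<2 N}\<close>, then the excursion has more than
\<open>N a / 2\<close> up steps. The exceptional event, where \<open>Z\<close> lies in \<open>{1..a}\<close> at half of these sites, is controlled by Markov's inequality.
\<close>

lemma lifetime_lower:
  assumes N: "N \<ge> 1" and n: "real n \<le> real N * a / 2"
  shows "survival (2 * N) - (2 / real N) * (\<Sum>x<2*N. measure_pmf.prob (crossings x) {k. k \<ge> 1 \<and> real k \<le> a}) \<le> lifetime n"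
proof -
  define S where "S = (\<lambda>x. {\<eta> \<in> space coin_space. branching \<eta> x \<in> {k. k \<ge> 1 \<and> real k \<le> a}})"
  define V where "V = (\<lambda>\<eta>. \<Sum>x=N..<2*N. indicator (S x) \<eta> :: real)"
  have Ss: "S x \<in> Q.events" for x unfolding S_def by (rule sets_branching)
  have Vi: "integrable (coin_law P) V" unfolding V_def using Ss by (auto simp: Q.emeasure_eq_measure)
  have Vs: "{\<eta> \<in> space (coin_law P). V \<eta> \<ge> real N / 2} \<in> Q.events"
    using borel_measurable_integrable[OF Vi] by simp
  have a: "a \<ge> 0" using n N by (smt (verit) divide_less_0_iff mult_pos_neg of_nat_0_le_iff of_nat_0_less_iff zero_less_one less_le_trans)
  have "Q.prob {\<eta> \<in> space coin_space. branching \<eta> (2 * N) \<in> {1..}}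
      \<le> Q.prob ({\<eta> \<in> space coin_space. hitting_time 0 (erw 1 \<eta>) > enat n} \<union> {\<eta> \<in> space (coin_law P). V \<eta> \<ge> real N / 2})"
  proof (rule Q.finite_measure_mono_AE)
    show "AE \<eta> in coin_law P. \<eta> \<in> {\<eta> \<in> space coin_space. branching \<eta> (2 * N) \<in> {1..}} \<longrightarrow>
        \<eta> \<in> {\<eta> \<in> space coin_space. hitting_time 0 (erw 1 \<eta>) > enat n} \<union> {\<eta> \<in> space (coin_law P). V \<eta> \<ge> real N / 2}"
      using excursion_AE
    proof eventually_elim
      case (elim \<eta>)
      show ?case
      proof (intro impI, elim CollectE conjE)
        assume s: "\<eta> \<in> space coin_space" and alive: "branching \<eta> (2 * N) \<in> {1..}"
        have pos: "branching \<eta> x \<ge> 1" if "x \<le> 2 * N" for x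
          using branching_positive_before[of \<eta> "2 * N" x] alive that by simp
        show "\<eta> \<in> {\<eta> \<in> space coin_space. hitting_time 0 (erw 1 \<eta>) > enat n} \<union> {\<eta> \<in> space (coin_law P). V \<eta> \<ge> real N / 2}"
        proof (cases "V \<eta> \<ge> real N / 2")
          case False
          define B where "B = {x \<in> {N..<2*N}. real (branching \<eta> x) > a}"
          have "V \<eta> = (\<Sum>x=N..<2*N. 1 - (if real (branching \<eta> x) > a then 1 else 0))"
            unfolding V_def using s pos by (intro sum.cong refl) (auto simp: S_def indicator_def)
          also have "\<dots> = real N - real (card B)"
            unfolding B_def sum_subtractf by (simp flip: sum.inter_filter)
          finally have B: "real (card B) > real N / 2" using False by simp
          then have B0: "B \<noteq> {}" by auto
          have fin: "finite B" by (simp add: B_def)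
          have "real n \<le> real N / 2 * a" using n by simp
          also have "\<dots> \<le> real (card B) * a" using B a by (intro mult_right_mono) auto
          also have "\<dots> = (\<Sum>x\<in>B. a)" by simp
          also have "\<dots> < (\<Sum>x\<in>B. real (branching \<eta> x))"
            using B0 fin by (intro sum_strict_mono) (auto simp: B_def)
          also have "\<dots> \<le> (\<Sum>x=1..2*N. real (branching \<eta> x))"
            using N by (intro sum_mono2) (auto simp: B_def)
          finally have "n < (\<Sum>x=1..2*N. branching \<eta> x)"
            unfolding of_nat_sum[symmetric] by (simp only: of_nat_less_iff)
          then have "enat n < enat (\<Sum>x=1..2*N. branching \<eta> x)" by simp
          also have "\<dots> \<le> hitting_time 0 (erw 1 \<eta>)" by (rule excursion.hitting_time_0_ge[OF elim])
          finally show ?thesis using s by simp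
        qed (use s in \<open>simp add: space_coin_law\<close>)
      qed
    qed
  qed (intro sets.Un sets_lifetime Vs)
  also have "\<dots> \<le> lifetime n + Q.prob {\<eta> \<in> space (coin_law P). V \<eta> \<ge> real N / 2}"
    unfolding lifetime_eq by (intro measure_Un_le sets_lifetime Vs)
  also have "Q.prob {\<eta> \<in> space (coin_law P). V \<eta> \<ge> real N / 2} \<le> Q.expectation V / (real N / 2)"
    by (rule integral_Markov_inequality_measure[OF Vi, of "{}"]) (use N in \<open>auto simp: V_def intro!: AE_I2 sum_nonneg\<close>)
  also have "Q.expectation V = (\<Sum>x=N..<2*N. Q.prob (S x))"
    unfolding V_def using Ss by (subst Bochner_Integration.integral_sum) (auto simp: Q.emeasure_eq_measure)
  also have "\<dots> / (real N / 2) = (2 / real N) * (\<Sum>x=N..<2*N. Q.prob (S x))" by simp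
  also have "\<dots> \<le> (2 / real N) * (\<Sum>x<2*N. Q.prob (S x))"
    by (intro mult_left_mono sum_mono2) auto
  finally show ?thesis unfolding S_def prob_branching survival_def by simp
qed

lemma lifetime_nonneg: "lifetime n \<ge> 0"
  unfolding lifetime_eq by simp

lemma prob_first_coin: "Q.prob {\<eta> \<in> space coin_space. \<eta> (0, 1)} = (\<integral>\<omega>. \<omega> (0, 1) \<partial>P)"
proof -
  have s: "{c \<in> space coin_stack_space. c 1} \<in> sets coin_stack_space"
    using sets_coin_stackI[OF measurable_component_singleton[of 1 "{1..}" "\<lambda>_. count_space UNIV"], of "{True}"] by simp
  have "coin_stack 0 -` {c \<in> space coin_stack_space. c 1} \<inter> space coin_space = {\<eta> \<in> space coin_space. \<eta> (0, 1)}"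
  proof (rule set_eqI)
    fix \<eta>
    show "\<eta> \<in> coin_stack 0 -` {c \<in> space coin_stack_space. c 1} \<inter> space coin_space \<longleftrightarrow> \<eta> \<in> {\<eta> \<in> space coin_space. \<eta> (0, 1)}"
      using measurable_space[OF measurable_coin_stack[of 0], of \<eta>] by (auto simp: coin_stack_def)
  qed
  then show ?thesis using measure_coin_stack_law[OF s, of 0] prob_coin[of 1] by simp
qed

text \<open>
The first coin belongs to site \<open>0\<close>, the excursion to the positive sites.
\<close>

lemma right_excursion:
  "Q.prob {\<eta> \<in> space coin_space. \<eta> (0, 1) \<and> (\<forall>m\<in>{1..Suc n}. erw 0 \<eta> m \<noteq> 0)} = (\<integral>\<omega>. \<omega> (0, 1) \<partial>P) * lifetime n"
proof -
  define ext :: "(int \<Rightarrow> nat \<Rightarrow> bool) \<Rightarrow> int \<times> nat \<Rightarrow> bool" where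
    "ext = (\<lambda>s. \<lambda>p\<in>cookies. if fst p \<ge> 1 then s (fst p) (snd p) else False)"
  let ?N0 = "PiM {0} (\<lambda>_::int. coin_stack_space)" and ?N1 = "PiM {1..} (\<lambda>_::int. coin_stack_space)"
  define E where "E = {s \<in> space ?N0. s 0 1}"
  define F where "F = {s \<in> space ?N1. hitting_time 0 (erw 1 (ext s)) > enat n}"
  have E: "E \<in> sets ?N0"
  proof -
    have "(\<lambda>s. s 0 1) \<in> measurable ?N0 (count_space (UNIV :: bool set))"
      by (rule measurable_compose[where f = "\<lambda>s. s 0" and g = "\<lambda>c. c 1" and N = coin_stack_space])
        (auto intro!: measurable_component_singleton)
    then show ?thesis unfolding E_def by (simp only: pred_def)
  qed
  have extm: "ext \<in> measurable ?N1 coin_space"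
    unfolding ext_def
  proof (rule measurable_restrict)
    fix p :: "int \<times> nat" assume p: "p \<in> cookies"
    show "(\<lambda>s. if fst p \<ge> 1 then s (fst p) (snd p) else False) \<in> measurable ?N1 (count_space UNIV)"
    proof (cases "fst p \<ge> 1")
      case True
      have "(\<lambda>s. s (fst p) (snd p)) \<in> measurable ?N1 (count_space UNIV)"
        by (rule measurable_compose[where f = "\<lambda>s. s (fst p)" and g = "\<lambda>c. c (snd p)" and N = coin_stack_space])
          (use True p in \<open>auto intro!: measurable_component_singleton\<close>)
      then show ?thesis using True by simp
    qed simp
  qed
  have F: "F \<in> sets ?N1"
  proof -
    have "Measurable.pred ?N1 (\<lambda>s. hitting_time 0 (erw 1 (ext s)) > enat n)"
      by (rule measurable_compose[OF measurable_compose[OF extm measurable_erw] pred_hitting_time_greater])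
    then show ?thesis unfolding F_def by (simp only: pred_def)
  qed
  have sp: "restrict (\<lambda>y. coin_stack y \<eta>) A \<in> space (PiM A (\<lambda>_. coin_stack_space))" for \<eta> A
    by (auto simp: space_PiM coin_stack_def)
  have Ei: "restrict (\<lambda>y. coin_stack y \<eta>) {0} \<in> E \<longleftrightarrow> \<eta> (0, 1)" for \<eta>
    using sp[of \<eta> "{0}"] by (simp add: E_def coin_stack_def)
  have Fi: "restrict (\<lambda>y. coin_stack y \<eta>) {1..} \<in> F \<longleftrightarrow> hitting_time 0 (erw 1 \<eta>) > enat n" for \<eta>
  proof -
    have "(\<forall>m\<le>n. erw 1 (ext (restrict (\<lambda>y. coin_stack y \<eta>) {1..})) m \<noteq> 0) \<longleftrightarrow> (\<forall>m\<le>n. erw 1 \<eta> m \<noteq> 0)"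
      by (rule erw_avoid_cong) (auto simp: ext_def coin_stack_def)
    then show ?thesis using sp[of \<eta> "{1..}"] unfolding F_def mem_Collect_eq hitting_time_greater_iff by blast
  qed
  have "{0} \<inter> {1::int..} = {}" by auto
  from indep_stacks_prob[OF this E F]
  have "Q.prob {\<eta> \<in> space coin_space. \<eta> (0, 1) \<and> hitting_time 0 (erw 1 \<eta>) > enat n} = (\<integral>\<omega>. \<omega> (0, 1) \<partial>P) * lifetime n"
    unfolding Ei Fi lifetime_eq prob_first_coin .
  moreover have "{\<eta> \<in> space coin_space. \<eta> (0, 1) \<and> (\<forall>m\<in>{1..Suc n}. erw 0 \<eta> m \<noteq> 0)}
      = {\<eta> \<in> space coin_space. \<eta> (0, 1) \<and> hitting_time 0 (erw 1 \<eta>) > enat n}"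
    unfolding hitting_time_greater_iff using return_avoid_iff by blast
  ultimately show ?thesis by simp
qed

end

section \<open>Reflection and the return time\<close>

definition flip_stack :: "(nat \<Rightarrow> real) \<Rightarrow> nat \<Rightarrow> real" where
  "flip_stack w = (\<lambda>i\<in>{1..}. 1 - w i)"

text \<open>
Mirrors the sites but keeps the cookies; composed with \<open>reflect\<close> it describes what the mirrored walk sees.
\<close>

definition space_reflect :: "(int \<times> nat \<Rightarrow> real) \<Rightarrow> int \<times> nat \<Rightarrow> real" where
  "space_reflect \<omega> = (\<lambda>k\<in>cookies. \<omega> (- fst k, snd k))"

lemma measurable_flip_stack: "flip_stack \<in> measurable stack_space stack_space"
proof -
  have "(\<lambda>w. 1 - w i) \<in> measurable stack_space unit_interval" if i: "i \<in> {1..}" for i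
  proof (rule measurable_restrict_space2)
    show "(\<lambda>w. 1 - w i) \<in> space stack_space \<rightarrow> {0..1}"
      using i by (auto simp: stack_space_def space_PiM space_restrict_space PiE_iff)
    have "(\<lambda>w. w i) \<in> measurable stack_space unit_interval"
      unfolding stack_space_def using i by (rule measurable_component_singleton)
    then have "(\<lambda>w. w i) \<in> borel_measurable stack_space"
      by (simp add: measurable_restrict_space2_iff)
    then show "(\<lambda>w. 1 - w i) \<in> borel_measurable stack_space" by simp
  qed
  then show ?thesis unfolding flip_stack_def stack_space_def by (intro measurable_restrict)
qed

lemma stack_reflect: "stack x (reflect \<omega>) = flip_stack (stack x \<omega>)"
  by (auto simp: stack_def reflect_def flip_stack_def fun_eq_iff)

lemma measurable_space_reflect: "space_reflect \<in> measurable env_space env_space"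
  unfolding space_reflect_def env_space_def
  by (rule measurable_restrict) (auto intro!: measurable_component_singleton)

lemma bernoulli_reflect:
  assumes "0 \<le> p" "p \<le> 1"
  shows "bernoulli_pmf (1 - p) = map_pmf Not (bernoulli_pmf p)"
proof (rule pmf_eqI)
  fix b
  have "Not -` {b} = {\<not> b}" by auto
  then show "pmf (bernoulli_pmf (1 - p)) b = pmf (map_pmf Not (bernoulli_pmf p)) b"
    using assms by (cases b) (auto simp: pmf_map measure_pmf_single)
qed

lemma measurable_mirror: "mirror \<in> measurable coin_space coin_space"
  unfolding mirror_def
proof (rule measurable_restrict)
  fix k :: "int \<times> nat" assume k: "k \<in> cookies"
  have "(\<lambda>\<eta>. \<eta> (- fst k, snd k)) \<in> measurable coin_space (count_space (UNIV :: bool set))"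
    using k by (intro measurable_component_singleton) auto
  then show "(\<lambda>\<eta>. \<not> \<eta> (- fst k, snd k)) \<in> measurable coin_space (count_space UNIV)"
    by (rule measurable_compose[where g = Not]) simp
qed

text \<open>
Mirroring the coins exchanges heads and tails, which replaces a bias \<open>p\<close> by \<open>1 - p\<close>, and moves the coin from \<open>x\<close> to \<open>-x\<close>.
\<close>

lemma distr_mirror:
  assumes \<omega>: "\<omega> \<in> space env_space"
  shows "distr (coin_measure \<omega>) coin_space mirror = coin_measure (reflect (space_reflect \<omega>))"
proof -
  let ?\<omega>' = "reflect (space_reflect \<omega>)"
  let ?\<sigma> = "\<lambda>k :: int \<times> nat. (- fst k, snd k)"
  interpret B: product_prob_space "\<lambda>k. measure_pmf (bernoulli_pmf (\<omega> k))" cookies by unfold_locales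
  interpret B': product_prob_space "\<lambda>k. measure_pmf (bernoulli_pmf (?\<omega>' k))" cookies by unfold_locales
  have sp: "space (coin_measure \<omega>) = space coin_space" by (rule sets_eq_imp_space_eq[OF sets_coin_measure])
  have spP: "space (PiM cookies (\<lambda>k. measure_pmf (bernoulli_pmf (\<omega> k)))) = space coin_space" for \<omega> :: "int \<times> nat \<Rightarrow> real"
    by (simp add: space_PiM)
  have mm: "mirror \<in> measurable (coin_measure \<omega>) coin_space"
    using measurable_mirror by (simp add: measurable_cong_sets[OF sets_coin_measure refl])
  have "distr (coin_measure \<omega>) coin_space mirror = PiM cookies (\<lambda>k. measure_pmf (bernoulli_pmf (?\<omega>' k)))"
  proof (rule B'.PiM_eq)
    show "sets (distr (coin_measure \<omega>) coin_space mirror) = sets (PiM cookies (\<lambda>k. measure_pmf (bernoulli_pmf (?\<omega>' k))))"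
      using sets_coin_measure[of ?\<omega>'] by (simp add: coin_measure_def)
    fix J :: "(int \<times> nat) set" and F :: "int \<times> nat \<Rightarrow> bool set"
    assume J: "finite J" "J \<subseteq> cookies"
    let ?E = "prod_emb cookies (\<lambda>k. measure_pmf (bernoulli_pmf (?\<omega>' k))) J (Pi\<^sub>E J F)"
    have Es: "?E \<in> sets coin_space"
    proof -
      have "?E \<in> sets (PiM cookies (\<lambda>k. measure_pmf (bernoulli_pmf (?\<omega>' k))))"
        using J by (intro sets_PiM_I) auto
      then show ?thesis using sets_coin_measure[of ?\<omega>'] by (simp add: coin_measure_def)
    qed
    have inj: "inj_on ?\<sigma> J" by (auto simp: inj_on_def prod_eq_iff)
    have "emeasure (distr (coin_measure \<omega>) coin_space mirror) ?E = emeasure (coin_measure \<omega>) (mirror -` ?E \<inter> space (coin_measure \<omega>))"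
      by (rule emeasure_distr[OF mm Es])
    also have "mirror -` ?E \<inter> space (coin_measure \<omega>) = {\<eta> \<in> space coin_space. \<forall>k\<in>?\<sigma> ` J. \<eta> k \<in> Not -` F (?\<sigma> k)}"
    proof (rule set_eqI)
      fix \<eta>
      have "mirror \<eta> \<in> ?E \<longleftrightarrow> (\<forall>k\<in>J. mirror \<eta> k \<in> F k)"
        using J by (auto simp: prod_emb_def mirror_def PiE_iff)
      also have "\<dots> \<longleftrightarrow> (\<forall>k\<in>J. \<eta> (?\<sigma> k) \<in> Not -` F k)"
        using J by (intro ball_cong) (auto simp: mirror_def)
      also have "\<dots> \<longleftrightarrow> (\<forall>k\<in>?\<sigma> ` J. \<eta> k \<in> Not -` F (?\<sigma> k))" by simp
      finally show "\<eta> \<in> mirror -` ?E \<inter> space (coin_measure \<omega>) \<longleftrightarrow> \<eta> \<in> {\<eta> \<in> space coin_space. \<forall>k\<in>?\<sigma> ` J. \<eta> k \<in> Not -` F (?\<sigma> k)}"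
        by (simp only: sp Int_iff vimage_eq mem_Collect_eq conj_commute)
    qed
    also have "emeasure (coin_measure \<omega>) \<dots> = (\<Prod>k\<in>?\<sigma> ` J. emeasure (measure_pmf (bernoulli_pmf (\<omega> k))) (Not -` F (?\<sigma> k)))"
      unfolding coin_measure_def spP[of \<omega>, symmetric]
      by (rule B.emeasure_PiM_Collect) (use J in auto)
    also have "\<dots> = (\<Prod>k\<in>J. emeasure (measure_pmf (bernoulli_pmf (\<omega> (?\<sigma> k)))) (Not -` F k))"
      by (simp add: prod.reindex[OF inj])
    also have "\<dots> = (\<Prod>k\<in>J. emeasure (measure_pmf (bernoulli_pmf (?\<omega>' k))) (F k))"
    proof (rule prod.cong[OF refl])
      fix k assume "k \<in> J"
      then have k: "k \<in> cookies" using J by auto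
      then have w: "?\<omega>' k = 1 - \<omega> (?\<sigma> k)" by (auto simp: reflect_def space_reflect_def)
      have "?\<sigma> k \<in> cookies" using k by auto
      then have "0 \<le> \<omega> (?\<sigma> k)" "\<omega> (?\<sigma> k) \<le> 1" using \<omega> by (auto simp: space_env_space PiE_iff)
      then show "emeasure (measure_pmf (bernoulli_pmf (\<omega> (?\<sigma> k)))) (Not -` F k) = emeasure (measure_pmf (bernoulli_pmf (?\<omega>' k))) (F k)"
        unfolding w by (subst bernoulli_reflect) simp_all
    qed
    finally show "emeasure (distr (coin_measure \<omega>) coin_space mirror) ?E = (\<Prod>k\<in>J. emeasure (measure_pmf (bernoulli_pmf (?\<omega>' k))) (F k))" .
  qed
  then show ?thesis by (simp add: coin_measure_def)
qed

context iid_environment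
begin

lemma distr_stacks:
  "distr P (PiM UNIV (\<lambda>_. stack_space)) (\<lambda>\<omega> x. stack x \<omega>) = PiM UNIV (\<lambda>_::int. distr P stack_space (stack 0))"
proof -
  have "distr P (PiM UNIV (\<lambda>_. stack_space)) (\<lambda>\<omega>. \<lambda>x\<in>UNIV. stack x \<omega>) = PiM UNIV (\<lambda>x. distr P stack_space (stack x))"
    using indep_stacks by (subst (asm) indep_vars_iff_distr_eq_PiM) (auto intro: measurable_stack_P)
  also have "\<dots> = PiM UNIV (\<lambda>_. distr P stack_space (stack 0))"
    by (intro PiM_cong refl distr_stack)
  finally show ?thesis by (simp only: restrict_UNIV)
qed

lemma measurable_stacks: "(\<lambda>\<omega> x. stack x \<omega>) \<in> measurable P (PiM UNIV (\<lambda>_::int. stack_space))"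
  by (rule measurable_PiM_single') (auto intro: measurable_stack_P dest: measurable_space[OF measurable_stack_P])

text \<open>
An environment with i.i.d. stacks is the image of a product of equal factors, and such a product is invariant under permutations of
the sites.
\<close>

lemma distr_space_reflect: "distr P env_space space_reflect = P"
proof -
  let ?S = "PiM UNIV (\<lambda>_::int. stack_space)"
  let ?D = "distr P stack_space (stack 0)"
  define U :: "(int \<Rightarrow> nat \<Rightarrow> real) \<Rightarrow> int \<times> nat \<Rightarrow> real" where "U = (\<lambda>s. \<lambda>k\<in>cookies. s (fst k) (snd k))"
  define G :: "(int \<Rightarrow> nat \<Rightarrow> real) \<Rightarrow> int \<Rightarrow> nat \<Rightarrow> real" where "G = (\<lambda>s x. s (- x))"
  interpret D: prob_space ?D by (rule prob_space_distr[OF measurable_stack_P])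
  have U: "U \<in> measurable ?S env_space"
    unfolding U_def env_space_def
  proof (rule measurable_restrict)
    fix k :: "int \<times> nat" assume k: "k \<in> cookies"
    show "(\<lambda>s. s (fst k) (snd k)) \<in> measurable ?S unit_interval"
      by (rule measurable_compose[where f = "\<lambda>s. s (fst k)" and g = "\<lambda>w. w (snd k)" and N = stack_space])
        (use k in \<open>auto intro!: measurable_component_singleton simp: stack_space_def\<close>)
  qed
  have G: "G \<in> measurable ?S ?S"
    unfolding G_def by (rule measurable_PiM_single') (auto intro!: measurable_component_singleton simp: space_PiM)
  have sD: "sets (PiM UNIV (\<lambda>_::int. ?D)) = sets ?S" by (intro sets_PiM_cong) auto
  have GD: "distr (PiM UNIV (\<lambda>_::int. ?D)) ?S G = PiM UNIV (\<lambda>_::int. ?D)"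
  proof -
    have "distr (PiM UNIV (\<lambda>_::int. ?D)) (PiM UNIV (\<lambda>_::int. ?D)) (\<lambda>s. \<lambda>n\<in>UNIV. s (- n)) = PiM UNIV (\<lambda>_::int. ?D)"
      by (rule distr_PiM_reindex) (auto intro: D.prob_space_axioms)
    moreover have "distr (PiM UNIV (\<lambda>_::int. ?D)) ?S G = distr (PiM UNIV (\<lambda>_::int. ?D)) (PiM UNIV (\<lambda>_::int. ?D)) (\<lambda>s. \<lambda>n\<in>UNIV. s (- n))"
      using sD by (intro distr_cong) (auto simp: G_def)
    ultimately show ?thesis by simp
  qed
  have id: "U (\<lambda>x. stack x \<omega>) = \<omega>" if "\<omega> \<in> space P" for \<omega>
    using that by (auto simp: U_def stack_def space_P space_env_space PiE_iff extensional_def fun_eq_iff)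
  have rf: "U (G (\<lambda>x. stack x \<omega>)) = space_reflect \<omega>" for \<omega>
    by (auto simp: U_def G_def stack_def space_reflect_def fun_eq_iff)
  have "P = distr P env_space (\<lambda>\<omega>. \<omega>)"
    by (rule distr_id2[symmetric]) (simp add: sets_P)
  also have "\<dots> = distr P env_space (U \<circ> (\<lambda>\<omega> x. stack x \<omega>))"
    by (intro distr_cong refl) (simp add: id)
  also have "\<dots> = distr (PiM UNIV (\<lambda>_::int. ?D)) env_space U"
    by (subst distr_distr[OF U measurable_stacks, symmetric]) (simp add: distr_stacks)
  also have "\<dots> = distr (distr (PiM UNIV (\<lambda>_::int. ?D)) ?S G) env_space U" unfolding GD ..
  also have "\<dots> = distr (distr (distr P ?S (\<lambda>\<omega> x. stack x \<omega>)) ?S G) env_space U" unfolding distr_stacks ..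
  also have "\<dots> = distr (distr P ?S (G \<circ> (\<lambda>\<omega> x. stack x \<omega>))) env_space U"
    by (subst distr_distr[OF G measurable_stacks]) simp
  also have "\<dots> = distr P env_space (U \<circ> (G \<circ> (\<lambda>\<omega> x. stack x \<omega>)))"
    by (rule distr_distr[OF U measurable_comp[OF measurable_stacks G]])
  also have "\<dots> = distr P env_space space_reflect"
    by (intro distr_cong refl) (simp add: rf)
  finally show ?thesis by (rule sym)
qed

lemma measurable_reflect_P: "reflect \<in> measurable P env_space"
  using measurable_reflect by (simp add: measurable_cong_sets[OF sets_P refl])

text \<open>
The law of the mirrored coins comes from an environment reflected both in space and in value; the former is invisible.
\<close>

lemma distr_coin_law_mirror: "distr (coin_law P) coin_space mirror = coin_law (reflected_law P)"
proof -
  have ne: "space P \<noteq> {}" by (rule not_empty)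
  have spr: "space_reflect \<in> measurable P env_space"
    using measurable_space_reflect by (simp add: measurable_cong_sets[OF sets_P refl])
  have cm: "coin_measure \<in> measurable env_space (subprob_algebra coin_space)"
    by (rule measurable_prob_algebraD[OF measurable_coin_measure])
  have "distr (coin_law P) coin_space mirror = P \<bind> (\<lambda>\<omega>. distr (coin_measure \<omega>) coin_space mirror)"
    unfolding coin_law_def by (rule distr_bind[OF measurable_coin_measure_P ne measurable_mirror])
  also have "\<dots> = P \<bind> (\<lambda>\<omega>. coin_measure (reflect (space_reflect \<omega>)))"
    by (intro bind_cong refl distr_mirror) (simp add: space_P)
  also have "\<dots> = distr P env_space (reflect \<circ> space_reflect) \<bind> coin_measure"
    by (subst bind_distr[OF measurable_comp[OF spr measurable_reflect] cm ne]) simp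
  also have "distr P env_space (reflect \<circ> space_reflect) = distr (distr P env_space space_reflect) env_space reflect"
    by (rule distr_distr[OF measurable_reflect spr, symmetric])
  also have "\<dots> = reflected_law P" unfolding distr_space_reflect reflected_law_def ..
  finally show ?thesis by (simp add: coin_law_def)
qed

lemma iid_environment_reflected: "iid_environment (reflected_law P)"
proof -
  have ps: "prob_space (reflected_law P)" unfolding reflected_law_def by (rule prob_space_distr[OF measurable_reflect_P])
  have sets: "sets (reflected_law P) = sets env_space" by (simp add: reflected_law_def)
  interpret R: random_environment "reflected_law P"
    by unfold_locales (simp add: environment_law_def ps sets)
  have st: "distr (reflected_law P) stack_space (stack x) = distr (distr P stack_space (stack x)) stack_space flip_stack" for x
    unfolding reflected_law_def
    by (subst distr_distr[OF measurable_stack measurable_reflect_P], subst distr_distr[OF measurable_flip_stack measurable_stack_P])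
      (simp add: comp_def stack_reflect)
  have "R.indep_vars (\<lambda>_. stack_space) stack UNIV"
  proof (subst R.indep_vars_iff_distr_eq_PiM)
    have ms: "(\<lambda>\<omega>. \<lambda>x\<in>UNIV. stack x \<omega>) \<in> measurable env_space (PiM UNIV (\<lambda>_::int. stack_space))"
      by (rule measurable_restrict) (rule measurable_stack)
    have "indep_vars (\<lambda>_. stack_space) (\<lambda>x \<omega>. flip_stack (stack x \<omega>)) UNIV"
      by (rule indep_vars_compose2[OF indep_stacks measurable_flip_stack])
    then have "distr P (PiM UNIV (\<lambda>_. stack_space)) (\<lambda>\<omega>. \<lambda>x\<in>UNIV. flip_stack (stack x \<omega>))
        = PiM UNIV (\<lambda>x. distr P stack_space (\<lambda>\<omega>. flip_stack (stack x \<omega>)))"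
      by (subst (asm) indep_vars_iff_distr_eq_PiM) (auto intro: measurable_compose[OF measurable_stack_P measurable_flip_stack])
    moreover have "distr (reflected_law P) (PiM UNIV (\<lambda>_. stack_space)) (\<lambda>\<omega>. \<lambda>x\<in>UNIV. stack x \<omega>)
        = distr P (PiM UNIV (\<lambda>_. stack_space)) (\<lambda>\<omega>. \<lambda>x\<in>UNIV. flip_stack (stack x \<omega>))"
      unfolding reflected_law_def by (subst distr_distr[OF ms measurable_reflect_P]) (simp add: comp_def stack_reflect)
    moreover have "distr P stack_space (\<lambda>\<omega>. flip_stack (stack x \<omega>)) = distr (reflected_law P) stack_space (stack x)" for x
      unfolding reflected_law_def by (subst distr_distr[OF measurable_stack measurable_reflect_P]) (simp add: comp_def stack_reflect)
    ultimately show "distr (reflected_law P) (PiM UNIV (\<lambda>_. stack_space)) (\<lambda>\<omega>. \<lambda>x\<in>UNIV. stack x \<omega>)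
        = PiM UNIV (\<lambda>x. distr (reflected_law P) stack_space (stack x))" by simp
  qed (auto intro: R.measurable_stack_P)
  moreover have "distr (reflected_law P) stack_space (stack x) = distr (reflected_law P) stack_space (stack y)" for x y
    using distr_stack[of x] distr_stack[of y] by (simp only: st)
  ultimately show ?thesis by unfold_locales (simp add: iid_stacks_def)
qed

end

context cookie_environment
begin

lemma borel_measurable_cookie: "i \<ge> 1 \<Longrightarrow> (\<lambda>\<omega>. \<omega> (x, i)) \<in> borel_measurable env_space"
  using measurable_cookie[of i x] by (simp add: measurable_cong_sets[OF sets_P refl])

lemma prob_reflected:
  assumes "Measurable.pred env_space A"
  shows "\<P>(\<omega> in reflected_law P. A \<omega>) = \<P>(\<omega> in P. A (reflect \<omega>))"
proof -
  have "{\<omega> \<in> space env_space. A \<omega>} \<in> sets env_space" using assms by (simp only: pred_def)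
  from measure_distr[OF measurable_reflect_P this]
  have "measure (reflected_law P) {\<omega> \<in> space env_space. A \<omega>} = prob (reflect -` {\<omega> \<in> space env_space. A \<omega>} \<inter> space P)"
    by (simp add: reflected_law_def)
  also have "reflect -` {\<omega> \<in> space env_space. A \<omega>} \<inter> space P = {\<omega> \<in> space P. A (reflect \<omega>)}"
    using measurable_space[OF measurable_reflect_P] by auto
  finally show ?thesis by (simp add: reflected_law_def)
qed

lemma cookie_environment_reflected: "cookie_environment (reflected_law P) M"
proof -
  interpret R: iid_environment "reflected_law P" by (rule iid_environment_reflected)
  have pd: "Measurable.pred env_space (\<lambda>\<omega>. \<forall>i\<ge>1. Q (\<omega> (x, i)))"
    if "Measurable.pred borel Q" for Q :: "real \<Rightarrow> bool" and x
  proof -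
    have "Measurable.pred env_space (\<lambda>\<omega>. Q (\<omega> (x, Suc i)))" for i
      by (rule measurable_compose[OF borel_measurable_cookie that]) simp
    then have "Measurable.pred env_space (\<lambda>\<omega>. \<forall>i. Q (\<omega> (x, Suc i)))"
      by (intro pred_intros_countable)
    moreover have "(\<forall>i\<ge>1. R i) \<longleftrightarrow> (\<forall>i. R (Suc i))" for R :: "nat \<Rightarrow> bool"
    proof
      assume *: "\<forall>i. R (Suc i)"
      show "\<forall>i\<ge>1. R i"
      proof (intro allI impI)
        fix i :: nat assume "i \<ge> 1"
        then have "Suc (i - 1) = i" by simp
        then show "R i" using * by metis
      qed
    qed simp
    ultimately show ?thesis by simp
  qed
  have r: "(\<forall>i\<ge>1. 0 < reflect \<omega> (x, i)) \<longleftrightarrow> (\<forall>i\<ge>1. \<omega> (x, i) < 1)"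
    "(\<forall>i\<ge>1. reflect \<omega> (x, i) < 1) \<longleftrightarrow> (\<forall>i\<ge>1. 0 < \<omega> (x, i))" for \<omega> x
    by (auto simp: reflect_def)
  have "weakly_elliptic (reflected_law P)"
    unfolding weakly_elliptic_def
  proof (intro allI conjI)
    fix x
    have "\<P>(\<omega> in reflected_law P. \<forall>i\<ge>1. 0 < \<omega> (x, i)) = \<P>(\<omega> in P. \<forall>i\<ge>1. \<omega> (x, i) < 1)"
      by (subst prob_reflected[OF pd[of "\<lambda>z. 0 < z"]]) (simp_all only: r, measurable)
    then show "0 < \<P>(\<omega> in reflected_law P. \<forall>i\<ge>1. 0 < \<omega> (x, i))" using elliptic by (simp add: weakly_elliptic_def)
    have "\<P>(\<omega> in reflected_law P. \<forall>i\<ge>1. \<omega> (x, i) < 1) = \<P>(\<omega> in P. \<forall>i\<ge>1. 0 < \<omega> (x, i))"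
      by (subst prob_reflected[OF pd[of "\<lambda>z. z < 1"]]) (simp_all only: r, measurable)
    then show "0 < \<P>(\<omega> in reflected_law P. \<forall>i\<ge>1. \<omega> (x, i) < 1)" using elliptic by (simp add: weakly_elliptic_def)
  qed
  moreover have "bounded_cookies (reflected_law P) M"
  proof -
    have "Measurable.pred env_space (\<lambda>\<omega>. \<omega> (x, i) = 1 / 2)" if "i > M" for x i
      by (rule measurable_compose[OF borel_measurable_cookie, where g = "\<lambda>z. z = 1 / 2"]) (use that in auto)
    then have "Measurable.pred env_space (\<lambda>\<omega>. \<forall>x. \<forall>i\<in>{M<..}. \<omega> (x, i) = 1 / 2)"
      by (intro pred_intros_countable pred_intros_countable_bounded) auto
    then have p: "Measurable.pred env_space (\<lambda>\<omega>. \<forall>x. \<forall>i>M. \<omega> (x, i) = 1 / 2)"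
      by (simp only: greaterThan_iff Ball_def)
    have "(\<forall>x. \<forall>i>M. reflect \<omega> (x, i) = 1 / 2) \<longleftrightarrow> (\<forall>x. \<forall>i>M. \<omega> (x, i) = 1 / 2)" for \<omega>
      by (auto simp: reflect_def field_simps)
    then show ?thesis
      using bounded unfolding bounded_cookies_def prob_reflected[OF p] by simp
  qed
  ultimately show ?thesis by unfold_locales
qed

lemma integral_reflected_cookie:
  assumes "i \<ge> 1"
  shows "(\<integral>\<omega>. \<omega> (x, i) \<partial>reflected_law P) = (\<integral>\<omega>. 1 - \<omega> (x, i) \<partial>P)"
  unfolding reflected_law_def
  by (subst integral_distr[OF measurable_reflect_P borel_measurable_cookie[OF assms]])
    (use assms in \<open>simp add: reflect_def\<close>)

lemma drift_reflected: "drift (reflected_law P) M = - drift P M"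
proof -
  interpret R: cookie_environment "reflected_law P" M by (rule cookie_environment_reflected)
  have "drift (reflected_law P) M = (\<Sum>i=1..M. 2 * (\<integral>\<omega>. \<omega> (0, i) \<partial>reflected_law P) - 1)"
    unfolding drift_def using R.integrable_cookie R.prob_space
    by (subst Bochner_Integration.integral_sum) auto
  also have "\<dots> = (\<Sum>i=1..M. - (2 * (\<integral>\<omega>. \<omega> (0, i) \<partial>P) - 1))"
    by (intro sum.cong refl) (use integrable_cookie prob_space in \<open>simp add: integral_reflected_cookie\<close>)
  also have "\<dots> = - drift P M"
    unfolding drift_def sum_negf using integrable_cookie prob_space
    by (subst Bochner_Integration.integral_sum) auto
  finally show ?thesis .
qed

theorem return_decomposition:
  "averaged_prob P 0 (\<lambda>X. return_time X > enat (Suc n))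
    = (\<integral>\<omega>. \<omega> (0, 1) \<partial>P) * lifetime n
      + (\<integral>\<omega>. 1 - \<omega> (0, 1) \<partial>P) * averaged_prob (reflected_law P) 1 (\<lambda>X. hitting_time 0 X > enat n)"
proof -
  interpret R: cookie_environment "reflected_law P" M by (rule cookie_environment_reflected)
  define A where "A = (\<lambda>b. {\<eta> \<in> space coin_space. \<eta> (0, 1) = b \<and> (\<forall>m\<in>{1..Suc n}. erw 0 \<eta> m \<noteq> 0)})"
  have A: "A b \<in> sets coin_space" for b
  proof -
    have "(\<lambda>\<eta>. \<eta> (0, 1)) \<in> measurable coin_space (count_space (UNIV :: bool set))"
      by (rule measurable_component_singleton) simp
    then have 1: "Measurable.pred coin_space (\<lambda>\<eta>. \<eta> (0, 1) = b)"
      by (rule measurable_compose[where g = "\<lambda>x. x = b"]) simp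
    have 2: "Measurable.pred coin_space (\<lambda>\<eta>. return_time (erw 0 \<eta>) > enat (Suc n))"
      by (rule measurable_compose[OF measurable_erw pred_return_time_greater])
    have "Measurable.pred coin_space (\<lambda>\<eta>. \<eta> (0, 1) = b \<and> return_time (erw 0 \<eta>) > enat (Suc n))"
      using 1 2 by (rule pred_intros_logic)
    then show ?thesis unfolding A_def return_time_greater_iff by (simp only: pred_def)
  qed
  have "averaged_prob P 0 (\<lambda>X. return_time X > enat (Suc n)) = Q.prob {\<eta> \<in> space coin_space. return_time (erw 0 \<eta>) > enat (Suc n)}"
    by (rule averaged_prob_eq[OF pred_return_time_greater])
  also have "{\<eta> \<in> space coin_space. return_time (erw 0 \<eta>) > enat (Suc n)} = A True \<union> A False"
    unfolding A_def return_time_greater_iff by auto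
  also have "Q.prob (A True \<union> A False) = Q.prob (A True) + Q.prob (A False)"
  proof (rule Q.finite_measure_Union)
    show "A True \<inter> A False = {}" by (auto simp: A_def)
  qed (simp_all only: sets_coin_law A)
  also have "Q.prob (A True) = (\<integral>\<omega>. \<omega> (0, 1) \<partial>P) * lifetime n"
    using right_excursion[of n] by (simp only: A_def eq_True)
  also have "Q.prob (A False) = R.Q.prob (A True)"
  proof -
    have mm: "mirror \<in> measurable (coin_law P) coin_space" by (rule measurable_coin_law[OF measurable_mirror])
    have "R.Q.prob (A True) = measure (distr (coin_law P) coin_space mirror) (A True)"
      unfolding distr_coin_law_mirror ..
    also have "\<dots> = Q.prob (mirror -` A True \<inter> space (coin_law P))"
      by (rule measure_distr[OF mm A])
    also have "mirror -` A True \<inter> space (coin_law P) = A False"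
    proof (rule set_eqI)
      fix \<eta>
      have "mirror \<eta> \<in> space coin_space" by (auto simp: space_PiM mirror_def)
      moreover have "mirror \<eta> (0, 1) \<longleftrightarrow> \<not> \<eta> (0, 1)" by (simp add: mirror_def)
      ultimately show "\<eta> \<in> mirror -` A True \<inter> space (coin_law P) \<longleftrightarrow> \<eta> \<in> A False"
        by (auto simp: A_def space_coin_law erw_mirror simp del: erw.simps)
    qed
    finally show ?thesis by (rule sym)
  qed
  also have "\<dots> = (\<integral>\<omega>. \<omega> (0, 1) \<partial>reflected_law P) * R.lifetime n"
    using R.right_excursion[of n] by (simp only: A_def eq_True)
  finally show ?thesis by (simp add: integral_reflected_cookie R.lifetime_def)
qed

lemma lifetime_critical:
  assumes "drift P M = 1"
  obtains c where "c > 0"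
    "(\<lambda>n. ln (real n) * averaged_prob P 1 (\<lambda>X. hitting_time (int n) X < hitting_time 0 X)) \<longlonglongrightarrow> c"
    "(\<lambda>n. ln (real n) * lifetime n) \<longlonglongrightarrow> 2 * c"
proof -
  interpret critical_cookie_chain coin_pmf M
    by unfold_locales (simp add: mean_drift_eq assms)
  define c where "c = lim mean_log"
  have "(\<lambda>n. ln (real n) * averaged_prob P 1 (\<lambda>X. hitting_time (int n) X < hitting_time 0 X)) \<longlonglongrightarrow> c"
  proof -
    have "(\<lambda>n. (ln (real (Suc n)) / ln (real n)) * (ln (real n) * survival n)) \<longlonglongrightarrow> 1 * c"
      unfolding c_def by (intro tendsto_mult survival_asymptotics) real_asymp
    moreover have "\<forall>\<^sub>F n in sequentially. (ln (real (Suc n)) / ln (real n)) * (ln (real n) * survival n)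
        = ln (real (Suc n)) * averaged_prob P 1 (\<lambda>X. hitting_time (int (Suc n)) X < hitting_time 0 X)"
      using eventually_ge_at_top[of 2]
    proof eventually_elim
      case (elim n)
      have "averaged_prob P 1 (\<lambda>X. hitting_time (int (Suc n)) X < hitting_time 0 X) = survival n"
        using prob_reach[of "Suc n"] by simp
      then show ?case using elim by (simp only:) simp
    qed
    ultimately have "(\<lambda>n. ln (real (Suc n)) * averaged_prob P 1 (\<lambda>X. hitting_time (int (Suc n)) X < hitting_time 0 X)) \<longlonglongrightarrow> c"
      by (simp only: mult_1_left) (rule Lim_transform_eventually)
    then show ?thesis by (rule LIMSEQ_imp_Suc)
  qed
  moreover have "(\<lambda>n. ln (real n) * lifetime n) \<longlonglongrightarrow> 2 * c"
    unfolding c_def by (rule lifetime_asymptotics[OF lifetime_upper lifetime_lower])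
  ultimately show ?thesis using that mean_log_limit_positive by (simp add: c_def)
qed

text \<open>
Height \<open>n powr (1/3)\<close> balances the two terms of \<open>lifetime_upper\<close> well enough: both are a negative power of \<open>n\<close>.
\<close>

lemma lifetime_subcritical:
  assumes "drift P M = - 1"
  shows "(\<lambda>n. ln (real n) * lifetime n) \<longlonglongrightarrow> 0"
proof -
  obtain C where C: "\<And>n. n \<ge> 1 \<Longrightarrow> survival n \<le> C / real n"
    using survival_subcritical mean_drift_eq assms by metis
  define N where "N = (\<lambda>n::nat. nat \<lfloor>real n powr (1 / 3)\<rfloor>)"
  have Nr: "real (N n) = real_of_int \<lfloor>real n powr (1 / 3)\<rfloor>" for n by (simp add: N_def)
  define u where "u = (\<lambda>n. C * (ln (real n) / real (N n)) + (ln (real n) / real n + 2 * (ln (real n) * real (N n) / real n) + 2 * real M * (ln (real n) * real (N n) ^ 2 / real n)))"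
  have "u \<longlonglongrightarrow> C * 0 + (0 + 2 * 0 + 2 * real M * 0)"
    unfolding u_def Nr by (intro tendsto_intros; real_asymp)
  then have u0: "u \<longlonglongrightarrow> 0" by simp
  have le: "\<forall>\<^sub>F n in sequentially. ln (real n) * lifetime n \<le> u n"
    using eventually_ge_at_top[of 1]
  proof eventually_elim
    case (elim n)
    have "real n powr (1 / 3) \<ge> 1" using elim by (intro ge_one_powr_ge_zero) auto
    then have N1: "N n \<ge> 1" by (simp add: N_def le_nat_iff)
    have "lifetime n \<le> C / real (N n) + (1 + 2 * real (N n) * (1 + real M * real (N n))) / real n"
      using lifetime_upper[OF elim, of "N n"] C[OF N1] by linarith
    then have "ln (real n) * lifetime n \<le> ln (real n) * (C / real (N n) + (1 + 2 * real (N n) * (1 + real M * real (N n))) / real n)"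
      using elim by (intro mult_left_mono) auto
    also have "\<dots> = u n" unfolding u_def by (simp add: field_simps power2_eq_square add_divide_distrib)
    finally show ?case .
  qed
  have "\<forall>\<^sub>F n in sequentially. 0 \<le> ln (real n) * lifetime n"
    using eventually_ge_at_top[of 1] by eventually_elim (auto intro!: mult_nonneg_nonneg lifetime_nonneg)
  from tendsto_sandwich[OF this le tendsto_const u0] show ?thesis .
qed

lemma return_limit:
  assumes "(\<lambda>n. ln (real n) * lifetime n) \<longlonglongrightarrow> a"
    and "(\<lambda>n. ln (real n) * averaged_prob (reflected_law P) 1 (\<lambda>X. hitting_time 0 X > enat n)) \<longlonglongrightarrow> b"
  shows "(\<lambda>n. ln (real n) * averaged_prob P 0 (\<lambda>X. return_time X > enat n))
    \<longlonglongrightarrow> a * (\<integral>\<omega>. \<omega> (0, 1) \<partial>P) + b * (\<integral>\<omega>. 1 - \<omega> (0, 1) \<partial>P)"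
proof -
  define p where "p = (\<integral>\<omega>. \<omega> (0, 1) \<partial>P)"
  define q where "q = (\<integral>\<omega>. 1 - \<omega> (0, 1) \<partial>P)"
  define l' where "l' = (\<lambda>n. averaged_prob (reflected_law P) 1 (\<lambda>X. hitting_time 0 X > enat n))"
  have "(\<lambda>n. (ln (real (Suc n)) / ln (real n)) * ((ln (real n) * lifetime n) * p + (ln (real n) * l' n) * q)) \<longlonglongrightarrow> 1 * (a * p + b * q)"
    using assms unfolding l'_def by (intro tendsto_mult tendsto_add tendsto_const) (auto, real_asymp)
  moreover have "\<forall>\<^sub>F n in sequentially. (ln (real (Suc n)) / ln (real n)) * ((ln (real n) * lifetime n) * p + (ln (real n) * l' n) * q)
     = ln (real (Suc n)) * averaged_prob P 0 (\<lambda>X. return_time X > enat (Suc n))"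
    using eventually_ge_at_top[of 2]
  proof eventually_elim
    case (elim n)
    then have "ln (real n) > 0" by simp
    moreover have "averaged_prob P 0 (\<lambda>X. return_time X > enat (Suc n)) = p * lifetime n + q * l' n"
      by (simp only: return_decomposition p_def q_def l'_def)
    ultimately show ?case by (simp add: field_simps)
  qed
  ultimately have "(\<lambda>n. ln (real (Suc n)) * averaged_prob P 0 (\<lambda>X. return_time X > enat (Suc n))) \<longlonglongrightarrow> a * p + b * q"
    by (simp only: mult_1_left) (rule Lim_transform_eventually)
  then show ?thesis unfolding p_def q_def by (rule LIMSEQ_imp_Suc)
qed

end

theorem theorem1p3:
  fixes P :: "(int \<times> nat \<Rightarrow> real) measure" and M :: nat
  assumes "environment_law P"
    and "iid_stacks P"
    and "weakly_elliptic P"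
    and "bounded_cookies P M"
  shows
    "(drift P M = 1 \<longrightarrow>
        (\<exists>c\<^sub>4>0.
           (\<lambda>n. ln (real n) * averaged_prob P 1 (\<lambda>X. hitting_time (int n) X < hitting_time 0 X))
             \<longlonglongrightarrow> c\<^sub>4 \<and>
           (\<lambda>n. ln (real n) * averaged_prob P 1 (\<lambda>X. hitting_time 0 X > enat n))
             \<longlonglongrightarrow> 2 * c\<^sub>4 \<and>
           (\<lambda>n. ln (real n) * averaged_prob P 0 (\<lambda>X. return_time X > enat n))
             \<longlonglongrightarrow> 2 * c\<^sub>4 * (\<integral>\<omega>. \<omega> (0, 1) \<partial>P))) \<and>
     (drift P M = -1 \<longrightarrow>
        drift (reflected_law P) M = 1 \<and>
        (\<exists>c\<^sub>4>0.
           (\<lambda>n. ln (real n) * averaged_prob (reflected_law P) 1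
                 (\<lambda>X. hitting_time (int n) X < hitting_time 0 X)) \<longlonglongrightarrow> c\<^sub>4 \<and>
           (\<lambda>n. ln (real n) * averaged_prob (reflected_law P) 1
                 (\<lambda>X. hitting_time 0 X > enat n)) \<longlonglongrightarrow> 2 * c\<^sub>4 \<and>
           (\<lambda>n. ln (real n) * averaged_prob P 0 (\<lambda>X. return_time X > enat n))
             \<longlonglongrightarrow> 2 * c\<^sub>4 * (\<integral>\<omega>. 1 - \<omega> (0, 1) \<partial>P)))"
proof -
  interpret cookie_environment P M by unfold_locales fact+
  interpret R: cookie_environment "reflected_law P" M by (rule cookie_environment_reflected)
  show ?thesis
  proof (intro conjI impI)
    assume d: "drift P M = 1"
    obtain c where c: "c > 0"
      "(\<lambda>n. ln (real n) * averaged_prob P 1 (\<lambda>X. hitting_time (int n) X < hitting_time 0 X)) \<longlonglongrightarrow> c"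
      "(\<lambda>n. ln (real n) * lifetime n) \<longlonglongrightarrow> 2 * c"
      using lifetime_critical[OF d] .
    have "(\<lambda>n. ln (real n) * R.lifetime n) \<longlonglongrightarrow> 0"
      by (rule R.lifetime_subcritical) (simp add: drift_reflected d)
    from return_limit[OF c(3) this[unfolded R.lifetime_def]]
    have "(\<lambda>n. ln (real n) * averaged_prob P 0 (\<lambda>X. return_time X > enat n)) \<longlonglongrightarrow> 2 * c * (\<integral>\<omega>. \<omega> (0, 1) \<partial>P)"
      by (simp only: mult_zero_left add_0_right)
    with c show "\<exists>c\<^sub>4>0.
           (\<lambda>n. ln (real n) * averaged_prob P 1 (\<lambda>X. hitting_time (int n) X < hitting_time 0 X))
             \<longlonglongrightarrow> c\<^sub>4 \<and>
           (\<lambda>n. ln (real n) * averaged_prob P 1 (\<lambda>X. hitting_time 0 X > enat n))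
             \<longlonglongrightarrow> 2 * c\<^sub>4 \<and>
           (\<lambda>n. ln (real n) * averaged_prob P 0 (\<lambda>X. return_time X > enat n))
             \<longlonglongrightarrow> 2 * c\<^sub>4 * (\<integral>\<omega>. \<omega> (0, 1) \<partial>P)"
      unfolding lifetime_def by blast
  next
    assume d: "drift P M = - 1"
    show dR: "drift (reflected_law P) M = 1" by (simp add: drift_reflected d)
    obtain c where c: "c > 0"
      "(\<lambda>n. ln (real n) * averaged_prob (reflected_law P) 1 (\<lambda>X. hitting_time (int n) X < hitting_time 0 X)) \<longlonglongrightarrow> c"
      "(\<lambda>n. ln (real n) * R.lifetime n) \<longlonglongrightarrow> 2 * c"
      using R.lifetime_critical[OF dR] .
    from return_limit[OF lifetime_subcritical[OF d] c(3)[unfolded R.lifetime_def]]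
    have "(\<lambda>n. ln (real n) * averaged_prob P 0 (\<lambda>X. return_time X > enat n)) \<longlonglongrightarrow> 2 * c * (\<integral>\<omega>. 1 - \<omega> (0, 1) \<partial>P)"
      by (simp only: mult_zero_left add_0_left)
    with c show "\<exists>c\<^sub>4>0.
           (\<lambda>n. ln (real n) * averaged_prob (reflected_law P) 1
                 (\<lambda>X. hitting_time (int n) X < hitting_time 0 X)) \<longlonglongrightarrow> c\<^sub>4 \<and>
           (\<lambda>n. ln (real n) * averaged_prob (reflected_law P) 1
                 (\<lambda>X. hitting_time 0 X > enat n)) \<longlonglongrightarrow> 2 * c\<^sub>4 \<and>
           (\<lambda>n. ln (real n) * averaged_prob P 0 (\<lambda>X. return_time X > enat n))
             \<longlonglongrightarrow> 2 * c\<^sub>4 * (\<integral>\<omega>. 1 - \<omega> (0, 1) \<partial>P)"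
      unfolding R.lifetime_def by blast
  qed
qed

end
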